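(* Let $p\ge 3$ be a prime and $k$ a positive integer with $p\nmid k$, and let $\phi_{(p,k)}(x)=x^p+kpx^{p-1}-kp\in\mathbb{Z}[x]$. Suppose that the critical point $a=-k(p-1)$ of $\phi_{(p,k)}$ has infinite forward orbit under $\phi_{(p,k)}$. Then $G_{\mathbb{Q}}(\phi_{(p,k)})$ has finite index in $\mathrm{Aut}(T_\infty)$.
   Context: For a number field $K$ and $\varphi\in K[x]$ of degree $d\ge 2$ such that every iterate $\varphi^n$ ($n\ge1$) is separable, the pre-image tree $T_\infty$ has vertex set $\bigsqcup_{n\ge 0}\varphi^{-n}(0)$ (with $\varphi^{-0}(0)=\{0\}$), and $\alpha\in\varphi^{-n}(0)$, $\beta\in\varphi^{-(n+1)}(0)$ are joined by an edge iff $\varphi(\beta)=\alpha$. $\mathrm{Aut}(T_\infty)$ is its graph automorphism group. $\mathrm{Gal}(\overline{K}/K)$ acts on $T_\infty$ through its action on the sets $\varphi^{-n}(0)$, giving $\rho:\mathrm{Gal}(\overline K/K)\to\mathrm{Aut}(T_\infty)$; $G_K(\varphi)$ denotes its image. *)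

theory Defs
  imports "HOL-Computational_Algebra.Computational_Algebra"
begin

definition phi_pk :: "nat \<Rightarrow> nat \<Rightarrow> complex poly" where
  "phi_pk p k = monom 1 p + monom (of_nat (k * p)) (p - 1) - [:of_nat (k * p):]"

definition poly_iter :: "complex poly \<Rightarrow> nat \<Rightarrow> complex poly" where
  "poly_iter f n = ((\<lambda>q. pcompose f q) ^^ n) [:0, 1:]"

text \<open>Vertices of the pre-image tree: disjoint union of the sets f^{-n}(0), tagged by level n.
  All roots are algebraic, so working inside complex numbers is harmless.\<close>
definition tree_vertices :: "complex poly \<Rightarrow> (nat \<times> complex) set" where
  "tree_vertices f = {(n, z). poly (poly_iter f n) z = 0}"

definition tree_edge :: "complex poly \<Rightarrow> nat \<times> complex \<Rightarrow> nat \<times> complex \<Rightarrow> bool" where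
  "tree_edge f u v \<longleftrightarrow> u \<in> tree_vertices f \<and> v \<in> tree_vertices f \<and>
     ((fst v = Suc (fst u) \<and> poly f (snd v) = snd u) \<or>
      (fst u = Suc (fst v) \<and> poly f (snd u) = snd v))"

definition tree_aut :: "complex poly \<Rightarrow> (nat \<times> complex \<Rightarrow> nat \<times> complex) set" where
  "tree_aut f = {g. bij_betw g (tree_vertices f) (tree_vertices f) \<and>
     (\<forall>u \<in> tree_vertices f. \<forall>v \<in> tree_vertices f. tree_edge f (g u) (g v) \<longleftrightarrow> tree_edge f u v) \<and>
     (\<forall>u. u \<notin> tree_vertices f \<longrightarrow> g u = u)}"

definition galQ :: "(complex \<Rightarrow> complex) set" where
  "galQ = {\<sigma>. bij_betw \<sigma> {z. algebraic z} {z. algebraic z} \<and>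
     (\<forall>x \<in> {z. algebraic z}. \<forall>y \<in> {z. algebraic z}. \<sigma> (x + y) = \<sigma> x + \<sigma> y \<and> \<sigma> (x * y) = \<sigma> x * \<sigma> y)}"

definition galois_action :: "complex poly \<Rightarrow> (complex \<Rightarrow> complex) \<Rightarrow> nat \<times> complex \<Rightarrow> nat \<times> complex" where
  "galois_action f \<sigma> u = (if u \<in> tree_vertices f then (fst u, \<sigma> (snd u)) else u)"

definition arb_galois_group :: "complex poly \<Rightarrow> (nat \<times> complex \<Rightarrow> nat \<times> complex) set" where
  "arb_galois_group f = galois_action f ` galQ"

definition finite_index :: "('a \<Rightarrow> 'a) set \<Rightarrow> ('a \<Rightarrow> 'a) set \<Rightarrow> bool" where
  "finite_index H G \<longleftrightarrow> finite ((\<lambda>g. (\<lambda>h. g \<circ> h) ` H) ` G)"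

end

theory Submission
  imports Defs "Jordan_Normal_Form.Char_Poly" "HOL-Combinatorics.Transposition"
begin

text \<open>
  In fact the Galois group is the whole automorphism group of the tree. Write \<open>\<phi>(x) + kp =
  x\<^sup>p\<^sup>-\<^sup>1 (x + kp)\<close> and \<open>\<phi>\<^sup>n(a) = k c\<^sub>n\<close>. Since \<open>p - 1\<close> is even, \<open>c\<^sub>n + p\<close> is a square times
  \<open>c\<^sub>n\<^sub>-\<^sub>1 + p\<close>, hence a square, as \<open>c\<^sub>0 + p = 1\<close>. So \<open>c\<^sub>n = y\<^sup>2\<close> would give a factorisation
  \<open>p = (z - y) (z + y)\<close>, which pins \<open>c\<^sub>n\<close> down to \<open>((p - 1) / 2)\<^sup>2\<close>; but \<open>c\<^sub>n\<close> is larger for \<open>n \<ge> 1\<close> unless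
  \<open>p = 3\<close> and \<open>k = 1\<close>, where the critical orbit is finite. Therefore some prime \<open>q\<close> divides
  \<open>c\<^sub>n\<close> to an odd power, and it divides neither \<open>k p\<close> nor any earlier \<open>c\<^sub>m\<close>.

  The discriminant of \<open>\<phi>\<^sup>n\<close> is \<open>c\<^sub>n\<close> times a number prime to \<open>q\<close>, so \<open>q\<close> ramifies in the splitting
  field of \<open>\<phi>\<^sup>n\<close>. Modulo a prime above \<open>q\<close> all roots of \<open>\<phi>\<^sup>n\<close> are distinct, except for one pair
  congruent to the critical point, so that a non-trivial inertia element is a transposition inside a
  fibre of \<open>\<phi>\<close>. The Galois group is transitive on each level because \<open>\<phi>\<^sup>n\<close> is Eisenstein at \<open>p\<close>. Since
  the fibres have prime size \<open>p\<close>, conjugates of this transposition generate all permutations of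
  level \<open>n\<close> over level \<open>n - 1\<close>. A compactness argument passes to the infinite tree.
\<close>

subsection \<open>The ring of algebraic integers\<close>

text \<open>Number fields are avoided: the proof works with finite root sets stable under
  \<open>galQ\<close>, with the ring of all algebraic integers in \<open>complex\<close>, and with a
  prime ideal of it containing \<open>q\<close>. The price is that ramification indices and
  decomposition groups are not at hand. The square root of the discriminant takes their place: it
  lies in the field generated by the roots, and after removal of an even power of \<open>q\<close>
  its square is exactly divisible by \<open>q\<close>. Independence of characters modulo the prime
  turns this into an inertia element that moves a root. Two facts rest on the extension of partial
  isomorphisms: Galois-invariant algebraic integers are rational integers, and Galois elements that
  stabilise pointwise have a limit. The critical points 0 and \<open>a\<close> play unequal roles.
  The orbit of 0 is 0, \<open>-kp\<close>, \<open>-kp\<close>, ..., so it contributes to the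
  discriminants only primes dividing \<open>k p\<close>; this is why one critical value controls
  each level.\<close>

lemma monic_annihilator_of_eigenvalue:
  fixes h :: "'a::comm_ring_1 \<Rightarrow> 'b::field"
    and n :: nat
  assumes h: "comm_ring_hom h"
    and e: "\<And>i. i < n \<Longrightarrow> z * v i = (\<Sum>j<n. h (M i j) * v j)"
    and nz: "i < n" "v i \<noteq> 0"
  shows "\<exists>P. lead_coeff P = 1 \<and> poly (map_poly h P) z = 0"
proof -
  interpret comm_ring_hom h by (rule h)
  define A where "A = mat n n (\<lambda>(i, j). M i j)"
  have A: "A \<in> carrier_mat n n" by (simp add: A_def)
  have "eigenvector (map_mat h A) (vec n v) z"
    unfolding eigenvector_def
  proof (intro conjI)
    show "vec n v \<noteq> 0\<^sub>v (dim_row (map_mat h A))"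
      using nz by (metis A carrier_matD(1) index_map_mat(2) index_vec index_zero_vec(1))
    show "map_mat h A *\<^sub>v vec n v = z \<cdot>\<^sub>v vec n v"
      by (rule eq_vecI) (auto simp: A_def scalar_prod_def e lessThan_atLeast0 intro!: sum.cong)
  qed (simp add: A_def)
  then have "poly (char_poly (map_mat h A)) z = 0"
    using eigenvalue_root_char_poly[of "map_mat h A" n] A
    by (auto simp: eigenvalue_def)
  \<comment> \<open>The characteristic polynomial is formed over the source ring, so it is monic
    with coefficients there; only afterwards is it mapped along \<open>h\<close>.\<close>
  moreover have "lead_coeff (char_poly A) = 1"
    using degree_monic_char_poly[OF A] by simp
  ultimately show ?thesis
    using char_poly_hom[OF A] by auto
qed

text \<open>Scalars act through a ring homomorphism \<open>h\<close>, so that one argument serves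
  algebraic integers (\<open>of_int\<close>) and algebraic numbers (\<open>of_rat\<close>).\<close>

definition lin_span :: "('a \<Rightarrow> 'b::field) \<Rightarrow> ('i \<Rightarrow> 'b) \<Rightarrow> 'i set \<Rightarrow> 'b set" where
  "lin_span h v I = range (\<lambda>c. \<Sum>i\<in>I. h (c i) * v i)"

context
  fixes h :: "'a::comm_ring_1 \<Rightarrow> 'b::field"
  assumes h: "comm_ring_hom h"
begin

interpretation comm_ring_hom h by (rule h)

lemma lin_span_add:
  assumes "x \<in> lin_span h v I" "y \<in> lin_span h v I"
  shows "x + y \<in> lin_span h v I"
proof -
  from assms obtain c d where "x = (\<Sum>i\<in>I. h (c i) * v i)" "y = (\<Sum>i\<in>I. h (d i) * v i)"
    by (auto simp: lin_span_def)
  then have "x + y = (\<Sum>i\<in>I. h (c i + d i) * v i)"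
    by (simp add: hom_add algebra_simps sum.distrib)
  then show ?thesis by (auto simp: lin_span_def)
qed

lemma lin_span_scale:
  assumes "x \<in> lin_span h v I"
  shows "h a * x \<in> lin_span h v I"
proof -
  from assms obtain c where "x = (\<Sum>i\<in>I. h (c i) * v i)"
    by (auto simp: lin_span_def)
  then have "h a * x = (\<Sum>i\<in>I. h (a * c i) * v i)"
    by (simp add: hom_mult sum_distrib_left mult.assoc)
  then show ?thesis by (auto simp: lin_span_def)
qed

lemma lin_span_zero: "0 \<in> lin_span h v I"
  unfolding lin_span_def by (rule image_eqI[of _ _ "\<lambda>_. 0"]) (auto simp: hom_zero)

lemma lin_span_sum:
  assumes "\<And>j. j \<in> J \<Longrightarrow> f j \<in> lin_span h v I"
  shows "(\<Sum>j\<in>J. f j) \<in> lin_span h v I"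
  using assms by (induction J rule: infinite_finite_induct) (auto intro: lin_span_add lin_span_zero)

lemma lin_span_base:
  assumes "finite I" "i \<in> I"
  shows "v i \<in> lin_span h v I"
proof -
  have "(\<Sum>j\<in>I. h (if j = i then 1 else 0) * v j) = (\<Sum>j\<in>I. if j = i then v j else 0)"
    by (rule sum.cong) (auto simp: hom_one hom_zero)
  then have "v i = (\<Sum>j\<in>I. h (if j = i then 1 else 0) * v j)"
    using assms by simp
  then show ?thesis
    unfolding lin_span_def by (rule range_eqI[where x = "\<lambda>j. if j = i then 1 else 0"])
qed

lemma lin_span_prod:
  assumes "x \<in> lin_span h v I" "y \<in> lin_span h w J"
  shows "x * y \<in> lin_span h (\<lambda>(i, j). v i * w j) (I \<times> J)"
proof -
  from assms obtain c d where "x = (\<Sum>i\<in>I. h (c i) * v i)" "y = (\<Sum>j\<in>J. h (d j) * w j)"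
    by (auto simp: lin_span_def)
  then have "x * y = (\<Sum>(i,j)\<in>I \<times> J. h (c i * d j) * (v i * w j))"
    by (simp add: sum_product sum.cartesian_product hom_mult mult_ac)
  also have "\<dots> = (\<Sum>u\<in>I \<times> J. h (c (fst u) * d (snd u)) * (case u of (i, j) \<Rightarrow> v i * w j))"
    by (rule sum.cong) auto
  finally show ?thesis
    unfolding lin_span_def by (rule range_eqI[where x = "\<lambda>u. c (fst u) * d (snd u)"])
qed

text \<open>The determinant trick: multiplication by \<open>z\<close> on the generators is a matrix
  over the source ring, and the vector of generators is an eigenvector as soon as one of them is
  nonzero.\<close>

lemma lin_span_stable_imp_monic:
  assumes "finite I" and e: "\<And>i. i \<in> I \<Longrightarrow> z * v i \<in> lin_span h v I"
    and nz: "i \<in> I" "v i \<noteq> 0"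
  shows "\<exists>P. lead_coeff P = 1 \<and> poly (map_poly h P) z = 0"
proof -
  obtain e where b: "bij_betw e {..<card I} I"
    using ex_bij_betw_nat_finite[OF \<open>finite I\<close>] by (auto simp: lessThan_atLeast0)
  have "\<forall>i\<in>I. \<exists>c. z * v i = (\<Sum>j\<in>I. h (c j) * v j)"
    using e by (auto simp: lin_span_def image_iff)
  then obtain c where c: "\<And>i. i \<in> I \<Longrightarrow> z * v i = (\<Sum>j\<in>I. h (c i j) * v j)"
    by metis
  obtain i0 where i0: "i0 < card I" "e i0 = i"
    using b nz by (metis (no_types, lifting) bij_betw_iff_bijections lessThan_iff)
  show ?thesis
  proof (rule monic_annihilator_of_eigenvalue[OF h, of "card I" z "v \<circ> e" "\<lambda>i j. c (e i) (e j)" i0])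
    fix i assume "i < card I"
    then have "e i \<in> I" using b by (auto simp: bij_betw_def)
    then show "z * (v \<circ> e) i = (\<Sum>j<card I. h (c (e i) (e j)) * (v \<circ> e) j)"
      using c sum.reindex_bij_betw[OF b, of "\<lambda>j. h (c (e i) j) * v j"] by simp
  qed (use i0 nz in auto)
qed

text \<open>A monic equation rewrites \<open>x ^ degree P\<close> through lower powers without any
  division; strong induction handles the higher powers.\<close>

lemma power_in_lin_span:
  assumes P: "lead_coeff P = 1" "poly (map_poly h P) x = 0"
  shows "x ^ k \<in> lin_span h (\<lambda>i. x ^ i) {..<degree P}"
proof (induction k rule: less_induct)
  case (less k)
  show ?case
  proof (cases "k < degree P")
    case True
    then show ?thesis using lin_span_base[of "{..<degree P}" k "\<lambda>i. x ^ i"] by auto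
  next
    case False
    have d: "degree (map_poly h P) = degree P"
      using P(1) by (intro degree_map_poly) (auto simp: hom_one)
    have "0 = (\<Sum>i\<le>degree P. h (coeff P i) * x ^ i)"
      using P(2) by (simp add: poly_altdef d coeff_map_poly hom_zero)
    also have "\<dots> = (\<Sum>i<degree P. h (coeff P i) * x ^ i) + x ^ degree P"
      using P(1) by (simp add: lessThan_Suc_atMost[symmetric] hom_one)
    finally have *: "x ^ degree P = (\<Sum>i<degree P. h (- coeff P i) * x ^ i)"
      by (simp add: hom_uminus sum_negf) (metis add.commute add_eq_0_iff)
    have "x ^ k = x ^ degree P * x ^ (k - degree P)"
      using False by (simp add: power_add[symmetric])
    also have "\<dots> = (\<Sum>i<degree P. h (- coeff P i) * x ^ (i + (k - degree P)))"
      by (simp add: * sum_distrib_right power_add mult.assoc)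
    also have "\<dots> \<in> lin_span h (\<lambda>i. x ^ i) {..<degree P}"
      using False by (intro lin_span_sum lin_span_scale less.IH) auto
    finally show ?thesis .
  qed
qed

text \<open>The monomials \<open>x ^ i * y ^ j\<close> with exponents below the two degrees span
  every monomial in \<open>x\<close> and \<open>y\<close>, so multiplication by \<open>x + y\<close>
  and by \<open>x * y\<close> stabilises this span.\<close>

lemma monic_root_closed:
  assumes "lead_coeff P = 1" "poly (map_poly h P) x = 0"
    and "lead_coeff Q = 1" "poly (map_poly h Q) y = 0"
  shows monic_root_add: "\<exists>R. lead_coeff R = 1 \<and> poly (map_poly h R) (x + y) = 0"
    and monic_root_mult: "\<exists>R. lead_coeff R = 1 \<and> poly (map_poly h R) (x * y) = 0"
proof -
  let ?v = "\<lambda>(i, j). x ^ i * y ^ j" and ?I = "{..<degree P} \<times> {..<degree Q}"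
  have mon: "x ^ i * y ^ j \<in> lin_span h ?v ?I" for i j
    using assms by (intro lin_span_prod power_in_lin_span) auto
  \<comment> \<open>Positive degrees make \<open>(0, 0)\<close> an admissible index, whose generator
    1 is the nonzero one required by the determinant trick.\<close>
  have pos: "degree R > 0" if "lead_coeff R = 1" "poly (map_poly h R) z = 0" for R z
  proof (rule ccontr)
    assume "\<not> degree R > 0"
    then obtain c where "R = [:c:]" using degree_eq_zeroE by blast
    with that show False by (simp add: map_poly_pCons hom_one)
  qed
  have z: "(0, 0) \<in> ?I" "?v (0, 0) \<noteq> 0"
    using pos assms by auto
  have "(x + y) * ?v u \<in> lin_span h ?v ?I" for u
  proof (cases u)
    case (Pair i j)
    have "x ^ Suc i * y ^ j + x ^ i * y ^ Suc j \<in> lin_span h ?v ?I"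
      by (intro lin_span_add mon)
    then show ?thesis by (simp add: Pair algebra_simps)
  qed
  then show "\<exists>R. lead_coeff R = 1 \<and> poly (map_poly h R) (x + y) = 0"
    using lin_span_stable_imp_monic[of ?I "x + y" ?v "(0, 0)"] z by auto
  have "(x * y) * ?v u \<in> lin_span h ?v ?I" for u
  proof (cases u)
    case (Pair i j)
    have "x ^ Suc i * y ^ Suc j \<in> lin_span h ?v ?I"
      by (intro mon)
    then show ?thesis by (simp add: Pair algebra_simps)
  qed
  then show "\<exists>R. lead_coeff R = 1 \<and> poly (map_poly h R) (x * y) = 0"
    using lin_span_stable_imp_monic[of ?I "x * y" ?v "(0, 0)"] z by auto
qed

end

section \<open>Closure properties of algebraic integers and algebraic numbers\<close>

lemma comm_ring_hom_of_int: "comm_ring_hom (of_int :: int \<Rightarrow> 'a::comm_ring_1)"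
  by unfold_locales auto

lemma comm_ring_hom_of_rat: "comm_ring_hom (of_rat :: rat \<Rightarrow> 'a::field_char_0)"
  by unfold_locales (auto simp: of_rat_add of_rat_mult)

lemma algebraic_int_add [intro]:
  fixes x y :: "'a::field_char_0"
  assumes "algebraic_int x" "algebraic_int y"
  shows "algebraic_int (x + y)"
  using assms monic_root_add[OF comm_ring_hom_of_int, where ?'b = 'a]
  unfolding algebraic_int_altdef_ipoly by metis

lemma algebraic_int_mult [intro]:
  fixes x y :: "'a::field_char_0"
  assumes "algebraic_int x" "algebraic_int y"
  shows "algebraic_int (x * y)"
  using assms monic_root_mult[OF comm_ring_hom_of_int, where ?'b = 'a]
  unfolding algebraic_int_altdef_ipoly by metis

lemma algebraic_int_diff [intro]:
  fixes x y :: "'a::field_char_0"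
  shows "algebraic_int x \<Longrightarrow> algebraic_int y \<Longrightarrow> algebraic_int (x - y)"
  using algebraic_int_add[of x "- y"] by auto

lemma algebraic_int_1 [simp]: "algebraic_int (1 :: 'a::field_char_0)"
  by (rule int_imp_algebraic_int) auto

lemma algebraic_int_of_int [simp]: "algebraic_int (of_int n :: 'a::field_char_0)"
  by (rule int_imp_algebraic_int) auto

lemma algebraic_int_of_nat [simp]: "algebraic_int (of_nat n :: 'a::field_char_0)"
  by (rule int_imp_algebraic_int) auto

lemma algebraic_int_power [intro]:
  fixes x :: "'a::field_char_0"
  shows "algebraic_int x \<Longrightarrow> algebraic_int (x ^ n)"
  by (induction n) auto

lemma algebraic_int_sum [intro]:
  fixes f :: "'i \<Rightarrow> 'a::field_char_0"
  shows "(\<And>i. i \<in> A \<Longrightarrow> algebraic_int (f i)) \<Longrightarrow> algebraic_int (\<Sum>i\<in>A. f i)"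
  by (induction A rule: infinite_finite_induct) auto

lemma algebraic_int_prod [intro]:
  fixes f :: "'i \<Rightarrow> 'a::field_char_0"
  shows "(\<And>i. i \<in> A \<Longrightarrow> algebraic_int (f i)) \<Longrightarrow> algebraic_int (\<Prod>i\<in>A. f i)"
  by (induction A rule: infinite_finite_induct) auto

lemma algebraic_iff_monic_rat:
  fixes x :: "'a::field_char_0"
  shows "algebraic x \<longleftrightarrow> (\<exists>P::rat poly. lead_coeff P = 1 \<and> poly (map_poly of_rat P) x = 0)"
proof
  assume "algebraic x"
  then obtain p :: "int poly" where p: "p \<noteq> 0" "poly (map_poly of_int p) x = 0"
    by (auto elim: algebraicE')
  define q :: "rat poly" where "q = map_poly of_int p"
  have q0: "q \<noteq> 0" using p(1) by (simp add: q_def poly_eq_iff coeff_map_poly)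
  have "map_poly of_rat q = (map_poly of_int p :: 'a poly)"
    by (simp add: q_def poly_eq_iff coeff_map_poly)
  then have "poly (map_poly of_rat q) x = 0" using p by simp
  moreover have "map_poly of_rat (Polynomial.smult (inverse (lead_coeff q)) q)
      = Polynomial.smult (of_rat (inverse (lead_coeff q))) (map_poly of_rat q :: 'a poly)"
    by (simp add: poly_eq_iff coeff_map_poly of_rat_mult)
  ultimately show "\<exists>P::rat poly. lead_coeff P = 1 \<and> poly (map_poly of_rat P) x = 0"
    using q0 by (intro exI[of _ "Polynomial.smult (inverse (lead_coeff q)) q"]) auto
next
  assume "\<exists>P::rat poly. lead_coeff P = 1 \<and> poly (map_poly of_rat P) x = 0"
  then obtain P :: "rat poly" where "lead_coeff P = 1" "poly (map_poly of_rat P) x = 0" by blast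
  then have "coeff (map_poly of_rat P :: 'a poly) (degree P) = 1"
    by (simp add: coeff_map_poly)
  then have "map_poly of_rat P \<noteq> (0 :: 'a poly)" by auto
  with \<open>poly (map_poly of_rat P) x = 0\<close> show "algebraic x"
    by (intro algebraicI'[of "map_poly of_rat P"]) (auto simp: coeff_map_poly)
qed

lemma algebraic_add [intro]:
  fixes x y :: "'a::field_char_0"
  assumes "algebraic x" "algebraic y"
  shows "algebraic (x + y)"
  using assms monic_root_add[OF comm_ring_hom_of_rat[where ?'a = 'a]]
  unfolding algebraic_iff_monic_rat by metis

lemma algebraic_mult [intro]:
  fixes x y :: "'a::field_char_0"
  assumes "algebraic x" "algebraic y"
  shows "algebraic (x * y)"
  using assms monic_root_mult[OF comm_ring_hom_of_rat[where ?'a = 'a]]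
  unfolding algebraic_iff_monic_rat by metis

lemma algebraic_diff [intro]:
  fixes x y :: "'a::field_char_0"
  shows "algebraic x \<Longrightarrow> algebraic y \<Longrightarrow> algebraic (x - y)"
  using algebraic_add[of x "- y"] by auto

subsection \<open>Extension of partial field isomorphisms\<close>

text \<open>Partial isomorphisms are represented by their graphs.\<close>

definition partial_iso :: "(complex \<times> complex) set \<Rightarrow> bool" where
  "partial_iso \<Gamma> \<longleftrightarrow> (1, 1) \<in> \<Gamma> \<and>
     (\<forall>x y u v. (x, y) \<in> \<Gamma> \<longrightarrow> (u, v) \<in> \<Gamma> \<longrightarrow>
        (x + u, y + v) \<in> \<Gamma> \<and> (x - u, y - v) \<in> \<Gamma> \<and> (x * u, y * v) \<in> \<Gamma>) \<and>
     (\<forall>x y. (x, y) \<in> \<Gamma> \<longrightarrow> (x = 0 \<longleftrightarrow> y = 0))"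

lemma partial_isoD:
  assumes "partial_iso \<Gamma>"
  shows "(1, 1) \<in> \<Gamma>"
    and "(x, y) \<in> \<Gamma> \<Longrightarrow> (u, v) \<in> \<Gamma> \<Longrightarrow> (x + u, y + v) \<in> \<Gamma>"
    and "(x, y) \<in> \<Gamma> \<Longrightarrow> (u, v) \<in> \<Gamma> \<Longrightarrow> (x - u, y - v) \<in> \<Gamma>"
    and "(x, y) \<in> \<Gamma> \<Longrightarrow> (u, v) \<in> \<Gamma> \<Longrightarrow> (x * u, y * v) \<in> \<Gamma>"
    and "(x, y) \<in> \<Gamma> \<Longrightarrow> x = 0 \<longleftrightarrow> y = 0"
  using assms unfolding partial_iso_def by blast+

lemma partial_iso_zero: "partial_iso \<Gamma> \<Longrightarrow> (0, 0) \<in> \<Gamma>"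
  using partial_isoD(3)[of \<Gamma> 1 1 1 1] partial_isoD(1)[of \<Gamma>] by simp

lemma partial_iso_converse: "partial_iso \<Gamma> \<Longrightarrow> partial_iso (\<Gamma>\<inverse>)"
  unfolding partial_iso_def by blast

text \<open>Closure under differences reduces single-valuedness to the condition at 0 in
  \<open>partial_iso\<close>; applied to the converse relation, the same argument gives
  injectivity.\<close>

lemma partial_iso_unique:
  assumes "partial_iso \<Gamma>" "(x, y) \<in> \<Gamma>" "(x, y') \<in> \<Gamma>"
  shows "y = y'"
  using partial_isoD(3)[OF assms] partial_isoD(5)[OF assms(1), of "x - x" "y - y'"] by simp

lemma partial_iso_sum:
  assumes "partial_iso \<Gamma>" "\<And>i. i \<in> I \<Longrightarrow> (f i, g i) \<in> \<Gamma>"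
  shows "(\<Sum>i\<in>I. f i, \<Sum>i\<in>I. g i) \<in> \<Gamma>"
  using assms(2)
  by (induction I rule: infinite_finite_induct)
     (auto intro: partial_isoD(2)[OF assms(1)] partial_iso_zero[OF assms(1)])

lemma partial_iso_of_int:
  assumes "partial_iso \<Gamma>"
  shows "(of_int n, of_int n) \<in> \<Gamma>"
proof (induction n rule: int_induct[where k = 0])
  case base
  then show ?case using partial_iso_zero[OF assms] by simp
next
  case (step1 i)
  then show ?case using partial_isoD(2)[OF assms _ partial_isoD(1)[OF assms], of "of_int i"] by simp
next
  case (step2 i)
  then show ?case using partial_isoD(3)[OF assms _ partial_isoD(1)[OF assms], of "of_int i"] by simp
qed

lemma partial_iso_Union_chain:
  assumes "C \<noteq> {}" "subset.chain {\<Gamma>. partial_iso \<Gamma>} C"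
  shows "partial_iso (\<Union>C)"
proof -
  have iso: "partial_iso \<Gamma>" if "\<Gamma> \<in> C" for \<Gamma>
    using assms(2) that by (auto simp: subset_chain_def)
  have common: "\<exists>\<Gamma>\<in>C. a \<in> \<Gamma> \<and> b \<in> \<Gamma>" if "a \<in> \<Union>C" "b \<in> \<Union>C" for a b
  proof -
    from that obtain X Y where "X \<in> C" "Y \<in> C" "a \<in> X" "b \<in> Y" by blast
    moreover from this have "X \<subseteq> Y \<or> Y \<subseteq> X"
      using assms(2) by (auto simp: subset_chain_def)
    ultimately show ?thesis by blast
  qed
  show ?thesis
    unfolding partial_iso_def
  proof (intro conjI allI impI)
    show "(1, 1) \<in> \<Union>C" using assms(1) iso partial_isoD(1) by blast
  next
    fix x y u v assume "(x, y) \<in> \<Union>C" "(u, v) \<in> \<Union>C"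
    then obtain \<Gamma> where *: "\<Gamma> \<in> C" "(x, y) \<in> \<Gamma>" "(u, v) \<in> \<Gamma>"
      using common by blast
    show "(x + u, y + v) \<in> \<Union>C" "(x - u, y - v) \<in> \<Union>C" "(x * u, y * v) \<in> \<Union>C"
      using * iso[OF *(1)] partial_isoD(2-4) by blast+
  next
    fix x y assume "(x, y) \<in> \<Union>C"
    then show "x = 0 \<longleftrightarrow> y = 0" using iso partial_isoD(5) by blast
  qed
qed

text \<open>The extension to fields of fractions. That it does not depend on the representation of a
  fraction comes out of the zero condition once \<open>partial_iso\<close> is proved for it.\<close>

definition fraction_iso :: "(complex \<times> complex) set \<Rightarrow> (complex \<times> complex) set" where
  "fraction_iso \<Gamma> = {(u / x, v / y) | u v x y. (u, v) \<in> \<Gamma> \<and> (x, y) \<in> \<Gamma> \<and> x \<noteq> 0 \<and> y \<noteq> 0}"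

lemma fraction_isoI:
  assumes "(u, v) \<in> \<Gamma>" "(x, y) \<in> \<Gamma>" "x \<noteq> 0" "y \<noteq> 0" "a = u / x" "b = v / y"
  shows "(a, b) \<in> fraction_iso \<Gamma>"
  using assms unfolding fraction_iso_def by blast

lemma fraction_isoE:
  assumes "(a, b) \<in> fraction_iso \<Gamma>"
  obtains u v x y where "(u, v) \<in> \<Gamma>" "(x, y) \<in> \<Gamma>" "x \<noteq> 0" "y \<noteq> 0" "a = u / x" "b = v / y"
  using assms unfolding fraction_iso_def by blast

lemma subset_fraction_iso: "partial_iso \<Gamma> \<Longrightarrow> \<Gamma> \<subseteq> fraction_iso \<Gamma>"
  by (auto intro!: fraction_isoI[where x = 1 and y = 1] partial_isoD(1))

lemma fraction_iso_inverse:
  assumes "partial_iso \<Gamma>" "(a, b) \<in> fraction_iso \<Gamma>"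
  shows "(inverse a, inverse b) \<in> fraction_iso \<Gamma>"
proof -
  obtain u v x y where *: "(u, v) \<in> \<Gamma>" "(x, y) \<in> \<Gamma>" "x \<noteq> 0" "y \<noteq> 0" "a = u / x" "b = v / y"
    using assms(2) by (rule fraction_isoE)
  show ?thesis
  proof (cases "u = 0")
    case True
    then have "v = 0" using * assms(1) partial_isoD(5) by blast
    with True * show ?thesis
      using subset_fraction_iso[OF assms(1)] partial_iso_zero[OF assms(1)] by auto
  next
    case False
    then have "v \<noteq> 0" using * assms(1) partial_isoD(5) by blast
    with False * show ?thesis by (intro fraction_isoI[of x y _ u v]) auto
  qed
qed

lemma partial_iso_fraction:
  assumes "partial_iso \<Gamma>"
  shows "partial_iso (fraction_iso \<Gamma>)"
  unfolding partial_iso_def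
proof (intro conjI allI impI)
  show "(1, 1) \<in> fraction_iso \<Gamma>"
    using subset_fraction_iso partial_isoD(1) assms by blast
next
  fix a b c d assume "(a, b) \<in> fraction_iso \<Gamma>" "(c, d) \<in> fraction_iso \<Gamma>"
  then obtain u v x y u' v' x' y'
    where *: "(u, v) \<in> \<Gamma>" "(x, y) \<in> \<Gamma>" "x \<noteq> 0" "y \<noteq> 0" "a = u / x" "b = v / y"
      "(u', v') \<in> \<Gamma>" "(x', y') \<in> \<Gamma>" "x' \<noteq> 0" "y' \<noteq> 0" "c = u' / x'" "d = v' / y'"
    by (elim fraction_isoE) blast
  note cl = partial_isoD(2-4)[OF assms]
  show "(a + c, b + d) \<in> fraction_iso \<Gamma>"
    by (rule fraction_isoI[of "u * x' + u' * x" "v * y' + v' * y" _ "x * x'" "y * y'"])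
       (use * in \<open>auto intro!: cl simp: field_simps\<close>)
  show "(a - c, b - d) \<in> fraction_iso \<Gamma>"
    by (rule fraction_isoI[of "u * x' - u' * x" "v * y' - v' * y" _ "x * x'" "y * y'"])
       (use * in \<open>auto intro!: cl simp: field_simps\<close>)
  show "(a * c, b * d) \<in> fraction_iso \<Gamma>"
    by (rule fraction_isoI[of "u * u'" "v * v'" _ "x * x'" "y * y'"])
       (use * in \<open>auto intro!: cl simp: field_simps\<close>)
next
  fix a b assume "(a, b) \<in> fraction_iso \<Gamma>"
  then show "a = 0 \<longleftrightarrow> b = 0"
    using partial_isoD(5)[OF assms] by (auto elim!: fraction_isoE)
qed

section \<open>Polynomials over two isomorphic fields, and simple extensions\<close>

locale field_iso =
  fixes \<Gamma> :: "(complex \<times> complex) set"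
  assumes iso: "partial_iso \<Gamma>"
    and inv: "(x, y) \<in> \<Gamma> \<Longrightarrow> (inverse x, inverse y) \<in> \<Gamma>"
begin

lemma divide: "(x, y) \<in> \<Gamma> \<Longrightarrow> (u, v) \<in> \<Gamma> \<Longrightarrow> (x / u, y / v) \<in> \<Gamma>"
  using partial_isoD(4)[OF iso _ inv] by (simp add: divide_inverse)

text \<open>\<open>Q\<close> is \<open>P\<close> transported along the isomorphism. Polynomial
  arithmetic is done on such pairs, so that each conclusion is available on both sides at
  once.\<close>

definition rel :: "complex poly \<Rightarrow> complex poly \<Rightarrow> bool" where
  "rel P Q \<longleftrightarrow> (\<forall>i. (coeff P i, coeff Q i) \<in> \<Gamma>)"

lemma rel_add: "rel P Q \<Longrightarrow> rel A B \<Longrightarrow> rel (P + A) (Q + B)"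
  by (auto simp: rel_def intro: partial_isoD(2)[OF iso])

lemma rel_diff: "rel P Q \<Longrightarrow> rel A B \<Longrightarrow> rel (P - A) (Q - B)"
  by (auto simp: rel_def intro: partial_isoD(3)[OF iso])

lemma rel_mult: "rel P Q \<Longrightarrow> rel A B \<Longrightarrow> rel (P * A) (Q * B)"
  unfolding rel_def coeff_mult
  by (intro allI partial_iso_sum[OF iso] partial_isoD(4)[OF iso]) auto

lemma rel_monom: "(a, b) \<in> \<Gamma> \<Longrightarrow> rel (monom a n) (monom b n)"
  using partial_iso_zero[OF iso] by (auto simp: rel_def)

lemma rel_0: "rel 0 0"
  using partial_iso_zero[OF iso] by (auto simp: rel_def)

lemma rel_eq_0: "rel P Q \<Longrightarrow> P = 0 \<longleftrightarrow> Q = 0"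
  using partial_isoD(5)[OF iso] by (auto simp: rel_def poly_eq_iff)

lemma rel_degree: "rel P Q \<Longrightarrow> degree P = degree Q"
  unfolding rel_def degree_def using partial_isoD(5)[OF iso] by metis

text \<open>Long division carried out simultaneously on both sides. The remainder is bounded through
  its coefficients rather than its degree, which covers a zero remainder and a constant divisor
  uniformly.\<close>

lemma rel_division:
  assumes PQ: "rel P Q" "P \<noteq> 0" and AB: "rel A B"
  shows "\<exists>U V R S. rel U V \<and> rel R S \<and> A = P * U + R \<and> B = Q * V + S \<and>
           (\<forall>i\<ge>degree P. coeff R i = 0)"
proof -
  have "\<exists>U V R S. rel U V \<and> rel R S \<and> A = P * U + R \<and> B = Q * V + S \<and>
      (\<forall>i\<ge>degree P. coeff R i = 0)" if "rel A B" "\<forall>i\<ge>n. coeff A i = 0" for n A B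
    using that
  proof (induction n arbitrary: A B)
    case 0
    then show ?case
      by (intro exI[of _ 0] exI[of _ A] exI[of _ B]) (auto simp: rel_0)
  next
    case (Suc n)
    show ?case
    proof (cases "n < degree P")
      case True
      then show ?thesis
        using Suc.prems by (intro exI[of _ 0] exI[of _ A] exI[of _ B]) (auto simp: rel_0)
    next
      case False
      define c d where "c = coeff A n / lead_coeff P" and "d = coeff B n / lead_coeff Q"
      define k where "k = n - degree P"
      have cd: "rel (monom c k) (monom d k)"
        unfolding c_def d_def using Suc.prems PQ rel_degree[OF PQ(1)]
        by (intro rel_monom divide) (auto simp: rel_def)
      have "rel (A - monom c k * P) (B - monom d k * Q)"
        by (intro rel_diff rel_mult cd PQ Suc.prems)
      moreover have "coeff (A - monom c k * P) i = 0" if "i \<ge> n" for i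
      proof (cases "i = n")
        case True
        then show ?thesis using False PQ(2) by (simp add: coeff_monom_mult k_def c_def)
      next
        case False
        then have "coeff P (i - k) = 0"
          using that \<open>\<not> n < degree P\<close> by (intro coeff_eq_0) (auto simp: k_def)
        moreover have "coeff A i = 0" using Suc.prems that False by simp
        ultimately show ?thesis by (simp add: coeff_monom_mult)
      qed
      ultimately obtain U V R S where *: "rel U V" "rel R S"
          "A - monom c k * P = P * U + R" "B - monom d k * Q = Q * V + S"
          "\<forall>i\<ge>degree P. coeff R i = 0"
        using Suc.IH by blast
      have "A = P * (U + monom c k) + R" "B = Q * (V + monom d k) + S"
        using *(3,4) by (simp_all add: algebra_simps)
      with * cd show ?thesis by (blast intro: rel_add)
    qed
  qed
  from this[OF AB, of "Suc (degree A)"] show ?thesis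
    by (auto simp: coeff_eq_0)
qed

lemma small_degree:
  assumes "\<forall>i\<ge>degree P. coeff R i = 0" "R \<noteq> 0"
  shows "degree R < degree P"
  using assms by (metis leading_coeff_0_iff not_le)

text \<open>The minimal polynomial up to a scalar. Having a partner under \<open>rel\<close>
  expresses that the coefficients lie in the domain field.\<close>

definition minimal :: "complex poly \<Rightarrow> complex \<Rightarrow> bool" where
  "minimal P z \<longleftrightarrow> P \<noteq> 0 \<and> poly P z = 0 \<and>
     (\<forall>R S. rel R S \<longrightarrow> R \<noteq> 0 \<longrightarrow> poly R z = 0 \<longrightarrow> degree P \<le> degree R)"

lemma minimal_dvd:
  assumes "rel P Q" "minimal P z" "rel A B" "poly A z = 0"
  obtains U V where "rel U V" "A = P * U" "B = Q * V"
proof -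
  have "P \<noteq> 0" using assms(2) by (simp add: minimal_def)
  then obtain U V R S where *: "rel U V" "rel R S" "A = P * U + R" "B = Q * V + S"
      "\<forall>i\<ge>degree P. coeff R i = 0"
    using rel_division assms by blast
  have "poly R z = 0" using * assms by (simp add: minimal_def)
  have "R = 0"
  proof (rule ccontr)
    assume "R \<noteq> 0"
    then have "degree R < degree P" using small_degree * by blast
    moreover have "degree P \<le> degree R"
      using assms(2) \<open>rel R S\<close> \<open>R \<noteq> 0\<close> \<open>poly R z = 0\<close> unfolding minimal_def by blast
    ultimately show False by simp
  qed
  then have "S = 0" using rel_eq_0 * by blast
  show ?thesis by (rule that[of U V]) (use * \<open>R = 0\<close> \<open>S = 0\<close> in auto)
qed

lemma minimal_exists:
  assumes "rel A B" "A \<noteq> 0" "poly A z = 0"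
  obtains P Q where "rel P Q" "minimal P z"
proof -
  define d where "d = (LEAST d. \<exists>P Q. rel P Q \<and> P \<noteq> 0 \<and> poly P z = 0 \<and> degree P = d)"
  have "\<exists>P Q. rel P Q \<and> P \<noteq> 0 \<and> poly P z = 0 \<and> degree P = d"
    unfolding d_def by (rule LeastI_ex) (use assms in blast)
  then obtain P Q where *: "rel P Q" "P \<noteq> 0" "poly P z = 0" "degree P = d" by blast
  have "degree P \<le> degree R" if "rel R S" "R \<noteq> 0" "poly R z = 0" for R S
    unfolding *(4) d_def by (rule Least_le) (use that in blast)
  with * that show ?thesis unfolding minimal_def by blast
qed

lemma rel_of_int: "rel (map_poly of_int p) (map_poly of_int p)"
  by (auto simp: rel_def coeff_map_poly partial_iso_of_int[OF iso])

text \<open>Irreducibility survives transport. For the converse direction, a minimal polynomial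
  \<open>S\<close> of \<open>w\<close> on the other side divides \<open>Q\<close>, so its partner
  \<open>R\<close> divides \<open>P\<close>. If \<open>R\<close> did not vanish at \<open>z\<close>,
  the cofactor would, and minimality of \<open>P\<close> would make \<open>R\<close> and
  \<open>S\<close> constant.\<close>

lemma minimal_other_root_zero_iff:
  assumes PQ: "rel P Q" and min: "minimal P z" and w: "poly Q w = 0" and AB: "rel A B"
  shows "poly A z = 0 \<longleftrightarrow> poly B w = 0"
proof
  assume "poly A z = 0"
  then obtain U V where "B = Q * V" using minimal_dvd PQ min AB by blast
  then show "poly B w = 0" using w by simp
next
  interpret conv: field_iso "\<Gamma>\<inverse>"
    using iso inv by unfold_locales (auto intro: partial_iso_converse)
  have rel_conv: "conv.rel X Y \<longleftrightarrow> rel Y X" for X Y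
    by (auto simp: rel_def conv.rel_def)
  assume "poly B w = 0"
  have "Q \<noteq> 0" using PQ min rel_eq_0 by (auto simp: minimal_def)
  moreover have "conv.rel Q P" using PQ by (simp add: rel_conv)
  ultimately obtain S R where "conv.rel S R" and min_S: "conv.minimal S w"
    using conv.minimal_exists w by blast
  then have SR: "rel R S" by (simp add: rel_conv)
  obtain V U where "conv.rel V U" and "P = R * U"
    using conv.minimal_dvd[OF \<open>conv.rel S R\<close> min_S \<open>conv.rel Q P\<close> w] by blast
  then have VU: "P = R * U" "rel U V" by (simp_all add: rel_conv)
  have "poly R z = 0"
  proof (rule ccontr)
    assume "poly R z \<noteq> 0"
    then have "poly U z = 0" "U \<noteq> 0" "R \<noteq> 0"
      using min VU by (auto simp: minimal_def)
    then have "degree P \<le> degree U" using min VU unfolding minimal_def by blast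
    then have "degree R = 0"
      using VU \<open>U \<noteq> 0\<close> \<open>R \<noteq> 0\<close> by (simp add: degree_mult_eq)
    then have "degree S = 0" using SR rel_degree by simp
    moreover have "poly S w = 0" "S \<noteq> 0" using min_S by (auto simp: conv.minimal_def)
    ultimately show False by (metis degree_eq_zeroE poly_const_conv pCons_0_0)
  qed
  moreover have "conv.rel B A" using AB by (simp add: rel_conv)
  then obtain U' where "A = R * U'"
    using conv.minimal_dvd[OF \<open>conv.rel S R\<close> min_S _ \<open>poly B w = 0\<close>] by blast
  ultimately show "poly A z = 0" by simp
qed

text \<open>Sending \<open>poly A z\<close> to \<open>poly B w\<close> is well defined and injective
  exactly because vanishing at \<open>z\<close> and at \<open>w\<close> correspond.\<close>

lemma simple_extension:
  assumes PQ: "rel P Q" and min: "minimal P z" and w: "poly Q w = 0"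
  defines "\<Gamma>' \<equiv> {(poly A z, poly B w) | A B. rel A B}"
  shows "partial_iso \<Gamma>'" "\<Gamma> \<subseteq> \<Gamma>'" "(z, w) \<in> \<Gamma>'"
proof -
  have I: "(poly A z, poly B w) \<in> \<Gamma>'" if "rel A B" for A B
    using that by (auto simp: \<Gamma>'_def)
  have const: "(x, y) \<in> \<Gamma>'" if "(x, y) \<in> \<Gamma>" for x y
    using I[OF rel_monom[OF that, of 0]] by (simp add: poly_monom)
  then show "\<Gamma> \<subseteq> \<Gamma>'" by auto
  show "(z, w) \<in> \<Gamma>'"
    using I[OF rel_monom[OF partial_isoD(1)[OF iso], of 1]] by (simp add: poly_monom)
  show "partial_iso \<Gamma>'"
    unfolding partial_iso_def
  proof (intro conjI allI impI)
    show "(1, 1) \<in> \<Gamma>'" using const partial_isoD(1)[OF iso] by blast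
  next
    fix x y u v assume "(x, y) \<in> \<Gamma>'" "(u, v) \<in> \<Gamma>'"
    then obtain A B C D where *: "rel A B" "rel C D"
        "x = poly A z" "y = poly B w" "u = poly C z" "v = poly D w"
      by (auto simp: \<Gamma>'_def)
    show "(x + u, y + v) \<in> \<Gamma>'" using I[OF rel_add[OF *(1,2)]] by (simp add: *)
    show "(x - u, y - v) \<in> \<Gamma>'" using I[OF rel_diff[OF *(1,2)]] by (simp add: *)
    show "(x * u, y * v) \<in> \<Gamma>'" using I[OF rel_mult[OF *(1,2)]] by (simp add: *)
  next
    fix x y assume "(x, y) \<in> \<Gamma>'"
    then show "x = 0 \<longleftrightarrow> y = 0"
      using minimal_other_root_zero_iff[OF PQ min w] by (auto simp: \<Gamma>'_def)
  qed
qed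

end

section \<open>Extension to all algebraic numbers\<close>

lemma partial_iso_poly_of_int:
  assumes "partial_iso \<Gamma>" "(x, y) \<in> \<Gamma>"
  shows "(poly (map_poly of_int p) x, poly (map_poly of_int p) y) \<in> \<Gamma>"
proof (induction p)
  case 0
  then show ?case using partial_iso_zero assms by simp
next
  case (pCons a p)
  then show ?case
    using partial_isoD(2,4)[OF assms(1)] partial_iso_of_int[OF assms(1)] assms(2)
    by (simp add: map_poly_pCons)
qed

lemma partial_iso_algebraic:
  assumes "partial_iso \<Gamma>" "(x, y) \<in> \<Gamma>" "algebraic x"
  shows "algebraic y"
proof -
  obtain p :: "int poly" where p: "p \<noteq> 0" "poly (map_poly of_int p) x = 0"
    using assms(3) by (auto elim: algebraicE')
  have "poly (map_poly of_int p) y = 0"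
    using partial_isoD(5)[OF assms(1) partial_iso_poly_of_int[OF assms(1,2), of p]] p by simp
  moreover have "map_poly of_int p \<noteq> (0 :: complex poly)"
    using p(1) by (simp add: poly_eq_iff coeff_map_poly)
  ultimately show ?thesis
    by (intro algebraicI[of "map_poly of_int p"]) (auto simp: coeff_map_poly)
qed

lemma algebraic_sum [intro]:
  fixes f :: "'i \<Rightarrow> 'a::field_char_0"
  shows "(\<And>i. i \<in> A \<Longrightarrow> algebraic (f i)) \<Longrightarrow> algebraic (\<Sum>i\<in>A. f i)"
  by (induction A rule: infinite_finite_induct) auto

lemma algebraic_power [intro]:
  fixes x :: "'a::field_char_0"
  shows "algebraic x \<Longrightarrow> algebraic (x ^ n)"
  by (induction n) (auto intro: rat_imp_algebraic)

text \<open>Passing to fractions first supplies the inverses needed for polynomial division; then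
  \<open>z\<close> is adjoined through its minimal polynomial.\<close>

lemma partial_iso_extend:
  assumes \<Gamma>: "partial_iso \<Gamma>" "Domain \<Gamma> \<subseteq> {z. algebraic z}" and z: "algebraic z"
  obtains \<Gamma>' where "partial_iso \<Gamma>'" "Domain \<Gamma>' \<subseteq> {z. algebraic z}" "\<Gamma> \<subseteq> \<Gamma>'" "z \<in> Domain \<Gamma>'"
proof -
  interpret field_iso "fraction_iso \<Gamma>"
    using partial_iso_fraction fraction_iso_inverse \<Gamma> by unfold_locales auto
  have alg: "algebraic x" if xy: "(x, y) \<in> fraction_iso \<Gamma>" for x y
  proof -
    obtain u v u' v' where "(u, v) \<in> \<Gamma>" "(u', v') \<in> \<Gamma>" "x = u / u'"
      using xy by (blast elim: fraction_isoE)
    then show ?thesis using \<Gamma>(2) by (force simp: divide_inverse)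
  qed
  obtain p :: "int poly" where p: "p \<noteq> 0" "poly (map_poly of_int p) z = 0"
    using z by (auto elim: algebraicE')
  have "map_poly of_int p \<noteq> (0 :: complex poly)"
    using p(1) by (simp add: poly_eq_iff coeff_map_poly)
  then obtain P Q where PQ: "rel P Q" "minimal P z"
    using minimal_exists[OF rel_of_int] p by blast
  have "degree Q \<noteq> 0"
  proof
    assume "degree Q = 0"
    then have "degree P = 0" using rel_degree PQ by simp
    moreover have "poly P z = 0" "P \<noteq> 0" using PQ by (auto simp: minimal_def)
    ultimately show False by (metis degree_eq_zeroE poly_const_conv pCons_0_0)
  qed
  \<comment> \<open>The image of \<open>z\<close> may be any root of the transported minimal
    polynomial; the fundamental theorem of algebra provides one.\<close>
  then obtain w where w: "poly Q w = 0"
    by (metis fundamental_theorem_of_algebra constant_degree)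
  let ?E = "{(poly A z, poly B w) | A B. rel A B}"
  have "algebraic (poly A z)" if "rel A B" for A B
  proof -
    have "algebraic (coeff A i)" for i
      using that alg[of "coeff A i" "coeff B i"] by (simp add: rel_def)
    then show ?thesis unfolding poly_altdef using z by auto
  qed
  then have "Domain ?E \<subseteq> {z. algebraic z}" by auto
  moreover have "\<Gamma> \<subseteq> ?E"
    using simple_extension(2)[OF PQ w] subset_fraction_iso \<Gamma>(1) by blast
  ultimately show ?thesis
    using that[of ?E] simple_extension(1,3)[OF PQ w] by blast
qed

text \<open>A maximal extension exists by Zorn's lemma. Extending it once more shows that its domain
  is full, and extending its converse shows that its range is full.\<close>

lemma galQ_extend:
  assumes \<Gamma>: "partial_iso \<Gamma>" "Domain \<Gamma> \<subseteq> {z. algebraic z}"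
  obtains \<sigma> where "\<sigma> \<in> galQ" "\<And>x y. (x, y) \<in> \<Gamma> \<Longrightarrow> \<sigma> x = y"
proof -
  define \<A> where "\<A> = {M. partial_iso M \<and> Domain M \<subseteq> {z. algebraic z} \<and> \<Gamma> \<subseteq> M}"
  have "\<exists>M\<in>\<A>. \<forall>X\<in>\<A>. M \<subseteq> X \<longrightarrow> X = M"
  proof (rule subset_Zorn_nonempty)
    show "\<A> \<noteq> {}" using \<Gamma> by (auto simp: \<A>_def)
  next
    fix C assume C: "C \<noteq> {}" "subset.chain \<A> C"
    then have "subset.chain {M. partial_iso M} C"
      by (auto simp: subset_chain_def \<A>_def)
    then have "partial_iso (\<Union>C)" using C(1) partial_iso_Union_chain by blast
    moreover have sub: "Domain X \<subseteq> {z. algebraic z} \<and> \<Gamma> \<subseteq> X" if "X \<in> C" for X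
      using C(2) that by (auto simp: subset_chain_def \<A>_def)
    have "Domain (\<Union>C) \<subseteq> {z. algebraic z}"
      using sub by blast
    moreover have "\<Gamma> \<subseteq> \<Union>C"
      using C(1) sub by blast
    ultimately show "\<Union>C \<in> \<A>" by (simp add: \<A>_def)
  qed
  then obtain M where MA: "M \<in> \<A>" and maxA: "\<And>X. X \<in> \<A> \<Longrightarrow> M \<subseteq> X \<Longrightarrow> X = M"
    by auto
  then have M: "partial_iso M" "Domain M \<subseteq> {z. algebraic z}" "\<Gamma> \<subseteq> M"
    by (simp_all add: \<A>_def)
  have max: "X = M" if "partial_iso X" "Domain X \<subseteq> {z. algebraic z}" "M \<subseteq> X" for X
    using maxA[of X] that M(3) by (simp add: \<A>_def)
  have dom: "\<exists>y. (x, y) \<in> M" if x: "algebraic x" for x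
  proof -
    obtain X where X: "partial_iso X" "Domain X \<subseteq> {z. algebraic z}" "M \<subseteq> X" "x \<in> Domain X"
      using partial_iso_extend[OF M(1,2) x] .
    from max[OF X(1-3)] X(4) show ?thesis by (simp add: Domain_iff)
  qed
  have algM: "algebraic x \<and> algebraic y" if "(x, y) \<in> M" for x y
    using that M partial_iso_algebraic by blast
  have M': "partial_iso (M\<inverse>)" "Domain (M\<inverse>) \<subseteq> {z. algebraic z}"
    using M(1) algM partial_iso_converse by auto
  have ran: "\<exists>x. (x, y) \<in> M" if y: "algebraic y" for y
  proof -
    obtain X where X: "partial_iso X" "Domain X \<subseteq> {z. algebraic z}" "M\<inverse> \<subseteq> X" "y \<in> Domain X"
      using partial_iso_extend[OF M' y] .
    have "Domain (X\<inverse>) \<subseteq> {z. algebraic z}"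
      using X(1,2) partial_iso_algebraic by blast
    moreover have "M \<subseteq> X\<inverse>" using X(3) by auto
    ultimately have "X\<inverse> = M" using max[OF partial_iso_converse[OF X(1)]] by simp
    then show ?thesis using X(4) by (auto simp: Domain_iff)
  qed
  define \<sigma> where "\<sigma> x = (THE y. (x, y) \<in> M)" for x
  have \<sigma>_eq: "\<sigma> x = y" if "(x, y) \<in> M" for x y
    unfolding \<sigma>_def using that partial_iso_unique[OF M(1)] by blast
  have \<sigma>M: "(x, \<sigma> x) \<in> M" if "algebraic x" for x
    using dom[OF that] \<sigma>_eq by blast
  have "bij_betw \<sigma> {z. algebraic z} {z. algebraic z}"
    unfolding bij_betw_def
  proof
    show "inj_on \<sigma> {z. algebraic z}"
    proof (rule inj_onI)
      fix x y assume "x \<in> {z. algebraic z}" "y \<in> {z. algebraic z}" "\<sigma> x = \<sigma> y"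
      then have "(\<sigma> x, x) \<in> M\<inverse>" "(\<sigma> x, y) \<in> M\<inverse>" using \<sigma>M[of x] \<sigma>M[of y] by auto
      then show "x = y" using partial_iso_unique[OF M'(1)] by blast
    qed
    show "\<sigma> ` {z. algebraic z} = {z. algebraic z}"
    proof (intro equalityI subsetI)
      fix y :: complex assume "y \<in> {z. algebraic z}"
      then obtain x where "(x, y) \<in> M" using ran by blast
      then show "y \<in> \<sigma> ` {z. algebraic z}" using \<sigma>_eq algM by (auto intro!: image_eqI[of _ _ x])
    qed (use \<sigma>M algM in auto)
  qed
  moreover have "\<sigma> (x + y) = \<sigma> x + \<sigma> y" "\<sigma> (x * y) = \<sigma> x * \<sigma> y" if "algebraic x" "algebraic y" for x y
    using partial_isoD(2,4)[OF M(1) \<sigma>M[OF that(1)] \<sigma>M[OF that(2)]] by (auto intro: \<sigma>_eq)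
  ultimately have "\<sigma> \<in> galQ" by (simp add: galQ_def)
  with \<sigma>_eq M(3) that show ?thesis by blast
qed

subsection \<open>The absolute Galois group\<close>

lemma galQ_add: "\<sigma> \<in> galQ \<Longrightarrow> algebraic x \<Longrightarrow> algebraic y \<Longrightarrow> \<sigma> (x + y) = \<sigma> x + \<sigma> y"
  and galQ_mult: "\<sigma> \<in> galQ \<Longrightarrow> algebraic x \<Longrightarrow> algebraic y \<Longrightarrow> \<sigma> (x * y) = \<sigma> x * \<sigma> y"
  and galQ_algebraic: "\<sigma> \<in> galQ \<Longrightarrow> algebraic x \<Longrightarrow> algebraic (\<sigma> x)"
  and galQ_inj: "\<sigma> \<in> galQ \<Longrightarrow> algebraic x \<Longrightarrow> algebraic y \<Longrightarrow> \<sigma> x = \<sigma> y \<longleftrightarrow> x = y"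
  by (auto simp: galQ_def bij_betw_def inj_on_def)

lemma galQ_0: "\<sigma> \<in> galQ \<Longrightarrow> \<sigma> 0 = 0"
  using galQ_add[of \<sigma> 0 0] by simp

lemma algebraic_1 [simp]: "algebraic (1 :: 'a::field_char_0)"
  by (rule rat_imp_algebraic) auto

lemma algebraic_of_int [simp]: "algebraic (of_int n :: 'a::field_char_0)"
  by (rule rat_imp_algebraic) auto

lemma algebraic_of_nat [simp]: "algebraic (of_nat n :: 'a::field_char_0)"
  by (rule rat_imp_algebraic) auto

lemma algebraic_prod [intro]:
  fixes f :: "'i \<Rightarrow> 'a::field_char_0"
  shows "(\<And>i. i \<in> A \<Longrightarrow> algebraic (f i)) \<Longrightarrow> algebraic (\<Prod>i\<in>A. f i)"
  by (induction A rule: infinite_finite_induct) auto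

lemma galQ_eq_0_iff: "\<sigma> \<in> galQ \<Longrightarrow> algebraic x \<Longrightarrow> \<sigma> x = 0 \<longleftrightarrow> x = 0"
  using galQ_inj[of \<sigma> x 0] by (simp add: galQ_0)

lemma galQ_1: "\<sigma> \<in> galQ \<Longrightarrow> \<sigma> 1 = 1"
  using galQ_mult[of \<sigma> 1 1] galQ_eq_0_iff[of \<sigma> 1] by simp

lemma galQ_minus: "\<sigma> \<in> galQ \<Longrightarrow> algebraic x \<Longrightarrow> \<sigma> (- x) = - \<sigma> x"
  using galQ_add[of \<sigma> x "- x"] by (auto simp: galQ_0 add_eq_0_iff)

lemma galQ_diff: "\<sigma> \<in> galQ \<Longrightarrow> algebraic x \<Longrightarrow> algebraic y \<Longrightarrow> \<sigma> (x - y) = \<sigma> x - \<sigma> y"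
  using galQ_add[of \<sigma> x "- y"] by (auto simp: galQ_minus)

lemma galQ_of_nat: "\<sigma> \<in> galQ \<Longrightarrow> \<sigma> (of_nat n) = of_nat n"
  by (induction n) (auto simp: galQ_0 galQ_1 galQ_add)

lemma galQ_of_int: "\<sigma> \<in> galQ \<Longrightarrow> \<sigma> (of_int n) = of_int n"
  by (cases n) (auto simp: galQ_of_nat galQ_minus galQ_1 galQ_diff)

lemma galQ_power: "\<sigma> \<in> galQ \<Longrightarrow> algebraic x \<Longrightarrow> \<sigma> (x ^ n) = \<sigma> x ^ n"
  by (induction n) (auto simp: galQ_1 galQ_mult algebraic_power)

lemma galQ_sum:
  "\<sigma> \<in> galQ \<Longrightarrow> (\<And>i. i \<in> A \<Longrightarrow> algebraic (f i)) \<Longrightarrow> \<sigma> (\<Sum>i\<in>A. f i) = (\<Sum>i\<in>A. \<sigma> (f i))"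
  by (induction A rule: infinite_finite_induct) (auto simp: galQ_0 galQ_add algebraic_sum)

lemma galQ_prod:
  "\<sigma> \<in> galQ \<Longrightarrow> (\<And>i. i \<in> A \<Longrightarrow> algebraic (f i)) \<Longrightarrow> \<sigma> (\<Prod>i\<in>A. f i) = (\<Prod>i\<in>A. \<sigma> (f i))"
  by (induction A rule: infinite_finite_induct) (auto simp: galQ_1 galQ_mult algebraic_prod)

lemma galQ_poly_of_int:
  assumes "\<sigma> \<in> galQ" "algebraic x"
  shows "\<sigma> (poly (map_poly of_int p) x) = poly (map_poly of_int p) (\<sigma> x)"
  using assms
  by (simp add: poly_altdef coeff_map_poly galQ_sum galQ_mult galQ_power galQ_of_int
      algebraic_mult algebraic_power)

lemma galQ_algebraic_int:
  assumes "\<sigma> \<in> galQ" "algebraic_int x"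
  shows "algebraic_int (\<sigma> x)"
proof -
  obtain p where p: "poly (map_poly of_int p) x = 0" "lead_coeff p = 1"
    using assms(2) algebraic_int_altdef_ipoly by blast
  then have "poly (map_poly of_int p) (\<sigma> x) = 0"
    using galQ_poly_of_int[OF assms(1), of x p] algebraic_int_imp_algebraic[OF assms(2)]
      galQ_0[OF assms(1)] by simp
  then show ?thesis using p algebraic_int_altdef_ipoly by blast
qed

lemma galQ_comp: "\<sigma> \<in> galQ \<Longrightarrow> \<tau> \<in> galQ \<Longrightarrow> \<sigma> \<circ> \<tau> \<in> galQ"
  using bij_betw_trans[of \<tau> "{z. algebraic z}" "{z. algebraic z}" \<sigma> "{z. algebraic z}"]
  by (subst galQ_def) (auto simp: galQ_add galQ_mult galQ_algebraic, simp add: galQ_def)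

lemma galQ_id: "id \<in> galQ"
  by (auto simp: galQ_def)

lemma galQ_inv:
  assumes "\<sigma> \<in> galQ"
  obtains \<tau> where "\<tau> \<in> galQ" "\<And>x. algebraic x \<Longrightarrow> \<tau> (\<sigma> x) = x" "\<And>x. algebraic x \<Longrightarrow> \<sigma> (\<tau> x) = x"
proof -
  let ?A = "{z :: complex. algebraic z}"
  define \<tau> where "\<tau> = inv_into ?A \<sigma>"
  have bij: "bij_betw \<sigma> ?A ?A" using assms by (simp add: galQ_def)
  then have bij': "bij_betw \<tau> ?A ?A" by (simp add: \<tau>_def bij_betw_inv_into)
  have l: "\<tau> (\<sigma> x) = x" if "algebraic x" for x
    using bij that by (simp add: \<tau>_def bij_betw_inv_into_left)
  have r: "\<sigma> (\<tau> x) = x" if "algebraic x" for x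
    using bij that by (simp add: \<tau>_def bij_betw_inv_into_right)
  have alg: "algebraic (\<tau> x)" if "algebraic x" for x
    using bij' that by (auto simp: bij_betw_def)
  have "\<tau> (x + y) = \<tau> x + \<tau> y" "\<tau> (x * y) = \<tau> x * \<tau> y" if "algebraic x" "algebraic y" for x y
  proof -
    have "\<sigma> (\<tau> x + \<tau> y) = x + y" "\<sigma> (\<tau> x * \<tau> y) = x * y"
      using that alg r by (simp_all add: galQ_add galQ_mult assms)
    then show "\<tau> (x + y) = \<tau> x + \<tau> y" "\<tau> (x * y) = \<tau> x * \<tau> y"
      using l[of "\<tau> x + \<tau> y"] l[of "\<tau> x * \<tau> y"] alg that by auto
  qed
  then have "\<tau> \<in> galQ" using bij' by (simp add: galQ_def)
  with l r that show ?thesis by blast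
qed

text \<open>The minimal polynomial of an irrational \<open>z\<close> has degree at least 2 and is
  separable, its derivative having smaller degree. Hence it has a root \<open>w\<close> other than
  \<open>z\<close>, and the identity on \<rat> extends to an automorphism sending \<open>z\<close>
  to \<open>w\<close>.\<close>

lemma fixed_by_galQ_imp_rational:
  assumes z: "algebraic z" and fixed: "\<And>\<sigma>. \<sigma> \<in> galQ \<Longrightarrow> \<sigma> z = z"
  shows "z \<in> \<rat>"
proof (rule ccontr)
  assume irr: "z \<notin> \<rat>"
  define \<Gamma> where "\<Gamma> = {(x, x) | x. x \<in> (\<rat> :: complex set)}"
  have "partial_iso \<Gamma>" by (auto simp: partial_iso_def \<Gamma>_def)
  then interpret field_iso \<Gamma> by unfold_locales (auto simp: \<Gamma>_def)
  have rel_same: "Q = P" if "rel P Q" for P Q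
  proof (rule poly_eqI)
    fix i
    have "(coeff P i, coeff Q i) \<in> \<Gamma>" using that by (simp add: rel_def)
    then show "coeff Q i = coeff P i" by (auto simp: \<Gamma>_def)
  qed
  have relI: "rel P P" if "\<And>i. coeff P i \<in> \<rat>" for P
    unfolding rel_def using that by (auto simp: \<Gamma>_def)
  have relD: "coeff P i \<in> \<rat>" if "rel P P" for P i
  proof -
    have "(coeff P i, coeff P i) \<in> \<Gamma>" using that by (simp add: rel_def)
    then show ?thesis by (auto simp: \<Gamma>_def)
  qed
  obtain p :: "int poly" where p: "p \<noteq> 0" "poly (map_poly of_int p) z = 0"
    using z by (auto elim: algebraicE')
  have "map_poly of_int p \<noteq> (0 :: complex poly)"
    using p(1) by (simp add: poly_eq_iff coeff_map_poly)
  then obtain P Q where "rel P Q" and min: "minimal P z"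
    using minimal_exists[OF rel_of_int] p by blast
  then have PP: "rel P P" using rel_same by metis
  have P: "P \<noteq> 0" "poly P z = 0" using min by (auto simp: minimal_def)
  have deg: "degree P \<ge> 2"
  proof (rule ccontr)
    assume "\<not> degree P \<ge> 2"
    then have lin: "P = [:coeff P 0, coeff P 1:]"
      by (intro poly_eqI) (auto simp: coeff_pCons coeff_eq_0 split: nat.split)
    then have "poly P z = coeff P 0 + coeff P 1 * z"
      by (metis add.right_neutral mult.commute mult_zero_left poly_0 poly_pCons)
    then have eq: "coeff P 0 + coeff P 1 * z = 0" using P by simp
    have "coeff P 1 \<noteq> 0"
    proof
      assume "coeff P 1 = 0"
      then have "coeff P 0 = 0" using eq by simp
      then have "P = 0" using lin \<open>coeff P 1 = 0\<close> by (metis pCons_0_0)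
      then show False using P(1) by simp
    qed
    then have "z = - coeff P 0 / coeff P 1" using eq by (simp add: field_simps eq_neg_iff_add_eq_0)
    then show False using irr relD[OF PP] by auto
  qed
  have "poly (pderiv P) z \<noteq> 0"
  proof
    assume "poly (pderiv P) z = 0"
    moreover have "rel (pderiv P) (pderiv P)"
      using relD[OF PP] by (intro relI) (auto simp: coeff_pderiv)
    moreover have "pderiv P \<noteq> 0" using deg pderiv_eq_0_iff[of P] by auto
    ultimately have "degree P \<le> degree (pderiv P)" using min unfolding minimal_def by metis
    then show False using deg degree_pderiv[of P] by simp
  qed
  moreover obtain U where U: "P = [:- z, 1:] * U"
    using P(2) by (metis dvdE poly_eq_0_iff_dvd)
  moreover have "pderiv P = [:- z, 1:] * pderiv U + U * pderiv [:- z, 1:]"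
    unfolding U by (rule pderiv_mult)
  ultimately have "poly U z \<noteq> 0" by (auto simp: pderiv_pCons)
  have "U \<noteq> 0" using U P by auto
  then have "degree P = Suc (degree U)" unfolding U by (subst degree_mult_eq) auto
  then have "degree U \<noteq> 0" using deg by simp
  then obtain w where w: "poly U w = 0"
    by (metis fundamental_theorem_of_algebra constant_degree)
  then have "w \<noteq> z" using \<open>poly U z \<noteq> 0\<close> by auto
  have "poly P w = 0" using w U by simp
  let ?E = "{(poly A z, poly B w) | A B. rel A B}"
  have "algebraic (poly A z)" if "rel A B" for A B
  proof -
    have "rel A A" using that rel_same by metis
    then have "algebraic (coeff A i)" for i
      using relD by (auto intro: rat_imp_algebraic)
    then show ?thesis unfolding poly_altdef using z by auto
  qed
  then have "Domain ?E \<subseteq> {z. algebraic z}" by auto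
  then obtain \<sigma> where "\<sigma> \<in> galQ" "\<And>x y. (x, y) \<in> ?E \<Longrightarrow> \<sigma> x = y"
    using galQ_extend simple_extension(1)[OF PP min \<open>poly P w = 0\<close>] by (metis (no_types, lifting))
  then have "\<sigma> z = w" using simple_extension(3)[OF PP min \<open>poly P w = 0\<close>] by blast
  then show False using fixed \<open>\<sigma> \<in> galQ\<close> \<open>w \<noteq> z\<close> by auto
qed

lemma fixed_by_galQ_imp_int:
  assumes "algebraic_int z" "\<And>\<sigma>. \<sigma> \<in> galQ \<Longrightarrow> \<sigma> z = z"
  obtains m where "z = of_int m"
  using rational_algebraic_int_is_int[OF assms(1)] fixed_by_galQ_imp_rational[of z] assms
  by (auto elim: Ints_cases)

text \<open>Where the values are eventually constant, the pointwise limit is a partial isomorphism,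
  and this extends to all algebraic numbers. It stands in for compactness of the profinite Galois
  group.\<close>

lemma galQ_limit:
  assumes s: "\<And>n::nat. s n \<in> galQ"
  obtains \<sigma> where "\<sigma> \<in> galQ"
    "\<And>x y N. algebraic x \<Longrightarrow> (\<And>n. n \<ge> N \<Longrightarrow> s n x = y) \<Longrightarrow> \<sigma> x = y"
proof -
  define \<Gamma> where "\<Gamma> = {(x, y). algebraic x \<and> (\<exists>N. \<forall>n\<ge>N. s n x = y)}"
  have "partial_iso \<Gamma>"
    unfolding partial_iso_def
  proof (intro conjI allI impI)
    show "(1, 1) \<in> \<Gamma>" by (auto simp: \<Gamma>_def galQ_1 s)
  next
    fix x y u v assume "(x, y) \<in> \<Gamma>" "(u, v) \<in> \<Gamma>"
    then obtain N M where *: "algebraic x" "\<And>n. n \<ge> N \<Longrightarrow> s n x = y"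
        "algebraic u" "\<And>n. n \<ge> M \<Longrightarrow> s n u = v"
      by (auto simp: \<Gamma>_def)
    have "\<forall>n\<ge>max N M. s n (x + u) = y + v" "\<forall>n\<ge>max N M. s n (x - u) = y - v"
        "\<forall>n\<ge>max N M. s n (x * u) = y * v"
      using * by (auto simp: galQ_add galQ_diff galQ_mult s)
    then show "(x + u, y + v) \<in> \<Gamma>" "(x - u, y - v) \<in> \<Gamma>" "(x * u, y * v) \<in> \<Gamma>"
      using *(1,3) unfolding \<Gamma>_def by (blast intro: algebraic_add algebraic_diff algebraic_mult)+
  next
    fix x y assume "(x, y) \<in> \<Gamma>"
    then obtain N where "algebraic x" "s N x = y" by (auto simp: \<Gamma>_def)
    then show "x = 0 \<longleftrightarrow> y = 0" using galQ_eq_0_iff[OF s, of x N] by auto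
  qed
  moreover have "Domain \<Gamma> \<subseteq> {z. algebraic z}" by (auto simp: \<Gamma>_def)
  ultimately obtain \<sigma> where "\<sigma> \<in> galQ" "\<And>x y. (x, y) \<in> \<Gamma> \<Longrightarrow> \<sigma> x = y"
    using galQ_extend by blast
  then show ?thesis by (intro that[of \<sigma>]) (auto simp: \<Gamma>_def)
qed

subsection \<open>Prime ideals of the ring of algebraic integers\<close>

locale prime_over =
  fixes q :: nat and I :: "complex set"
  assumes prime: "prime q"
    and sub: "x \<in> I \<Longrightarrow> algebraic_int x"
    and add: "x \<in> I \<Longrightarrow> y \<in> I \<Longrightarrow> x + y \<in> I"
    and smult: "algebraic_int a \<Longrightarrow> x \<in> I \<Longrightarrow> a * x \<in> I"
    and one: "1 \<notin> I"
    and q_in: "of_nat q \<in> I"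
    and primeD: "algebraic_int x \<Longrightarrow> algebraic_int y \<Longrightarrow> x * y \<in> I \<Longrightarrow> x \<in> I \<or> y \<in> I"
begin

lemma zero: "0 \<in> I"
  using smult[OF _ q_in, of 0] by simp

lemma smult_right: "algebraic_int a \<Longrightarrow> x \<in> I \<Longrightarrow> x * a \<in> I"
  using smult by (simp add: mult.commute)

lemma minus: "x \<in> I \<Longrightarrow> - x \<in> I"
  using smult[of "- 1" x] by (simp add: algebraic_int_minus)

lemma minus_iff: "- x \<in> I \<longleftrightarrow> x \<in> I"
  using minus[of x] minus[of "- x"] by auto

lemma diff: "x \<in> I \<Longrightarrow> y \<in> I \<Longrightarrow> x - y \<in> I"
  using add[of x "- y"] minus[of y] by simp

lemma add_cancel: "x \<in> I \<Longrightarrow> x + y \<in> I \<longleftrightarrow> y \<in> I"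
  using add[of x y] diff[of "x + y" x] by auto

lemma sum: "(\<And>i. i \<in> A \<Longrightarrow> f i \<in> I) \<Longrightarrow> (\<Sum>i\<in>A. f i) \<in> I"
  by (induction A rule: infinite_finite_induct) (auto intro: add zero)

lemma mult_iff: "algebraic_int x \<Longrightarrow> algebraic_int y \<Longrightarrow> x * y \<in> I \<longleftrightarrow> x \<in> I \<or> y \<in> I"
  using primeD smult smult_right by blast

lemma power_iff: "algebraic_int x \<Longrightarrow> x ^ n \<in> I \<longleftrightarrow> x \<in> I \<and> n > 0"
  by (induction n) (auto simp: one mult_iff algebraic_int_power)

lemma prod_iff:
  assumes "finite A" "\<And>i. i \<in> A \<Longrightarrow> algebraic_int (f i)"
  shows "(\<Prod>i\<in>A. f i) \<in> I \<longleftrightarrow> (\<exists>i\<in>A. f i \<in> I)"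
  using assms by (induction A rule: finite_induct) (auto simp: one mult_iff algebraic_int_prod)

lemma of_int_iff: "of_int m \<in> I \<longleftrightarrow> int q dvd m"
proof
  assume "int q dvd m"
  then obtain n where "m = n * int q" by (metis dvdE mult.commute)
  then show "of_int m \<in> I" using smult[OF _ q_in, of "of_int n"] by simp
next
  assume m: "of_int m \<in> I"
  show "int q dvd m"
  proof (rule ccontr)
    assume "\<not> int q dvd m"
    then have "coprime (int q) m" using prime by (simp add: prime_imp_coprime)
    then obtain u v where "u * int q + v * m = 1"
      by (metis bezout_int coprime_iff_gcd_eq_1)
    then have "of_int u * of_nat q + of_int v * of_int m = (1 :: complex)"
      by (metis of_int_1 of_int_add of_int_mult of_int_of_nat_eq)
    moreover have "of_int u * of_nat q + of_int v * of_int m \<in> I"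
      using m q_in by (intro add smult) auto
    ultimately show False using one by simp
  qed
qed

lemma of_nat_iff: "of_nat m \<in> I \<longleftrightarrow> q dvd m"
  using of_int_iff[of "int m"] by simp

end

text \<open>An ideal maximal among those containing \<open>q\<close> but not 1 is prime: an element
  outside it generates the unit ideal together with it, and two such representations of 1 can be
  multiplied.\<close>

lemma prime_over_exists:
  assumes q: "prime q"
  obtains I where "prime_over q I"
proof -
  define ideal where "ideal J \<longleftrightarrow> (\<forall>x\<in>J. algebraic_int x) \<and> (\<forall>x\<in>J. \<forall>y\<in>J. x + y \<in> J) \<and>
     (\<forall>a x. algebraic_int a \<longrightarrow> x \<in> J \<longrightarrow> a * x \<in> J)" for J :: "complex set"
  define \<A> where "\<A> = {J. ideal J \<and> of_nat q \<in> J \<and> 1 \<notin> J}"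
  have "\<exists>M\<in>\<A>. \<forall>X\<in>\<A>. M \<subseteq> X \<longrightarrow> X = M"
  proof (rule subset_Zorn_nonempty)
    \<comment> \<open>The principal ideal of \<open>q\<close> is proper because \<open>1 / q\<close>
      is rational but not an integer, hence not an algebraic integer.\<close>
    define J where "J = {of_nat q * a | a :: complex. algebraic_int a}"
    have "x + y \<in> J" if "x \<in> J" "y \<in> J" for x y
    proof -
      from that obtain a b where "x = of_nat q * a" "y = of_nat q * b" "algebraic_int a" "algebraic_int b"
        by (auto simp: J_def)
      then have "x + y = of_nat q * (a + b)" "algebraic_int (a + b)"
        by (auto simp: algebra_simps)
      then show ?thesis unfolding J_def by blast
    qed
    moreover have "c * x \<in> J" if "x \<in> J" "algebraic_int c" for c x
    proof -
      from that obtain a where "x = of_nat q * a" "algebraic_int a"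
        by (auto simp: J_def)
      then have "c * x = of_nat q * (c * a)" "algebraic_int (c * a)"
        using that by auto
      then show ?thesis unfolding J_def by blast
    qed
    moreover have "\<forall>x\<in>J. algebraic_int x"
      by (auto simp: J_def algebraic_int_mult)
    ultimately have "ideal J" by (simp add: ideal_def)
    moreover have "of_nat q \<in> J" unfolding J_def using algebraic_int_1 by force
    moreover have "1 \<notin> J"
    proof
      assume "1 \<in> J"
      then obtain a :: complex where a: "1 = of_nat q * a" "algebraic_int a" by (auto simp: J_def)
      then have "a = 1 / of_nat q" using q by (auto simp: field_simps)
      then have "a \<in> \<rat>" by auto
      then obtain m where "a = of_int m"
        using rational_algebraic_int_is_int[OF a(2)] by (auto elim: Ints_cases)
      then have "(of_int 1 :: complex) = of_int (int q * m)" using a(1) by simp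
      then have "int q * m = 1" by (metis of_int_eq_iff)
      then show False using q by (auto simp: zmult_eq_1_iff)
    qed
    ultimately show "\<A> \<noteq> {}" by (auto simp: \<A>_def)
  next
    fix C assume C: "C \<noteq> {}" "subset.chain \<A> C"
    have sub: "ideal X \<and> of_nat q \<in> X \<and> 1 \<notin> X" if "X \<in> C" for X
      using C(2) that by (auto simp: subset_chain_def \<A>_def)
    have "x + y \<in> \<Union>C" if xy: "x \<in> \<Union>C" "y \<in> \<Union>C" for x y
    proof -
      from xy obtain X Y where XY: "X \<in> C" "Y \<in> C" "x \<in> X" "y \<in> Y" by blast
      then have "X \<subseteq> Y \<or> Y \<subseteq> X" using C(2) by (auto simp: subset_chain_def)
      then obtain Z where "Z \<in> C" "x \<in> Z" "y \<in> Z" using XY by blast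
      then show ?thesis using sub[of Z] unfolding ideal_def by blast
    qed
    moreover have "\<forall>x\<in>\<Union>C. algebraic_int x" using sub unfolding ideal_def by blast
    moreover have "a * x \<in> \<Union>C" if "algebraic_int a" "x \<in> \<Union>C" for a x
      using sub that unfolding ideal_def by blast
    ultimately have "ideal (\<Union>C)" unfolding ideal_def by simp
    moreover have "of_nat q \<in> \<Union>C" using C(1) sub by blast
    moreover have "1 \<notin> \<Union>C" using sub by blast
    ultimately show "\<Union>C \<in> \<A>" by (simp add: \<A>_def)
  qed
  then obtain M where MA: "M \<in> \<A>" and max: "\<And>X. X \<in> \<A> \<Longrightarrow> M \<subseteq> X \<Longrightarrow> X = M"
    by auto
  then have M: "ideal M" "of_nat q \<in> M" "1 \<notin> M" by (simp_all add: \<A>_def)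
  have Mint: "algebraic_int x" if "x \<in> M" for x using M(1) that by (simp add: ideal_def)
  have Madd: "x + y \<in> M" if "x \<in> M" "y \<in> M" for x y using M(1) that by (simp add: ideal_def)
  have Mmult: "a * x \<in> M" if "algebraic_int a" "x \<in> M" for a x using M(1) that by (simp add: ideal_def)
  have M0: "0 \<in> M" using Mmult[OF _ M(2), of 0] by simp
  have one_comb: "\<exists>m a. m \<in> M \<and> algebraic_int a \<and> 1 = m + x * a" if x: "algebraic_int x" "x \<notin> M" for x
  proof (rule ccontr)
    assume no: "\<nexists>m a. m \<in> M \<and> algebraic_int a \<and> 1 = m + x * a"
    define J where "J = {m + x * a | m a. m \<in> M \<and> algebraic_int a}"
    have JI: "m + x * a \<in> J" if "m \<in> M" "algebraic_int a" for m a
      using that by (auto simp: J_def)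
    have MJ: "M \<subseteq> J" using JI[of _ 0] by auto
    have "ideal J"
      unfolding ideal_def
    proof (intro conjI ballI allI impI)
      fix y assume "y \<in> J"
      then show "algebraic_int y"
        using Mint x(1) by (auto simp: J_def intro!: algebraic_int_add algebraic_int_mult)
    next
      fix y z assume "y \<in> J" "z \<in> J"
      then obtain m a n b where "y = m + x * a" "z = n + x * b" "m \<in> M" "n \<in> M"
          "algebraic_int a" "algebraic_int b"
        by (auto simp: J_def)
      then show "y + z \<in> J"
        using JI[of "m + n" "a + b"] Madd by (simp add: algebra_simps algebraic_int_add)
    next
      fix c y :: complex assume "algebraic_int c" "y \<in> J"
      then obtain m a where "y = m + x * a" "m \<in> M" "algebraic_int a"
        by (auto simp: J_def)
      then show "c * y \<in> J"
        using JI[of "c * m" "c * a"] Mmult \<open>algebraic_int c\<close> by (simp add: algebra_simps algebraic_int_mult)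
    qed
    moreover have "1 \<notin> J" using no by (auto simp: J_def)
    ultimately have "J \<in> \<A>" using MJ M(2) by (auto simp: \<A>_def)
    then have "J = M" using max MJ by blast
    moreover have "x \<in> J" using JI[OF M0, of 1] by simp
    ultimately show False using x by simp
  qed
  have "prime_over q M"
  proof
    fix x y assume xy: "algebraic_int x" "algebraic_int y" "x * y \<in> M"
    show "x \<in> M \<or> y \<in> M"
    proof (rule ccontr)
      assume "\<not> (x \<in> M \<or> y \<in> M)"
      then obtain m a n b where *: "m \<in> M" "algebraic_int a" "1 = m + x * a"
          "n \<in> M" "algebraic_int b" "1 = n + y * b"
        using one_comb[OF xy(1)] one_comb[OF xy(2)] by blast
      have "1 = (m + x * a) * (n + y * b)" using * by simp
      also have "\<dots> = (n + y * b) * m + (x * a) * n + (a * b) * (x * y)" by (simp add: algebra_simps)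
      also have "\<dots> \<in> M"
      proof -
        have "(n + y * b) * m \<in> M" "(x * a) * n \<in> M" "(a * b) * (x * y) \<in> M"
          using * xy Mint[of n] by (auto intro!: Mmult[of _ m] Mmult[of _ n] Mmult[of _ "x * y"])
        then show ?thesis using Madd by blast
      qed
      finally show False using M(3) by simp
    qed
  qed (use q M Mint Madd Mmult in auto)
  then show ?thesis by (rule that)
qed

text \<open>Eisenstein's criterion in Galois form. The product over a nonempty stable subset of
  \<open>V\<close> is a rational integer in \<open>I\<close>, so \<open>q\<close> divides it. If the
  orbit \<open>W\<close> of \<open>u\<close> missed \<open>v\<close>, both \<open>W\<close> and its
  complement would contribute a factor \<open>q\<close> to \<open>m\<close>.\<close>

lemma (in prime_over) galQ_transitive:
  assumes fin: "finite V" and V: "V \<subseteq> I"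
    and stable: "\<And>\<sigma> v. \<sigma> \<in> galQ \<Longrightarrow> v \<in> V \<Longrightarrow> \<sigma> v \<in> V"
    and prod: "(\<Prod>v\<in>V. v) = of_int m" and m: "\<not> (int q)\<^sup>2 dvd m"
    and uv: "u \<in> V" "v \<in> V"
  shows "\<exists>\<sigma>\<in>galQ. \<sigma> u = v"
proof (rule ccontr)
  assume no: "\<not> (\<exists>\<sigma>\<in>galQ. \<sigma> u = v)"
  define W where "W = {\<sigma> u | \<sigma>. \<sigma> \<in> galQ}"
  have alg: "algebraic_int x" if "x \<in> V" for x using that V sub by blast
  have int_prod: "\<exists>n. (\<Prod>x\<in>X. x) = of_int n \<and> int q dvd n"
    if X: "X \<subseteq> V" "X \<noteq> {}" and st: "\<And>\<sigma> x. \<sigma> \<in> galQ \<Longrightarrow> x \<in> X \<Longrightarrow> \<sigma> x \<in> X" for X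
  proof -
    have finX: "finite X" using X fin finite_subset by blast
    have algX: "algebraic_int x" if "x \<in> X" for x using that X alg by blast
    have "\<sigma> (\<Prod>x\<in>X. x) = (\<Prod>x\<in>X. x)" if \<sigma>: "\<sigma> \<in> galQ" for \<sigma>
    proof -
      have inj: "inj_on \<sigma> X"
        using \<sigma> algX galQ_inj by (meson algebraic_int_imp_algebraic inj_onI)
      then have "\<sigma> ` X = X" using st[OF \<sigma>] finX by (intro endo_inj_surj) auto
      then have "(\<Prod>x\<in>X. \<sigma> x) = (\<Prod>x\<in>X. x)" using prod.reindex[OF inj, of id] by simp
      then show ?thesis using galQ_prod[OF \<sigma>, of X id] algX by (simp add: algebraic_int_imp_algebraic)
    qed
    moreover have "algebraic_int (\<Prod>x\<in>X. x)" using algX by blast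
    ultimately obtain n where n: "(\<Prod>x\<in>X. x) = of_int n" using fixed_by_galQ_imp_int by blast
    have "(\<Prod>x\<in>X. x) \<in> I" using X V algX finX by (subst prod_iff) auto
    then show ?thesis using n of_int_iff by auto
  qed
  have WV: "W \<subseteq> V" using stable uv by (auto simp: W_def)
  have "u \<in> W" unfolding W_def using galQ_id by (intro CollectI exI[of _ id]) simp
  have Wst: "\<sigma> x \<in> W" if \<sigma>: "\<sigma> \<in> galQ" and "x \<in> W" for \<sigma> x
  proof -
    obtain \<tau> where "\<tau> \<in> galQ" "x = \<tau> u" using \<open>x \<in> W\<close> by (auto simp: W_def)
    then have "\<sigma> x = (\<sigma> \<circ> \<tau>) u" "\<sigma> \<circ> \<tau> \<in> galQ" using galQ_comp \<sigma> by auto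
    then show ?thesis unfolding W_def by blast
  qed
  have "\<sigma> x \<in> V - W" if \<sigma>: "\<sigma> \<in> galQ" and x: "x \<in> V - W" for \<sigma> x
  proof -
    obtain \<tau> where \<tau>: "\<tau> \<in> galQ" "\<And>x. algebraic x \<Longrightarrow> \<tau> (\<sigma> x) = x"
      using galQ_inv[OF \<sigma>] by blast
    have "\<tau> (\<sigma> x) = x" using \<tau> x alg by auto
    then show ?thesis using Wst[OF \<tau>(1), of "\<sigma> x"] stable[OF \<sigma>] x by auto
  qed
  moreover have "v \<in> V - W" using uv no by (auto simp: W_def)
  ultimately obtain m2 where m2: "(\<Prod>x\<in>V - W. x) = of_int m2" "int q dvd m2"
    using int_prod[of "V - W"] by blast
  obtain m1 where m1: "(\<Prod>x\<in>W. x) = of_int m1" "int q dvd m1"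
    using int_prod[of W] WV \<open>u \<in> W\<close> Wst by blast
  have "of_int m = (of_int (m1 * m2) :: complex)"
    using prod.subset_diff[OF WV fin, of id] m1 m2 prod by (simp add: mult.commute)
  then have "m = m1 * m2" by (simp only: of_int_eq_iff)
  then show False using m m1 m2 by (simp add: power2_eq_square mult_dvd_mono)
qed

text \<open>Dedekind's argument modulo \<open>I\<close>: subtracting \<open>a t z\<close> times the
  relation at \<open>x\<close> from the relation at \<open>x * z\<close> eliminates
  \<open>t\<close>. The characters must differ modulo \<open>I\<close>, so that primality allows
  cancelling \<open>a s z - a t z\<close>.\<close>

lemma (in prime_over) character_independence:
  assumes "finite S"
    and R: "1 \<in> R" "\<And>x y. x \<in> R \<Longrightarrow> y \<in> R \<Longrightarrow> x * y \<in> R"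
    and int: "\<And>s x. s \<in> S \<Longrightarrow> x \<in> R \<Longrightarrow> algebraic_int (a s x)"
    and one': "\<And>s. s \<in> S \<Longrightarrow> a s 1 = 1"
    and mult: "\<And>s x y. s \<in> S \<Longrightarrow> x \<in> R \<Longrightarrow> y \<in> R \<Longrightarrow> a s (x * y) = a s x * a s y"
    and distinct: "\<And>s t. s \<in> S \<Longrightarrow> t \<in> S \<Longrightarrow> s \<noteq> t \<Longrightarrow> \<exists>x\<in>R. a s x - a t x \<notin> I"
    and c: "\<And>s. s \<in> S \<Longrightarrow> algebraic_int (c s)"
    and rel: "\<And>x. x \<in> R \<Longrightarrow> (\<Sum>s\<in>S. c s * a s x) \<in> I"
    and s: "s \<in> S"
  shows "c s \<in> I"
  using assms(1) int one' mult distinct c rel s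
proof (induction S arbitrary: c s rule: finite_induct)
  case empty
  then show ?case by simp
next
  case (insert t S)
  have others: "c s \<in> I" if sS: "s \<in> S" for s
  proof -
    obtain z where z: "z \<in> R" "a s z - a t z \<notin> I"
      using insert.prems(4)[of s t] sS insert.hyps by auto
    have alg: "algebraic_int (a t z)" "algebraic_int (c t)"
      using insert.prems z by auto
    have "c s * (a s z - a t z) \<in> I"
    proof (rule insert.IH[where c = "\<lambda>s. c s * (a s z - a t z)"])
      fix x assume x: "x \<in> R"
      have "(\<Sum>s\<in>insert t S. c s * a s (x * z)) - a t z * (\<Sum>s\<in>insert t S. c s * a s x) \<in> I"
        using insert.prems(6) R(2) x z alg by (intro diff smult) auto
      also have "(\<Sum>s\<in>insert t S. c s * a s (x * z)) - a t z * (\<Sum>s\<in>insert t S. c s * a s x)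
          = (\<Sum>s\<in>insert t S. c s * (a s z - a t z) * a s x)"
        unfolding sum_distrib_left sum_subtractf[symmetric]
        by (rule sum.cong) (use insert.prems(3) x z in \<open>auto simp: algebra_simps\<close>)
      also have "\<dots> = (\<Sum>s\<in>S. c s * (a s z - a t z) * a s x)"
        using insert.hyps by simp
      finally show "(\<Sum>s\<in>S. c s * (a s z - a t z) * a s x) \<in> I" .
    qed (use insert.prems sS z in \<open>auto intro!: algebraic_int_mult algebraic_int_diff\<close>)
    moreover have "algebraic_int (c s)" "algebraic_int (a s z - a t z)"
      using insert.prems sS z alg by (auto intro!: algebraic_int_diff)
    ultimately show ?thesis using primeD z by blast
  qed
  \<comment> \<open>With all other coefficients in \<open>I\<close>, evaluation at 1 isolates
    \<open>c t\<close>.\<close>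
  have "(\<Sum>s\<in>insert t S. c s * a s 1) \<in> I"
    using insert.prems(6) R(1) by blast
  then have "c t + (\<Sum>s\<in>S. c s) \<in> I"
    using insert.hyps insert.prems(2) by simp
  moreover have "(\<Sum>s\<in>S. c s) \<in> I" using others by (rule sum)
  ultimately have "c t \<in> I" using add_cancel[of "\<Sum>s\<in>S. c s" "c t"] by (simp add: add.commute)
  then show ?case using others insert.prems(7) by auto
qed

subsection \<open>Inertia\<close>

text \<open>If \<open>y\<close> is a square root of an integer exactly divisible by \<open>q\<close> in the field generated by
  \<open>V\<close>, then \<open>q\<close> ramifies there. Without inertia, the Galois conjugations would be distinct
  characters modulo \<open>I\<close>, so some twisted trace \<open>T = \<Sum>\<^sub>\<sigma> \<chi>(\<sigma>) \<sigma>(x)\<close> would lie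
  outside \<open>I\<close>, where \<open>\<chi>(\<sigma>) = \<sigma>(y) / y\<close>; but \<open>T y\<close> is an integer divisible by \<open>q\<close>,
  which forces \<open>T\<close> into \<open>I\<close>.\<close>

lemma (in prime_over) inertia_nontrivial:
  assumes fin: "finite V" and V: "\<And>v. v \<in> V \<Longrightarrow> algebraic_int v"
    and stable: "\<And>\<sigma> v. \<sigma> \<in> galQ \<Longrightarrow> v \<in> V \<Longrightarrow> \<sigma> v \<in> V"
    and y: "algebraic_int y" "y\<^sup>2 = of_int (int q * e)" "\<not> int q dvd e"
    and ysgn: "\<And>\<sigma>. \<sigma> \<in> galQ \<Longrightarrow> \<sigma> y = y \<or> \<sigma> y = - y"
    and yV: "\<And>\<sigma>. \<sigma> \<in> galQ \<Longrightarrow> (\<And>v. v \<in> V \<Longrightarrow> \<sigma> v = v) \<Longrightarrow> \<sigma> y = y"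
  shows "\<exists>\<sigma>\<in>galQ. (\<exists>v\<in>V. \<sigma> v \<noteq> v) \<and> (\<forall>v\<in>V. \<sigma> v - v \<in> I)"
proof (rule ccontr)
  assume "\<not> ?thesis"
  then have trivial: "\<sigma> v = v"
    if "\<sigma> \<in> galQ" "\<And>v. v \<in> V \<Longrightarrow> \<sigma> v - v \<in> I" "v \<in> V" for \<sigma> v
    using that by blast
  \<comment> \<open>The ring of integers of the field generated by \<open>V\<close>, described
    through the Galois correspondence.\<close>
  define R where "R = {x. algebraic_int x \<and>
    (\<forall>\<sigma>\<in>galQ. (\<forall>v\<in>V. \<sigma> v = v) \<longrightarrow> \<sigma> x = x)}"
  have Ralg: "algebraic x" "algebraic_int x" if "x \<in> R" for x
    using that by (auto simp: R_def)
  have Valg: "algebraic v" if "v \<in> V" for v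
    using V that by blast
  have agree: "\<sigma> x = \<tau> x"
    if "\<sigma> \<in> galQ" "\<tau> \<in> galQ" "x \<in> R" and eq: "\<And>v. v \<in> V \<Longrightarrow> \<sigma> v = \<tau> v" for \<sigma> \<tau> x
  proof -
    obtain \<rho> where \<rho>: "\<rho> \<in> galQ" "\<And>x. algebraic x \<Longrightarrow> \<rho> (\<tau> x) = x" "\<And>x. algebraic x \<Longrightarrow> \<tau> (\<rho> x) = x"
      using galQ_inv[OF \<open>\<tau> \<in> galQ\<close>] by blast
    have "\<forall>v\<in>V. (\<rho> \<circ> \<sigma>) v = v" using \<rho> eq Valg by simp
    then have "(\<rho> \<circ> \<sigma>) x = x"
      using \<open>x \<in> R\<close> galQ_comp[OF \<rho>(1) \<open>\<sigma> \<in> galQ\<close>] unfolding R_def by blast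
    then have "\<tau> (\<rho> (\<sigma> x)) = \<tau> x" by simp
    then show ?thesis using \<rho>(3) galQ_algebraic[OF \<open>\<sigma> \<in> galQ\<close>] Ralg \<open>x \<in> R\<close> by simp
  qed
  \<comment> \<open>The Galois group of that field, made finite by restricting to \<open>V\<close>;
    below, \<open>r\<close> chooses a lift of each element to \<open>galQ\<close>.\<close>
  define G where "G = (\<lambda>\<sigma>. restrict \<sigma> V) ` galQ"
  have "G \<subseteq> V \<rightarrow>\<^sub>E V" using stable by (auto simp: G_def)
  then have "finite G" using fin by (meson finite_PiE finite_subset)
  have "\<forall>g\<in>G. \<exists>\<sigma>. \<sigma> \<in> galQ \<and> restrict \<sigma> V = g" by (auto simp: G_def)
  from bchoice[OF this] obtain r where "\<forall>g\<in>G. r g \<in> galQ \<and> restrict (r g) V = g" ..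
  then have r: "r g \<in> galQ \<and> restrict (r g) V = g" if "g \<in> G" for g
    using that by blast
  have "G \<noteq> {}" using galQ_id by (auto simp: G_def)
  define \<chi> :: "(complex \<Rightarrow> complex) \<Rightarrow> complex" where "\<chi> g = (if r g y = y then 1 else - 1)" for g
  have y0: "y \<noteq> 0" using y prime by auto
  have yR: "y \<in> R" using y yV by (auto simp: R_def)
  have \<chi>y: "r g y = \<chi> g * y" if "g \<in> G" for g
    using ysgn r[OF that] by (auto simp: \<chi>_def)
  have "\<exists>x\<in>R. (\<Sum>g\<in>G. \<chi> g * r g x) \<notin> I"
  proof (rule ccontr)
    assume no: "\<not> (\<exists>x\<in>R. (\<Sum>g\<in>G. \<chi> g * r g x) \<notin> I)"
    obtain g where g: "g \<in> G" using \<open>G \<noteq> {}\<close> by blast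
    have "\<chi> g \<in> I"
    proof (rule character_independence[OF \<open>finite G\<close>, where R = R and a = r and c = \<chi> and s = g])
      show "1 \<in> R" by (auto simp: R_def galQ_1)
      show "x * z \<in> R" if "x \<in> R" "z \<in> R" for x z
        using that by (auto simp: R_def galQ_mult algebraic_int_mult algebraic_int_imp_algebraic)
      \<comment> \<open>If two lifts agreed modulo \<open>I\<close> on all of \<open>R\<close>, then
        one composed with the inverse of the other would be inertia, so by assumption trivial on
        \<open>V\<close>, and the two restrictions would coincide.\<close>
      show "\<exists>x\<in>R. r s x - r t x \<notin> I" if st: "s \<in> G" "t \<in> G" "s \<noteq> t" for s t
      proof (rule ccontr)
        assume all: "\<not> (\<exists>x\<in>R. r s x - r t x \<notin> I)"
        obtain \<rho> where \<rho>: "\<rho> \<in> galQ" "\<And>x. algebraic x \<Longrightarrow> \<rho> (r s x) = x" "\<And>x. algebraic x \<Longrightarrow> r s (\<rho> x) = x"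
          using galQ_inv r[OF st(1)] by blast
        have VR: "v \<in> R" if "v \<in> V" for v using that V by (auto simp: R_def)
        have "(r t \<circ> \<rho>) v - v \<in> I" if "v \<in> V" for v
        proof -
          have "r s (\<rho> v) - r t (\<rho> v) \<in> I" using all VR stable[OF \<rho>(1) that] by blast
          then show ?thesis using minus \<rho>(3) Valg[OF that] by fastforce
        qed
        then have fix_V: "(r t \<circ> \<rho>) v = v" if "v \<in> V" for v
          using trivial[OF galQ_comp[of "r t" \<rho>]] r[OF st(2)] \<rho>(1) that by blast
        have "r t v = r s v" if "v \<in> V" for v
          using fix_V[OF stable[of "r s" v]] r[OF st(1)] \<rho>(2) Valg that by simp
        then have "restrict (r t) V = restrict (r s) V" by auto
        then show False using r st by metis
      qed
      show "algebraic_int (r s x)" if "s \<in> G" "x \<in> R" for s x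
        using galQ_algebraic_int r Ralg that by blast
      show "r s 1 = 1" if "s \<in> G" for s using galQ_1 r that by blast
      show "r s (x * z) = r s x * r s z" if "s \<in> G" "x \<in> R" "z \<in> R" for s x z
        using galQ_mult r Ralg that by blast
      show "algebraic_int (\<chi> s)" for s by (auto simp: \<chi>_def algebraic_int_minus)
      show "(\<Sum>g\<in>G. \<chi> g * r g x) \<in> I" if "x \<in> R" for x using no that by blast
      show "g \<in> G" by (rule g)
    qed
    then show False using one minus_iff[of 1] by (auto simp: \<chi>_def split: if_splits)
  qed
  then obtain x where x: "x \<in> R" and xI: "(\<Sum>g\<in>G. \<chi> g * r g x) \<notin> I" by blast
  define T where "T = (\<Sum>g\<in>G. \<chi> g * r g x)"
  have rx: "algebraic_int (r g x)" if "g \<in> G" for g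
    using galQ_algebraic_int r[OF that] Ralg x by blast
  have \<chi>int: "algebraic_int (\<chi> g)" for g by (auto simp: \<chi>_def algebraic_int_minus)
  have T: "algebraic_int T"
    unfolding T_def using rx \<chi>int by (intro algebraic_int_sum algebraic_int_mult)
  have "\<tau> (T * y) = T * y" if \<tau>: "\<tau> \<in> galQ" for \<tau>
  proof -
    \<comment> \<open>Left translation by \<open>\<tau>\<close> permutes \<open>G\<close>. It
      multiplies \<open>T\<close> and \<open>y\<close> by the same sign, which cancels in
      \<open>T * y\<close>.\<close>
    define \<phi> where "\<phi> g = restrict (\<tau> \<circ> r g) V" for g
    have \<phi>G: "\<phi> g \<in> G" if "g \<in> G" for g
      unfolding \<phi>_def G_def using galQ_comp[OF \<tau>] r[OF that] by blast
    have r\<phi>: "r (\<phi> g) z = \<tau> (r g z)" if "g \<in> G" "z \<in> R" for g z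
    proof -
      have "r (\<phi> g) z = (\<tau> \<circ> r g) z"
      proof (rule agree[of "r (\<phi> g)" "\<tau> \<circ> r g" z])
        fix v assume "v \<in> V"
        have "restrict (r (\<phi> g)) V = \<phi> g" using r[OF \<phi>G[OF that(1)]] by blast
        then have "restrict (r (\<phi> g)) V v = \<phi> g v" by simp
        then show "r (\<phi> g) v = (\<tau> \<circ> r g) v" using \<open>v \<in> V\<close> by (simp add: \<phi>_def)
      qed (use that r[OF \<phi>G[OF that(1)]] galQ_comp[OF \<tau>] r[OF that(1)] in auto)
      then show ?thesis by simp
    qed
    have inj: "inj_on \<phi> G"
    proof (rule inj_onI)
      fix g h assume gh: "g \<in> G" "h \<in> G" "\<phi> g = \<phi> h"
      have "r g v = r h v" if "v \<in> V" for v
      proof -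
        have "\<phi> g v = \<phi> h v" using gh by simp
        then have "\<tau> (r g v) = \<tau> (r h v)" using that by (simp add: \<phi>_def)
        then show ?thesis using galQ_inj[OF \<tau>] galQ_algebraic r gh Valg[OF that] by blast
      qed
      then have "restrict (r g) V = restrict (r h) V" by auto
      then show "g = h" using r gh by metis
    qed
    then have surj: "\<phi> ` G = G" using \<phi>G \<open>finite G\<close> by (intro endo_inj_surj) auto
    have \<tau>\<chi>: "\<tau> (\<chi> g) = \<chi> g" for g using \<tau> by (auto simp: \<chi>_def galQ_1 galQ_minus)
    have \<chi>\<phi>: "\<chi> (\<phi> g) * y = \<chi> g * \<tau> y" if "g \<in> G" for g
    proof -
      have "\<chi> (\<phi> g) * y = \<tau> (r g y)" using \<chi>y[OF \<phi>G[OF that]] r\<phi>[OF that yR] by simp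
      also have "\<dots> = \<chi> g * \<tau> y"
        using \<chi>y[OF that] galQ_mult[OF \<tau>, of "\<chi> g" y] \<chi>int y(1) \<tau>\<chi>
        by (simp add: algebraic_int_imp_algebraic)
      finally show ?thesis .
    qed
    have "\<tau> (T * y) = \<tau> T * \<tau> y"
      using T y by (intro galQ_mult \<tau>) auto
    also have "\<tau> T = (\<Sum>g\<in>G. \<tau> (\<chi> g * r g x))"
      unfolding T_def using rx \<chi>int by (intro galQ_sum \<tau>) (auto intro!: algebraic_mult)
    also have "\<dots> = (\<Sum>g\<in>G. \<chi> g * r (\<phi> g) x)"
    proof (rule sum.cong[OF refl])
      fix g assume g: "g \<in> G"
      have "\<tau> (\<chi> g * r g x) = \<tau> (\<chi> g) * \<tau> (r g x)"
        using rx[OF g] \<chi>int[of g] by (intro galQ_mult \<tau>) auto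
      then show "\<tau> (\<chi> g * r g x) = \<chi> g * r (\<phi> g) x" using \<tau>\<chi> r\<phi>[OF g x] by simp
    qed
    also have "\<dots> * \<tau> y = (\<Sum>g\<in>G. \<chi> (\<phi> g) * r (\<phi> g) x * y)"
      unfolding sum_distrib_right by (rule sum.cong) (use \<chi>\<phi> in \<open>auto simp: algebra_simps\<close>)
    also have "\<dots> = (\<Sum>g\<in>G. \<chi> g * r g x * y)"
      using sum.reindex[OF inj, of "\<lambda>g. \<chi> g * r g x * y"] surj by simp
    also have "\<dots> = T * y" by (simp add: T_def sum_distrib_right)
    finally show ?thesis .
  qed
  moreover have "algebraic_int (T * y)" using T y by blast
  ultimately obtain m where m: "T * y = of_int m" using fixed_by_galQ_imp_int by blast
  have "y ^ 2 \<in> I" unfolding y(2) of_int_iff by simp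
  then have yI: "y \<in> I" using power_iff[OF y(1)] by simp
  then have "of_int m \<in> I" using smult[OF T] m by metis
  then obtain m' where m': "m = int q * m'" using of_int_iff by (auto elim: dvdE)
  \<comment> \<open>One factor \<open>q\<close> of \<open>y\<^sup>2\<close> is cancelled against the
    one in \<open>m\<close>. What remains, \<open>T * of_int e\<close>, is a multiple of
    \<open>y\<close> and so lies in \<open>I\<close>.\<close>
  have "T * of_int e * of_nat q = of_int m' * y * of_nat q"
  proof -
    have "T * of_int e * of_nat q = T * y\<^sup>2" by (simp add: y(2) mult_ac)
    also have "\<dots> = of_int m * y" by (simp add: m[symmetric] power2_eq_square)
    finally show ?thesis by (simp add: m' mult_ac)
  qed
  moreover have "(of_nat q :: complex) \<noteq> 0" using prime by auto
  ultimately have "T * of_int e = of_int m' * y" by simp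
  also have "\<dots> \<in> I" using yI by (intro smult) auto
  finally have "T \<in> I \<or> of_int e \<in> I" using T primeD by auto
  then show False using xI of_int_iff y(3) by (auto simp: T_def)
qed

subsection \<open>The orbit of the critical point\<close>

text \<open>The orbit of the critical point \<open>- k (p - 1)\<close> under \<open>phi_pk p k\<close>, divided by \<open>k\<close>.\<close>

primrec crit_orbit :: "nat \<Rightarrow> nat \<Rightarrow> nat \<Rightarrow> int" where
  "crit_orbit p k 0 = 1 - int p"
| "crit_orbit p k (Suc n) =
     (int k * crit_orbit p k n) ^ (p - 1) * (crit_orbit p k n + int p) - int p"

lemma poly_phi_pk:
  assumes "p \<ge> 1"
  shows "poly (phi_pk p k) x = x ^ (p - 1) * (x + of_nat (k * p)) - of_nat (k * p)"
proof -
  have "x ^ p = x ^ (p - 1) * x" using assms by (cases p) auto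
  then show ?thesis by (simp add: phi_pk_def poly_monom algebra_simps)
qed

lemma phi_pk_crit_orbit:
  assumes "p \<ge> 1"
  shows "(poly (phi_pk p k) ^^ n) (- of_nat (k * (p - 1))) = of_int (int k * crit_orbit p k n)"
  using assms
  by (induction n) (auto simp: poly_phi_pk of_nat_diff algebra_simps)

context
  fixes p k :: nat
  assumes p: "prime p" "p \<ge> 3" and k: "k > 0" "\<not> p dvd k"
begin

lemma crit_orbit_add_p: "crit_orbit p k (Suc n) + int p = (int k * crit_orbit p k n) ^ (p - 1) * (crit_orbit p k n + int p)"
  by simp

text \<open>Modulo \<open>p\<close> the recursion is multiplication by
  \<open>(k c_n) ^ (p - 1)\<close>, starting from 1, and \<open>k\<close> is prime to
  \<open>p\<close>.\<close>

lemma p_not_dvd_crit_orbit: "\<not> int p dvd crit_orbit p k n"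
proof (induction n)
  case 0
  have "int p dvd 1" if "int p dvd 1 - int p"
    using dvd_add[OF that dvd_refl[of "int p"]] by simp
  then show ?case using p by auto
next
  case (Suc n)
  have pp: "Factorial_Ring.prime (int p)" using p by simp
  show ?case
  proof
    assume "int p dvd crit_orbit p k (Suc n)"
    then have "int p dvd crit_orbit p k (Suc n) + int p" by (simp only: dvd_add_triv_right_iff)
    then have "int p dvd (int k * crit_orbit p k n) ^ (p - 1) \<or> int p dvd crit_orbit p k n + int p"
      unfolding crit_orbit_add_p using prime_dvd_mult_iff[OF pp] by blast
    then have "int p dvd int k \<or> int p dvd crit_orbit p k n"
      using prime_dvd_mult_iff[OF pp, of "int k" "crit_orbit p k n"] prime_dvd_power[OF pp, of "int k * crit_orbit p k n" "p - 1"] by auto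
    then show False using k Suc by (simp add: int_dvd_int_iff)
  qed
qed

text \<open>If \<open>q\<close> divides \<open>c_m\<close>, the critical orbit meets 0 modulo
  \<open>q\<close> and is then caught in the fixed point \<open>-kp\<close>, so \<open>q\<close>
  divides \<open>c_j + p\<close> for all later \<open>j\<close>. A divisor of \<open>k\<close>
  likewise divides \<open>c_j + p\<close> for \<open>j > 0\<close>. Either would give
  \<open>q\<close> dividing \<open>p\<close>.\<close>

lemma prime_dvd_crit_orbit:
  assumes q: "prime q" "int q dvd crit_orbit p k (Suc n)"
  shows "\<not> q dvd p" "\<not> q dvd k" "m \<le> n \<Longrightarrow> \<not> int q dvd crit_orbit p k m"
proof -
  show qp: "\<not> q dvd p"
    using q p p_not_dvd_crit_orbit[of "Suc n"] by (metis primes_dvd_imp_eq)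
  have no: "\<not> int q dvd crit_orbit p k (Suc n) + int p"
    using qp q(2) by (metis dvd_add_right_iff int_dvd_int_iff)
  have pos: "p - 1 > 0" using p by simp
  show "\<not> q dvd k"
  proof
    assume "q dvd k"
    then have "int q dvd (int k * crit_orbit p k n) ^ (p - 1)"
      using pos by (metis dvd_mult2 dvd_power dvd_trans int_dvd_int_iff)
    then show False using no unfolding crit_orbit_add_p by (meson dvd_mult2)
  qed
  show "\<not> int q dvd crit_orbit p k m" if "m \<le> n"
  proof
    assume m: "int q dvd crit_orbit p k m"
    have "int q dvd crit_orbit p k (Suc (m + j)) + int p" for j
    proof (induction j)
      case 0
      have "int q dvd (int k * crit_orbit p k m) ^ (p - 1)"
        using m pos by (metis dvd_mult dvd_power dvd_trans)
      then show ?case unfolding crit_orbit_add_p by simp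
    next
      case (Suc j)
      then show ?case unfolding crit_orbit_add_p[of "Suc (m + j)"] add_Suc_right by (rule dvd_mult)
    qed
    from this[of "n - m"] show False using no that by simp
  qed
qed

lemma crit_orbit_add_p_square: "\<exists>Z \<ge> 0. crit_orbit p k n + int p = Z ^ 2"
proof (induction n)
  case 0
  show ?case by (intro exI[of _ 1]) simp
next
  case (Suc n)
  then obtain Z where Z: "crit_orbit p k n + int p = Z ^ 2" by blast
  have "odd p" using p primes_dvd_imp_eq[of 2 p] two_is_prime_nat by auto
  then obtain s where s: "p - 1 = 2 * s" by (auto elim!: oddE)
  have "crit_orbit p k (Suc n) + int p = ((int k * crit_orbit p k n) ^ s * Z) ^ 2"
    unfolding crit_orbit_add_p Z s by (simp add: power_mult_distrib power_mult[symmetric] mult.commute)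
  then show ?case by (intro exI[of _ "\<bar>(int k * crit_orbit p k n) ^ s * Z\<bar>"]) auto
qed

text \<open>From index 1 on the orbit does not decrease, so the value
  \<open>(k (p - 1)) ^ (p - 1) - p\<close> decides. In the excluded case it is 1, and the two sides
  are equal.\<close>

lemma crit_orbit_bound:
  assumes "\<not> (p = 3 \<and> k = 1)"
  shows "4 * crit_orbit p k (Suc n) > (int p - 1) ^ 2"
proof (induction n)
  case 0
  have eq: "crit_orbit p k (Suc 0) = (int k * (int p - 1)) ^ (p - 1) - int p"
  proof -
    have "even (p - 1)" using p primes_dvd_imp_eq[of 2 p] two_is_prime_nat by auto
    then have "(int k * (1 - int p)) ^ (p - 1) = (int k * (int p - 1)) ^ (p - 1)"
      by (metis minus_diff_eq mult_minus_right power_minus_even)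
    then show ?thesis by simp
  qed
  show ?case
  proof (cases "p = 3")
    case True
    then have "int k \<ge> 2" using assms k by auto
    then have "(int k) ^ 2 \<ge> 2 ^ 2" by (intro power_mono) auto
    then show ?thesis unfolding eq using True by (simp add: power_mult_distrib)
  next
    case False
    have "p \<noteq> 4" using p by auto
    then have p5: "p \<ge> 5" using p False by auto
    \<comment> \<open>With \<open>u\<close> at least 4 and exponent \<open>p - 1\<close> at least 4,
      the power is at least \<open>u ^ 4\<close>, hence at least \<open>16 * u ^ 2\<close>;
      subtracting \<open>p = u + 1\<close> leaves ample room.\<close>
    define u where "u = int p - 1"
    have u: "u \<ge> 4" using p5 by (simp add: u_def)
    have "u ^ 2 * u ^ 2 \<le> u ^ (p - 1)"
      using u p5 power_increasing[of 4 "p - 1" u] by (simp add: power_add[symmetric])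
    also have "\<dots> \<le> (int k * u) ^ (p - 1)"
      using u k by (intro power_mono) auto
    finally have 1: "u ^ 2 * u ^ 2 \<le> crit_orbit p k (Suc 0) + int p" unfolding eq u_def by simp
    have 2: "4 * u \<le> u ^ 2" using u by (simp add: power2_eq_square)
    then have "16 * u ^ 2 \<le> u ^ 2 * u ^ 2" using u by (intro mult_right_mono) auto
    then have "4 * crit_orbit p k (Suc 0) \<ge> 64 * u ^ 2 - 4 * int p" using 1 by simp
    moreover have "int p = u + 1" by (simp add: u_def)
    ultimately show ?thesis using 2 u unfolding u_def[symmetric] by linarith
  qed
next
  case (Suc n)
  have pos: "crit_orbit p k (Suc n) > 0"
  proof -
    have "(int p - 1) ^ 2 \<ge> 0" by simp
    then show ?thesis using Suc by linarith
  qed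
  then have "int k * crit_orbit p k (Suc n) \<ge> 1" using k by (simp add: int_one_le_iff_zero_less)
  then have "(int k * crit_orbit p k (Suc n)) ^ (p - 1) \<ge> 1" by (rule one_le_power)
  then have "(int k * crit_orbit p k (Suc n)) ^ (p - 1) * (crit_orbit p k (Suc n) + int p) \<ge> crit_orbit p k (Suc n) + int p"
    using pos by (simp add: mult_le_cancel_right1)
  then have "crit_orbit p k (Suc (Suc n)) \<ge> crit_orbit p k (Suc n)"
    using crit_orbit_add_p[of "Suc n"] by linarith
  then show ?case using Suc by linarith
qed

lemma crit_orbit_not_square:
  assumes "\<not> (p = 3 \<and> k = 1)"
  shows "crit_orbit p k (Suc n) \<noteq> y ^ 2"
proof
  assume "crit_orbit p k (Suc n) = y ^ 2"
  then have y: "crit_orbit p k (Suc n) = \<bar>y\<bar> ^ 2" by simp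
  obtain Z where Z: "Z \<ge> 0" "crit_orbit p k (Suc n) + int p = Z ^ 2"
    using crit_orbit_add_p_square by blast
  define w where "w = \<bar>y\<bar>"
  have w0: "w \<ge> 0" by (simp add: w_def)
  have prod: "(Z - w) * (Z + w) = int p"
    using Z y by (simp add: w_def algebra_simps power2_eq_square)
  then have "(Z - w) * (Z + w) > 0" using p by simp
  moreover have "Z + w \<ge> 0" using Z w0 by simp
  ultimately have pos: "Z - w > 0" by (metis mult_nonpos_nonneg not_less)
  have pp: "Factorial_Ring.prime (int p)" using p by simp
  have "Z - w dvd int p" using prod by (metis dvd_triv_left)
  then have "Z - w = 1 \<or> Z - w = int p"
    using pp pos by (metis prime_int_iff less_imp_le)
  then have "Z - w = 1"
  proof
    assume "Z - w = int p"
    then have "Z + w = 1" using prod p by simp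
    then show ?thesis using \<open>Z - w = int p\<close> w0 p by simp
  qed simp
  then have "2 * w = int p - 1" using prod by simp
  then have "(2 * w) ^ 2 = (int p - 1) ^ 2" by simp
  then have "4 * w ^ 2 = (int p - 1) ^ 2" by (simp only: power_mult_distrib) simp
  then show False using crit_orbit_bound[OF assms, of n] y by (simp add: w_def)
qed

lemma crit_orbit_odd_prime:
  assumes "\<not> (p = 3 \<and> k = 1)"
  obtains q r e where "prime q" "crit_orbit p k (Suc n) = int q ^ (2 * r + 1) * e" "\<not> int q dvd e"
proof -
  define m where "m = nat (crit_orbit p k (Suc n))"
  \<comment> \<open>Positivity matters here: minus a square also has only even
    multiplicities.\<close>
  have "(int p - 1) ^ 2 \<ge> 0" by simp
  then have pos: "crit_orbit p k (Suc n) > 0" using crit_orbit_bound[OF assms, of n] by linarith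
  then have m: "int m = crit_orbit p k (Suc n)" by (simp add: m_def)
  have "\<not> is_nth_power 2 m"
  proof
    assume "is_nth_power 2 m"
    then obtain y where "m = y ^ 2" by (auto simp: is_nth_power_def)
    then have "crit_orbit p k (Suc n) = int y ^ 2" using m by simp
    then show False using crit_orbit_not_square[OF assms] by blast
  qed
  moreover have "m > 0" using m pos by simp
  ultimately obtain q where q: "prime q" "\<not> 2 dvd multiplicity q m"
    by (subst (asm) is_nth_power_conv_multiplicity_nat) auto
  then obtain r where r: "multiplicity q m = 2 * r + 1" by (auto elim: oddE)
  obtain e where e: "m = q ^ multiplicity q m * e" "\<not> q dvd e"
    using multiplicity_decompose'[of m q] \<open>m > 0\<close> q(1) by (metis not_prime_unit not_gr_zero)
  have "crit_orbit p k (Suc n) = int q ^ (2 * r + 1) * int e"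
    using m e(1) r by (metis of_nat_mult of_nat_power)
  with e(2) q(1) show ?thesis by (intro that[of q r "int e"]) (auto simp: int_dvd_int_iff)
qed

end

lemma crit_orbit_3_1: "crit_orbit 3 1 (Suc n) = 1"
  by (induction n) auto

text \<open>The polynomial \<open>x^3 + 3x^2 - 3\<close> sends its critical point -2 to 1 and fixes
  1.\<close>

lemma infinite_orbit_imp_not_3_1:
  assumes "infinite (range (\<lambda>n. (poly (phi_pk p k) ^^ n) (- of_nat (k * (p - 1)))))"
  shows "\<not> (p = 3 \<and> k = 1)"
proof
  assume pk: "p = 3 \<and> k = 1"
  have "(poly (phi_pk p k) ^^ n) (- of_nat (k * (p - 1))) \<in> {- 2, 1}" for n
  proof -
    have "(poly (phi_pk p k) ^^ n) (- of_nat (k * (p - 1))) = of_int (int k * crit_orbit p k n)"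
      using pk by (intro phi_pk_crit_orbit) simp
    then show ?thesis
      using pk crit_orbit_3_1 by (cases n) (simp_all del: crit_orbit.simps(2))
  qed
  then have "range (\<lambda>n. (poly (phi_pk p k) ^^ n) (- of_nat (k * (p - 1)))) \<subseteq> {- 2, 1}" by blast
  then show False using assms finite_subset by blast
qed

subsection \<open>Preimages of zero and the discriminants of the iterates\<close>

lemma pcompose_coeff_Ints:
  fixes P Q :: "complex poly"
  assumes "\<forall>i. coeff P i \<in> \<int>" "\<forall>i. coeff Q i \<in> \<int>"
  shows "\<forall>i. coeff (pcompose P Q) i \<in> \<int>"
  using assms(1)
proof (induction P)
  case 0
  then show ?case by simp
next
  case (pCons a P)
  have "coeff (pCons a P) 0 \<in> \<int>" "coeff (pCons a P) (Suc i) \<in> \<int>" for i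
    using pCons.prems by blast+
  then have "a \<in> \<int>" "\<forall>i. coeff P i \<in> \<int>" by auto
  with pCons.IH have "\<forall>i. coeff (pcompose P Q) i \<in> \<int>" by blast
  then show ?case
    using \<open>a \<in> \<int>\<close> assms(2)
    by (auto simp: pcompose_pCons coeff_mult coeff_pCons intro!: Ints_add Ints_sum Ints_mult split: nat.split)
qed

lemma monic_rsquarefree_complex:
  fixes P :: "complex poly"
  assumes "rsquarefree P" "lead_coeff P = 1"
  shows "P = (\<Prod>z | poly P z = 0. [:- z, 1:])" "card {z. poly P z = 0} = degree P"
proof -
  show eq: "P = (\<Prod>z | poly P z = 0. [:- z, 1:])"
    using complex_poly_decompose_rsquarefree[OF assms(1)] assms(2) by simp
  show "card {z. poly P z = 0} = degree P"
    by (subst (2) eq, subst degree_prod_sum_eq) auto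
qed

locale phi_tree =
  fixes p k :: nat
  assumes p: "prime p" "p \<ge> 3" and k: "k > 0" "\<not> p dvd k"
    and rsf: "n \<ge> 1 \<Longrightarrow> rsquarefree (poly_iter (phi_pk p k) n)"
    and not_3_1: "\<not> (p = 3 \<and> k = 1)"
begin

definition f :: "complex poly" where "f = phi_pk p k"

definition V :: "nat \<Rightarrow> complex set" where "V n = {z. poly (poly_iter f n) z = 0}"

definition fib :: "complex \<Rightarrow> complex set" where "fib \<alpha> = {z. poly f z = \<alpha>}"

definition crit :: complex where "crit = - of_nat (k * (p - 1))"

lemma poly_f: "poly f x = x ^ (p - 1) * (x + of_nat (k * p)) - of_nat (k * p)"
  using p by (simp add: f_def poly_phi_pk)

lemma degree_f: "degree f = p" and lead_coeff_f: "lead_coeff f = 1"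
proof -
  have *: "coeff f n = (if n = p then 1 else 0)" if "n \<ge> p" for n
    using that p by (auto simp: f_def phi_pk_def coeff_pCons split: nat.split)
  show "degree f = p"
  proof (rule antisym)
    show "degree f \<le> p" using * by (intro degree_le) auto
    show "p \<le> degree f" using *[of p] by (intro le_degree) auto
  qed
  then show "lead_coeff f = 1" using *[of p] by simp
qed

lemma coeff_f_Ints: "\<forall>i. coeff f i \<in> \<int>"
  by (auto simp: f_def phi_pk_def coeff_pCons simp flip: of_nat_mult split: nat.split)

lemma poly_iter_0: "poly_iter f 0 = [:0, 1:]"
  by (simp add: poly_iter_def)

lemma poly_iter_Suc: "poly_iter f (Suc n) = pcompose f (poly_iter f n)"
  by (simp add: poly_iter_def)

lemma poly_iter_Suc': "poly_iter f (Suc n) = pcompose (poly_iter f n) f"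
proof (induction n)
  case 0
  show ?case by (simp add: poly_iter_Suc poly_iter_0 pcompose_pCons)
next
  case (Suc n)
  then show ?case by (metis pcompose_assoc poly_iter_Suc)
qed

lemma poly_poly_iter: "poly (poly_iter f n) x = (poly f ^^ n) x"
  by (induction n) (auto simp: poly_iter_0 poly_iter_Suc poly_pcompose)

lemma V_iff: "z \<in> V n \<longleftrightarrow> (poly f ^^ n) z = 0"
  by (simp add: V_def poly_poly_iter)

lemma V_0: "V 0 = {0}"
  by (auto simp: V_iff)

lemma V_Suc_iff: "z \<in> V (Suc n) \<longleftrightarrow> poly f z \<in> V n"
  by (simp add: V_iff funpow_Suc_right del: funpow.simps)

lemma degree_iter: "degree (poly_iter f n) = p ^ n"
  by (induction n) (auto simp: poly_iter_0 poly_iter_Suc degree_pcompose degree_f)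

lemma lead_coeff_iter: "lead_coeff (poly_iter f n) = 1"
proof (induction n)
  case 0
  show ?case by (simp add: poly_iter_0)
next
  case (Suc n)
  have "degree (poly_iter f n) > 0" using p by (simp add: degree_iter)
  then show ?case
    using Suc by (simp only: poly_iter_Suc lead_coeff_comp lead_coeff_f power_one mult_1)
qed

lemma coeff_iter_Ints: "\<forall>i. coeff (poly_iter f n) i \<in> \<int>"
proof (induction n)
  case 0
  show ?case by (auto simp: poly_iter_0 coeff_pCons split: nat.split)
next
  case (Suc n)
  then show ?case unfolding poly_iter_Suc by (rule pcompose_coeff_Ints[OF coeff_f_Ints])
qed

lemma rsquarefree_iter: "rsquarefree (poly_iter f n)"
proof (cases n)
  case 0
  then show ?thesis by (simp add: poly_iter_0 rsquarefree_roots pderiv_pCons)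
next
  case (Suc m)
  then show ?thesis using rsf[of n] by (simp add: f_def)
qed

lemma iter_eq_prod: "poly_iter f n = (\<Prod>z\<in>V n. [:- z, 1:])"
  and card_V: "card (V n) = p ^ n"
  using monic_rsquarefree_complex[OF rsquarefree_iter lead_coeff_iter, of n]
  by (auto simp: V_def degree_iter)

lemma finite_V: "finite (V n)"
  using card_V[of n] p by (intro card_ge_0_finite) auto

lemma V_algebraic_int: "z \<in> V n \<Longrightarrow> algebraic_int z"
  using lead_coeff_iter coeff_iter_Ints by (intro algebraic_int.intros) (auto simp: V_def)

lemma V_algebraic: "z \<in> V n \<Longrightarrow> algebraic z"
  using V_algebraic_int by blast

lemma fib_subset: "\<alpha> \<in> V n \<Longrightarrow> fib \<alpha> \<subseteq> V (Suc n)"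
  by (auto simp: fib_def V_Suc_iff)

lemma pderiv_iter_Suc:
  "poly (pderiv (poly_iter f (Suc n))) x = poly (pderiv (poly_iter f n)) (poly f x) * poly (pderiv f) x"
  by (simp add: poly_iter_Suc' pderiv_pcompose poly_pcompose)

text \<open>By the chain rule a double root of \<open>f - [:\<alpha>:]\<close> would be a double
  root of the next iterate, so separability of the iterates makes every fibre in the tree
  full.\<close>

lemma f_minus_const:
  assumes "\<alpha> \<in> V n"
  shows "f - [:\<alpha>:] = (\<Prod>z\<in>fib \<alpha>. [:- z, 1:])" "card (fib \<alpha>) = p"
proof -
  have deg: "degree (f - [:\<alpha>:]) = p" and lc: "lead_coeff (f - [:\<alpha>:]) = 1"
  proof -
    show "degree (f - [:\<alpha>:]) = p"
      unfolding diff_conv_add_uminus using degree_f p by (subst degree_add_eq_left) auto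
    then show "lead_coeff (f - [:\<alpha>:]) = 1"
      using lead_coeff_f degree_f p by (simp add: coeff_pCons split: nat.split)
  qed
  have "rsquarefree (f - [:\<alpha>:])"
    unfolding rsquarefree_roots
  proof (intro allI notI)
    fix \<beta> assume *: "poly (f - [:\<alpha>:]) \<beta> = 0 \<and> poly (pderiv (f - [:\<alpha>:])) \<beta> = 0"
    then have "poly (pderiv (poly_iter f (Suc n))) \<beta> = 0"
      by (simp add: pderiv_iter_Suc pderiv_diff pderiv_pCons)
    moreover have "poly (poly_iter f (Suc n)) \<beta> = 0"
      using * assms V_Suc_iff[of \<beta> n] by (simp add: V_def)
    ultimately show False using rsquarefree_iter[of "Suc n"] by (auto simp: rsquarefree_roots)
  qed
  note * = monic_rsquarefree_complex[OF this lc]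
  have roots: "{z. poly (f - [:\<alpha>:]) z = 0} = fib \<alpha>" by (auto simp: fib_def)
  show "f - [:\<alpha>:] = (\<Prod>z\<in>fib \<alpha>. [:- z, 1:])"
    using *(1) unfolding roots .
  show "card (fib \<alpha>) = p"
    using *(2) unfolding roots deg .
qed

lemma prod_fibres:
  "(\<Prod>\<beta>\<in>V (Suc n). g \<beta>) = (\<Prod>\<alpha>\<in>V n. \<Prod>\<beta>\<in>fib \<alpha>. (g \<beta> :: complex))"
proof -
  have "(\<Prod>\<beta>\<in>V (Suc n). g \<beta>) = (\<Prod>\<alpha>\<in>V n. \<Prod>\<beta>\<in>{\<beta>. \<beta> \<in> V (Suc n) \<and> poly f \<beta> = \<alpha>}. g \<beta>)"
    by (rule prod.group[symmetric]) (auto simp: finite_V V_Suc_iff)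
  also have "\<dots> = (\<Prod>\<alpha>\<in>V n. \<Prod>\<beta>\<in>fib \<alpha>. g \<beta>)"
    by (intro prod.cong) (auto simp: fib_def V_Suc_iff)
  finally show ?thesis .
qed

lemma prod_V: "(\<Prod>\<beta>\<in>V n. \<beta> - x) = (- 1) ^ card (V n) * (poly f ^^ n) x"
proof -
  have "(poly f ^^ n) x = (\<Prod>\<beta>\<in>V n. x - \<beta>)"
    unfolding poly_poly_iter[symmetric] by (subst iter_eq_prod) (simp add: poly_prod)
  also have "\<dots> = (\<Prod>\<beta>\<in>V n. (- 1) * (\<beta> - x))" by simp
  also have "\<dots> = (- 1) ^ card (V n) * (\<Prod>\<beta>\<in>V n. \<beta> - x)"
    by (subst prod.distrib) simp
  finally show ?thesis by (simp add: power_mult_distrib[symmetric] mult.assoc[symmetric])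
qed

lemma f_0: "poly f 0 = - of_nat (k * p)"
  using p by (simp add: poly_f)

lemma f_fixpoint: "poly f (- of_nat (k * p)) = - of_nat (k * p)"
  by (simp add: poly_f)

lemma iter_0: "(poly f ^^ Suc n) 0 = - of_nat (k * p)"
  by (induction n) (simp_all only: funpow.simps o_apply f_0 f_fixpoint id_apply)

lemma iter_crit: "(poly f ^^ n) crit = of_int (int k * crit_orbit p k n)"
  using phi_pk_crit_orbit[of p n k] p by (simp add: f_def crit_def)

lemma pderiv_f: "poly (pderiv f) x = of_nat p * x ^ (p - 2) * (x - crit)"
proof -
  obtain r where "p = Suc (Suc r)" using p(2) by (intro that[of "p - 2"]) simp
  then show ?thesis
    unfolding f_def crit_def phi_pk_def
    by (simp add: pderiv_add pderiv_diff pderiv_monom pderiv_pCons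
        poly_monom algebra_simps)
qed

text \<open>By \<open>pderiv_f\<close> the product splits into values of the iterate, up to sign, at
  the critical points 0 and \<open>crit\<close>. These are \<open>-kp\<close> and \<open>k\<close>
  times the orbit value, so \<open>w\<close> collects only signs and powers of \<open>p\<close> and
  \<open>k\<close>.\<close>

lemma prod_pderiv_f:
  obtains w where "(\<Prod>\<beta>\<in>V (Suc n). poly (pderiv f) \<beta>) = of_int (w * crit_orbit p k (Suc n))"
    and "\<And>q. prime q \<Longrightarrow> \<not> q dvd p \<Longrightarrow> \<not> q dvd k \<Longrightarrow> \<not> int q dvd w"
proof -
  define N where "N = card (V (Suc n))"
  define w where "w = int p ^ N * ((- 1) ^ N * - int (k * p)) ^ (p - 2) * ((- 1) ^ N * int k)"
  have "(\<Prod>\<beta>\<in>V (Suc n). poly (pderiv f) \<beta>)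
      = of_nat p ^ N * (\<Prod>\<beta>\<in>V (Suc n). \<beta> - 0) ^ (p - 2) * (\<Prod>\<beta>\<in>V (Suc n). \<beta> - crit)"
    by (simp add: pderiv_f prod.distrib prod_power_distrib N_def)
  also have "\<dots> = of_nat p ^ N * ((- 1) ^ N * - of_nat (k * p)) ^ (p - 2)
      * ((- 1) ^ N * of_int (int k * crit_orbit p k (Suc n)))"
    unfolding prod_V iter_crit iter_0 N_def ..
  also have "\<dots> = of_int (w * crit_orbit p k (Suc n))"
    by (simp add: w_def)
  finally have "(\<Prod>\<beta>\<in>V (Suc n). poly (pderiv f) \<beta>) = of_int (w * crit_orbit p k (Suc n))" .
  moreover have "\<not> int q dvd w" if q: "prime q" "\<not> q dvd p" "\<not> q dvd k" for q
  proof -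
    have qq: "Factorial_Ring.prime (int q)" using q by simp
    have unit: "\<not> int q dvd (- 1) ^ N"
    proof
      assume "int q dvd (- 1) ^ N"
      then have "int q dvd - 1" by (rule prime_dvd_power[OF qq])
      then show False using q(1) by simp
    qed
    show ?thesis
      unfolding w_def using q unit
      by (auto simp: prime_dvd_mult_iff[OF qq] int_dvd_int_iff dest!: prime_dvd_power[OF qq])
  qed
  ultimately show ?thesis using that by blast
qed

text \<open>The discriminant formula for a tower, up to sign. By the chain rule each value at
  \<alpha> occurs once for each of the \<open>p\<close> points of its fibre.\<close>

lemma prod_pderiv_iter_Suc:
  "(\<Prod>\<beta>\<in>V (Suc n). poly (pderiv (poly_iter f (Suc n))) \<beta>)
     = (\<Prod>\<alpha>\<in>V n. poly (pderiv (poly_iter f n)) \<alpha>) ^ p * (\<Prod>\<beta>\<in>V (Suc n). poly (pderiv f) \<beta>)"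
proof -
  have "(\<Prod>\<beta>\<in>V (Suc n). poly (pderiv (poly_iter f n)) (poly f \<beta>))
      = (\<Prod>\<alpha>\<in>V n. \<Prod>\<beta>\<in>fib \<alpha>. poly (pderiv (poly_iter f n)) \<alpha>)"
    unfolding prod_fibres by (intro prod.cong) (auto simp: fib_def)
  also have "\<dots> = (\<Prod>\<alpha>\<in>V n. poly (pderiv (poly_iter f n)) \<alpha>) ^ p"
    using f_minus_const(2)[of _ n] by (simp add: prod_power_distrib)
  finally show ?thesis by (simp add: pderiv_iter_Suc prod.distrib)
qed

text \<open>Unwinding the tower, the discriminant of a level has only prime factors of
  \<open>p\<close>, \<open>k\<close> and the orbit up to that level. A prime that first appears in
  the orbit at the next level therefore leaves this level unramified.\<close>

lemma discriminant_unit: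
  "\<exists>E. (\<Prod>\<beta>\<in>V n. poly (pderiv (poly_iter f n)) \<beta>) = of_int E \<and>
     (\<forall>q. prime q \<longrightarrow> \<not> q dvd p \<longrightarrow> \<not> q dvd k \<longrightarrow>
        (\<forall>m\<le>n. \<not> int q dvd crit_orbit p k m) \<longrightarrow> \<not> int q dvd E)"
proof (induction n)
  case 0
  show ?case
    by (intro exI[of _ 1]) (auto simp: V_0 poly_iter_0 pderiv_pCons)
next
  case (Suc n)
  then obtain E where E: "(\<Prod>\<beta>\<in>V n. poly (pderiv (poly_iter f n)) \<beta>) = of_int E"
    "\<And>q. prime q \<Longrightarrow> \<not> q dvd p \<Longrightarrow> \<not> q dvd k \<Longrightarrow>
        (\<forall>m\<le>n. \<not> int q dvd crit_orbit p k m) \<Longrightarrow> \<not> int q dvd E"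
    by blast
  obtain w where w: "(\<Prod>\<beta>\<in>V (Suc n). poly (pderiv f) \<beta>) = of_int (w * crit_orbit p k (Suc n))"
    "\<And>q. prime q \<Longrightarrow> \<not> q dvd p \<Longrightarrow> \<not> q dvd k \<Longrightarrow> \<not> int q dvd w"
    using prod_pderiv_f[of n] by blast
  show ?case
  proof (intro exI[of _ "E ^ p * (w * crit_orbit p k (Suc n))"] conjI allI impI)
    show "(\<Prod>\<beta>\<in>V (Suc n). poly (pderiv (poly_iter f (Suc n))) \<beta>)
        = of_int (E ^ p * (w * crit_orbit p k (Suc n)))"
      unfolding prod_pderiv_iter_Suc E(1) w(1) by simp
  next
    fix q assume q: "prime q" "\<not> q dvd p" "\<not> q dvd k" "\<forall>m\<le>Suc n. \<not> int q dvd crit_orbit p k m"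
    then have qq: "Factorial_Ring.prime (int q)" by simp
    have "\<not> int q dvd E" using E(2) q by simp
    moreover have "\<not> int q dvd w" using w(2) q by simp
    moreover have "\<not> int q dvd crit_orbit p k (Suc n)" using q(4) by blast
    moreover have "\<not> int q dvd E ^ p" using calculation(1) prime_dvd_power[OF qq] by blast
    ultimately show "\<not> int q dvd E ^ p * (w * crit_orbit p k (Suc n))"
      by (simp only: prime_dvd_mult_iff[OF qq] simp_thms)
  qed
qed

end

subsection \<open>A transposition at each level\<close>

lemma algebraic_int_poly_Ints:
  fixes P :: "complex poly"
  assumes "\<forall>i. coeff P i \<in> \<int>" "algebraic_int x"
  shows "algebraic_int (poly P x)"
  unfolding poly_altdef using assms
  by (intro algebraic_int_sum algebraic_int_mult algebraic_int_power) (auto intro: int_imp_algebraic_int)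

lemma galQ_poly_Ints:
  assumes "\<sigma> \<in> galQ" "\<forall>i. coeff P i \<in> \<int>" "algebraic x"
  shows "\<sigma> (poly P x) = poly P (\<sigma> x)"
proof -
  have c: "\<sigma> (coeff P i) = coeff P i" "algebraic (coeff P i)" for i
    using assms(2) galQ_of_int[OF assms(1)] by (metis Ints_cases algebraic_of_int)+
  show ?thesis
    unfolding poly_altdef using assms c
    by (simp add: galQ_sum galQ_mult galQ_power algebraic_mult algebraic_power)
qed

lemma (in prime_over) poly_cong:
  assumes "\<forall>i. coeff P i \<in> \<int>" "algebraic_int x" "algebraic_int y" "x - y \<in> I"
  shows "poly P x - poly P y \<in> I"
  using assms(1)
proof (induction P)
  case 0
  then show ?case by (simp add: zero)
next
  case (pCons a P)
  have P: "\<forall>i. coeff P i \<in> \<int>"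
    using pCons.prems by (metis coeff_pCons_Suc)
  have "poly (pCons a P) x - poly (pCons a P) y = x * (poly P x - poly P y) + poly P y * (x - y)"
    by (simp add: algebra_simps)
  also have "\<dots> \<in> I"
    using assms(2,3,4) pCons.IH[OF P] P by (intro add smult algebraic_int_poly_Ints) auto
  finally show ?case .
qed

lemma pderiv_prod_linear_at_root:
  fixes S :: "'a::idom set"
  assumes "finite S" "a \<in> S"
  shows "poly (pderiv (\<Prod>z\<in>S. [:- z, 1:])) a = (\<Prod>z\<in>S - {a}. a - z)"
proof -
  have "(\<Prod>z\<in>S. [:- z, 1:]) = [:- a, 1:] * (\<Prod>z\<in>S - {a}. [:- z, 1:])"
    using assms by (rule prod.remove)
  then have "poly (pderiv (\<Prod>z\<in>S. [:- z, 1:])) a = poly (\<Prod>z\<in>S - {a}. [:- z, 1:]) a"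
    by (simp only: pderiv_mult) (simp add: pderiv_pCons)
  then show ?thesis by (simp add: poly_prod)
qed

text \<open>An arbitrary injection into the naturals serves as an order on \<open>S\<close> and
  selects one of each two opposite pairs. Reversing the pairs costs one sign each, so
  \<open>s\<close> is the number of selected pairs.\<close>

lemma Vandermonde_square:
  fixes S :: "complex set"
  assumes "finite S"
  obtains P s where "finite P" "P \<subseteq> S \<times> S"
    "(\<Prod>(x, y)\<in>P. x - y)\<^sup>2 = (- 1) ^ s * (\<Prod>x\<in>S. \<Prod>y\<in>S - {x}. x - y)"
proof -
  obtain h :: "complex \<Rightarrow> nat" where h: "inj_on h S"
    using finite_imp_inj_to_nat_seg[OF assms] by blast
  define P where "P = {(x, y). x \<in> S \<and> y \<in> S \<and> h x < h y}"
  have PS: "P \<subseteq> S \<times> S" by (auto simp: P_def)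
  then have finP: "finite P" using assms finite_subset by blast
  define D where "D = (\<Prod>(x, y)\<in>P. x - y)"
  have "(\<Prod>x\<in>S. \<Prod>y\<in>S - {x}. x - y) = (\<Prod>(x, y)\<in>(SIGMA x:S. S - {x}). x - y)"
    using assms by (subst prod.Sigma) auto
  also have "(SIGMA x:S. S - {x}) = P \<union> P\<inverse>"
    using inj_onD[OF h] by (auto simp: P_def) (metis nat_neq_iff)
  also have "(\<Prod>(x, y)\<in>P \<union> P\<inverse>. x - y) = D * (\<Prod>(x, y)\<in>P\<inverse>. x - y)"
    unfolding D_def using finP by (intro prod.union_disjoint) (auto simp: P_def)
  also have "(\<Prod>(x, y)\<in>P\<inverse>. x - y) = (\<Prod>(x, y)\<in>P. y - x)"
    by (rule prod.reindex_bij_witness[of _ prod.swap prod.swap]) auto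
  also have "\<dots> = (\<Prod>(x, y)\<in>P. (- 1) * (x - y))"
    by (intro prod.cong) auto
  also have "\<dots> = (- 1) ^ card P * D"
    unfolding D_def case_prod_unfold prod.distrib by simp
  finally have "(\<Prod>x\<in>S. \<Prod>y\<in>S - {x}. x - y) = D * ((- 1) ^ card P * D)" .
  then have "D\<^sup>2 = (- 1) ^ card P * (\<Prod>x\<in>S. \<Prod>y\<in>S - {x}. x - y)"
    by (simp add: power2_eq_square mult.assoc[symmetric] power_mult_distrib[symmetric])
  then show ?thesis using that finP PS unfolding D_def by blast
qed

context phi_tree
begin

lemma galQ_f: "\<sigma> \<in> galQ \<Longrightarrow> algebraic x \<Longrightarrow> \<sigma> (poly f x) = poly f (\<sigma> x)"
  using galQ_poly_Ints coeff_f_Ints by blast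

lemma galQ_V:
  assumes "\<sigma> \<in> galQ" "z \<in> V n"
  shows "\<sigma> z \<in> V n"
proof -
  have "poly (poly_iter f n) (\<sigma> z) = \<sigma> (poly (poly_iter f n) z)"
    using galQ_poly_Ints[OF assms(1) coeff_iter_Ints V_algebraic[OF assms(2)]] by simp
  then show ?thesis using assms galQ_0 by (simp add: V_def)
qed

lemma galQ_V_surj:
  assumes "\<sigma> \<in> galQ" shows "bij_betw \<sigma> (V n) (V n)"
proof -
  have "inj_on \<sigma> (V n)"
    using galQ_inj[OF assms] V_algebraic by (meson inj_onI)
  moreover from this have "\<sigma> ` V n = V n"
    using galQ_V[OF assms] by (intro endo_inj_surj finite_V) auto
  ultimately show ?thesis by (simp add: bij_betw_def)
qed

lemma pderiv_iter_root:
  "\<alpha> \<in> V n \<Longrightarrow> poly (pderiv (poly_iter f n)) \<alpha> = (\<Prod>\<gamma>\<in>V n - {\<alpha>}. \<alpha> - \<gamma>)"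
  using pderiv_prod_linear_at_root[OF finite_V] by (simp add: iter_eq_prod)

lemma pderiv_f_root:
  assumes "\<beta> \<in> V (Suc n)"
  shows "poly (pderiv f) \<beta> = (\<Prod>\<gamma>\<in>fib (poly f \<beta>) - {\<beta>}. \<beta> - \<gamma>)"
proof -
  have \<alpha>: "poly f \<beta> \<in> V n" using assms by (simp add: V_Suc_iff)
  have fin: "finite (fib (poly f \<beta>))" using finite_subset[OF fib_subset[OF \<alpha>] finite_V] .
  have "pderiv f = pderiv (f - [:poly f \<beta>:])" by (simp add: pderiv_diff pderiv_pCons)
  also have "\<dots> = pderiv (\<Prod>z\<in>fib (poly f \<beta>). [:- z, 1:])"
    using f_minus_const(1)[OF \<alpha>] by simp
  finally show ?thesis
    using pderiv_prod_linear_at_root[OF fin, of \<beta>] by (simp add: fib_def)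
qed

end

section \<open>Reduction of the roots modulo a prime dividing the critical orbit to an odd
  power\<close>

locale phi_ramified = phi_tree + prime_over q I for q I +
  fixes n r :: nat and e :: int
  assumes q_exact: "crit_orbit p k (Suc n) = int q ^ (2 * r + 1) * e" "\<not> int q dvd e"
begin

lemma q_dvd: "int q dvd crit_orbit p k (Suc n)"
  by (simp add: q_exact del: crit_orbit.simps)

lemma q_units: "\<not> q dvd p" "\<not> q dvd k" "m \<le> n \<Longrightarrow> \<not> int q dvd crit_orbit p k m"
  using prime_dvd_crit_orbit[OF p k prime q_dvd] by auto

text \<open>Two congruent roots would put the discriminant of level \<open>n\<close> into
  \<open>I\<close>, but \<open>q\<close> does not divide it.\<close>

lemma V_distinct_mod:
  assumes "\<alpha> \<in> V n" "\<gamma> \<in> V n" "\<alpha> - \<gamma> \<in> I"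
  shows "\<alpha> = \<gamma>"
proof (rule ccontr)
  assume ne: "\<alpha> \<noteq> \<gamma>"
  obtain E where E: "(\<Prod>\<beta>\<in>V n. poly (pderiv (poly_iter f n)) \<beta>) = of_int E"
    "\<not> int q dvd E"
    using discriminant_unit[of n] prime q_units by blast
  have alg: "algebraic_int (\<beta> - \<delta>)" if "\<beta> \<in> V n" "\<delta> \<in> V n" for \<beta> \<delta>
    using that V_algebraic_int by blast
  have "(\<Prod>\<beta>\<in>V n. \<Prod>\<delta>\<in>V n - {\<beta>}. \<beta> - \<delta>) = of_int E"
    using E(1) pderiv_iter_root by (metis (no_types, lifting) prod.cong)
  moreover have "(\<Prod>\<beta>\<in>V n. \<Prod>\<delta>\<in>V n - {\<beta>}. \<beta> - \<delta>) \<in> I"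
  proof (subst prod_iff[OF finite_V])
    show "algebraic_int (\<Prod>\<delta>\<in>V n - {\<beta>}. \<beta> - \<delta>)" if "\<beta> \<in> V n" for \<beta>
      using alg that by (intro algebraic_int_prod) auto
    have "(\<Prod>\<delta>\<in>V n - {\<alpha>}. \<alpha> - \<delta>) \<in> I"
      using assms ne alg finite_V by (subst prod_iff) auto
    then show "\<exists>\<beta>\<in>V n. (\<Prod>\<delta>\<in>V n - {\<beta>}. \<beta> - \<delta>) \<in> I" using assms(1) by blast
  qed
  ultimately show False using of_int_iff E(2) by simp
qed

text \<open>Keeps the roots away from the critical point 0 modulo \<open>I\<close>: the iterate
  takes the value \<open>-kp\<close> at 0, and \<open>q\<close> does not divide
  \<open>k p\<close>.\<close>

lemma V_Suc_notin:
  assumes "\<beta> \<in> V (Suc n)" shows "\<beta> \<notin> I"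
proof
  assume "\<beta> \<in> I"
  then have "poly (poly_iter f (Suc n)) \<beta> - poly (poly_iter f (Suc n)) 0 \<in> I"
    using V_algebraic_int[OF assms] by (intro poly_cong coeff_iter_Ints) auto
  moreover have "poly (poly_iter f (Suc n)) \<beta> = 0" using assms by (simp add: V_def)
  ultimately have "of_nat (k * p) \<in> I" by (simp only: poly_poly_iter iter_0) simp
  then have "q dvd k * p" by (simp only: of_nat_iff)
  then show False using q_units prime by (simp add: prime_dvd_mult_iff)
qed

text \<open>The images under \<open>f\<close> are congruent roots of the lower level, hence equal.
  The derivative at \<beta>, being the product of the differences to the rest of its fibre, then
  lies in \<open>I\<close>, and its factors \<open>p\<close> and \<beta> do not.\<close>

lemma congruent_imp:
  assumes "\<beta> \<in> V (Suc n)" "\<gamma> \<in> V (Suc n)" "\<beta> \<noteq> \<gamma>" "\<beta> - \<gamma> \<in> I"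
  shows "poly f \<beta> = poly f \<gamma>" "\<beta> - crit \<in> I"
proof -
  have int: "algebraic_int \<beta>" "algebraic_int \<gamma>" using assms V_algebraic_int by auto
  have "poly f \<beta> - poly f \<gamma> \<in> I"
    using assms int by (intro poly_cong coeff_f_Ints)
  then show eq: "poly f \<beta> = poly f \<gamma>"
    using assms by (intro V_distinct_mod) (auto simp: V_Suc_iff)
  have sub: "fib (poly f \<beta>) \<subseteq> V (Suc n)"
    using assms(1) by (intro fib_subset) (simp add: V_Suc_iff)
  have "poly (pderiv f) \<beta> \<in> I"
    unfolding pderiv_f_root[OF assms(1)]
  proof (subst prod_iff)
    show "finite (fib (poly f \<beta>) - {\<beta>})" using finite_subset[OF sub finite_V] by simp
    show "algebraic_int (\<beta> - \<delta>)" if "\<delta> \<in> fib (poly f \<beta>) - {\<beta>}" for \<delta>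
      using that sub int V_algebraic_int by blast
    show "\<exists>\<delta>\<in>fib (poly f \<beta>) - {\<beta>}. \<beta> - \<delta> \<in> I"
      using assms eq by (intro bexI[of _ \<gamma>]) (auto simp: fib_def)
  qed
  then have "of_nat p * \<beta> ^ (p - 2) * (\<beta> - crit) \<in> I" by (simp only: pderiv_f)
  moreover have crit: "algebraic_int crit" by (auto simp: crit_def algebraic_int_minus)
  moreover have "of_nat p * \<beta> ^ (p - 2) \<notin> I"
    using int V_Suc_notin[OF assms(1)] q_units(1)
    by (subst mult_iff) (auto simp: power_iff of_nat_iff)
  ultimately show "\<beta> - crit \<in> I"
    using primeD[of "of_nat p * \<beta> ^ (p - 2)" "\<beta> - crit"] int by auto
qed

text \<open>Three congruent roots in one fibre would make the critical point a double zero of the derivative.\<close>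

lemma no_three_congruent:
  assumes V: "\<beta> \<in> V (Suc n)" "\<gamma> \<in> V (Suc n)" "\<delta> \<in> V (Suc n)"
    and ne: "\<beta> \<noteq> \<gamma>" "\<beta> \<noteq> \<delta>" "\<gamma> \<noteq> \<delta>" and cong: "\<beta> - \<gamma> \<in> I" "\<beta> - \<delta> \<in> I"
  shows False
proof -
  define F where "F = fib (poly f \<beta>)"
  have \<alpha>: "poly f \<beta> \<in> V n" using V(1) by (simp add: V_Suc_iff)
  have sub: "F \<subseteq> V (Suc n)" unfolding F_def using \<alpha> by (rule fib_subset)
  then have fin: "finite F" using finite_V finite_subset by blast
  have FM: "\<beta> \<in> F" "\<gamma> \<in> F" "\<delta> \<in> F"
    using congruent_imp(1)[of \<beta> \<gamma>] congruent_imp(1)[of \<beta> \<delta>] V ne cong by (auto simp: F_def fib_def)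
  define S where "S = F - {\<beta>}"
  have finS: "finite S" using fin by (simp add: S_def)
  define g where "g = (\<Prod>z\<in>S. [:- z, 1:])"
  have "f - [:poly f \<beta>:] = [:- \<beta>, 1:] * g"
    using f_minus_const(1)[OF \<alpha>] prod.remove[OF fin FM(1), of "\<lambda>z. [:- z, 1:]"]
    by (simp only: F_def[symmetric] S_def g_def)
  then have "pderiv (f - [:poly f \<beta>:]) = pderiv ([:- \<beta>, 1:] * g)" by simp
  then have "pderiv f = pderiv ([:- \<beta>, 1:] * g)" by (simp add: pderiv_diff pderiv_pCons)
  also have "\<dots> = [:- \<beta>, 1:] * pderiv g + g"
    by (simp only: pderiv_mult) (simp add: pderiv_pCons)
  finally have "pderiv (pderiv f) = pderiv ([:- \<beta>, 1:] * pderiv g) + pderiv g"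
    by (simp only: pderiv_add)
  also have "pderiv ([:- \<beta>, 1:] * pderiv g) = [:- \<beta>, 1:] * pderiv (pderiv g) + pderiv g"
    by (simp only: pderiv_mult) (simp add: pderiv_pCons)
  finally have d2: "poly (pderiv (pderiv f)) \<beta> = 2 * poly (pderiv g) \<beta>" by simp
  have alg: "algebraic_int \<beta>" "algebraic_int (\<beta> - z)" if "z \<in> S" for z
    using that sub V V_algebraic_int unfolding S_def by blast+
  have "poly (pderiv g) \<beta> = (\<Sum>a\<in>S. \<Prod>z\<in>S - {a}. \<beta> - z)"
    unfolding g_def pderiv_prod by (simp add: poly_sum poly_prod pderiv_pCons)
  also have "\<dots> \<in> I"
  proof (rule sum)
    fix a assume "a \<in> S"
    \<comment> \<open>Removing one \<open>a\<close> cannot remove both \<gamma> and \<delta>, so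
      each summand keeps a factor in \<open>I\<close>.\<close>
    have "\<exists>z\<in>S - {a}. \<beta> - z \<in> I"
      using FM ne cong by (cases "a = \<gamma>") (auto simp: S_def)
    then show "(\<Prod>z\<in>S - {a}. \<beta> - z) \<in> I"
      using finS alg by (subst prod_iff) auto
  qed
  finally have "poly (pderiv (pderiv f)) \<beta> \<in> I"
    unfolding d2 mult_2 by (intro add)
  moreover have "pderiv f = Polynomial.smult (of_nat p) (monom 1 (p - 2) * [:- crit, 1:])"
    unfolding poly_eq_poly_eq_iff[symmetric] by (rule ext) (simp add: pderiv_f poly_monom algebra_simps)
  then have "poly (pderiv (pderiv f)) \<beta>
      = of_nat p * (\<beta> ^ (p - 2) + of_nat (p - 2) * \<beta> ^ (p - 3) * (\<beta> - crit))"
    by (simp only: pderiv_smult pderiv_mult)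
       (simp add: pderiv_monom pderiv_pCons poly_monom algebra_simps diff_diff_eq numeral_3_eq_3)
  ultimately have "of_nat p * (\<beta> ^ (p - 2) + of_nat (p - 2) * \<beta> ^ (p - 3) * (\<beta> - crit)) \<in> I"
    by simp
  moreover have int: "algebraic_int \<beta>" using V V_algebraic_int by blast
  have crit: "algebraic_int crit" by (auto simp: crit_def algebraic_int_minus)
  have "algebraic_int (\<beta> ^ (p - 2) + of_nat (p - 2) * \<beta> ^ (p - 3) * (\<beta> - crit))"
    using int crit
    by (intro algebraic_int_add algebraic_int_mult algebraic_int_power algebraic_int_diff) auto
  moreover have "of_nat p \<notin> I" using q_units(1) by (simp only: of_nat_iff) simp
  ultimately have "\<beta> ^ (p - 2) + of_nat (p - 2) * \<beta> ^ (p - 3) * (\<beta> - crit) \<in> I"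
    using primeD[OF algebraic_int_of_nat] by blast
  \<comment> \<open>Since \<beta> is congruent to \<open>crit\<close>, only
    \<open>\<beta> ^ (p - 2)\<close> survives modulo \<open>I\<close>, which would put \<beta> into
    \<open>I\<close>.\<close>
  moreover have "of_nat (p - 2) * \<beta> ^ (p - 3) * (\<beta> - crit) \<in> I"
    using congruent_imp(2)[of \<beta> \<gamma>] V ne cong int by (intro smult) auto
  ultimately have "\<beta> ^ (p - 2) \<in> I" using add_cancel by (metis add.commute)
  then show False using power_iff[OF int] V_Suc_notin V by blast
qed

lemma ramified_square_root:
  obtains y e' where "algebraic_int y" "y\<^sup>2 = of_int (int q * e')" "\<not> int q dvd e'"
    "\<And>\<sigma>. \<sigma> \<in> galQ \<Longrightarrow> (\<And>v. v \<in> V (Suc n) \<Longrightarrow> \<sigma> v = v) \<Longrightarrow> \<sigma> y = y"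
proof -
  obtain E where E: "(\<Prod>\<beta>\<in>V n. poly (pderiv (poly_iter f n)) \<beta>) = of_int E" "\<not> int q dvd E"
    using discriminant_unit[of n] prime q_units by blast
  obtain w where w: "(\<Prod>\<beta>\<in>V (Suc n). poly (pderiv f) \<beta>) = of_int (w * crit_orbit p k (Suc n))"
      "\<not> int q dvd w"
    using prod_pderiv_f[of n] prime q_units by blast
  have "finite (V (Suc n))" by (rule finite_V)
  then obtain P s where P: "finite P" "P \<subseteq> V (Suc n) \<times> V (Suc n)"
    "(\<Prod>(x, y)\<in>P. x - y)\<^sup>2 = (- 1) ^ s * (\<Prod>x\<in>V (Suc n). \<Prod>y\<in>V (Suc n) - {x}. x - y)"
    by (rule Vandermonde_square)
  define D where "D = (\<Prod>(x, y)\<in>P. x - y)"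
  define e' where "e' = (- 1) ^ s * (E ^ p * (w * e))"
  \<comment> \<open>\<open>D\<close> is a square root of the discriminant up to sign. Dividing by
    \<open>q ^ r\<close> leaves a single factor \<open>q\<close> in the square; as that square is an
    integer, \<open>y\<close> stays integral.\<close>
  define y where "y = D / of_nat q ^ r"
  have q0: "(of_nat q :: complex) \<noteq> 0" using prime by auto
  have "(\<Prod>x\<in>V (Suc n). \<Prod>y\<in>V (Suc n) - {x}. x - y)
      = (\<Prod>\<beta>\<in>V (Suc n). poly (pderiv (poly_iter f (Suc n))) \<beta>)"
    by (rule prod.cong) (simp_all add: pderiv_iter_root)
  also have "\<dots> = of_int (E ^ p * (w * (int q ^ (2 * r + 1) * e)))"
    unfolding prod_pderiv_iter_Suc E(1) w(1) q_exact(1) by simp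
  finally have "D\<^sup>2 = of_int (int q * e') * (of_nat q ^ r)\<^sup>2"
    using P(3) by (simp add: D_def e'_def power_add power_mult power2_eq_square power_mult_distrib mult_ac)
  then have y2: "y\<^sup>2 = of_int (int q * e')"
    using q0 by (simp add: y_def power_divide)
  have "algebraic_int y"
  proof (rule algebraic_int_root[where p = "monom 1 2"])
    show "algebraic_int (of_int (int q * e') :: complex)" by (rule algebraic_int_of_int)
    show "poly (monom 1 2) y = of_int (int q * e')" by (simp add: poly_monom y2)
  qed (auto simp: degree_monom_eq)
  moreover have "\<not> int q dvd e'"
  proof -
    have qq: "Factorial_Ring.prime (int q)" using prime by simp
    have "\<not> int q dvd (- 1) ^ s"
    proof
      assume "int q dvd (- 1) ^ s"
      then have "int q dvd - 1" by (rule prime_dvd_power[OF qq])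
      then show False using prime by simp
    qed
    moreover have "\<not> int q dvd E ^ p" using E(2) prime_dvd_power[OF qq] by blast
    ultimately show ?thesis
      using w(2) q_exact(2) by (simp only: e'_def prime_dvd_mult_iff[OF qq] simp_thms)
  qed
  moreover have "\<sigma> y = y" if \<sigma>: "\<sigma> \<in> galQ" "\<And>v. v \<in> V (Suc n) \<Longrightarrow> \<sigma> v = v" for \<sigma>
  proof -
    have alg: "algebraic (fst u)" "algebraic (snd u)" "\<sigma> (fst u) = fst u" "\<sigma> (snd u) = snd u"
      if "u \<in> P" for u
      using that P(2) V_algebraic \<sigma>(2) by auto
    have "\<sigma> D = (\<Prod>u\<in>P. \<sigma> (fst u - snd u))"
      unfolding D_def case_prod_unfold using alg by (intro galQ_prod \<sigma>) auto
    also have "\<dots> = D"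
      unfolding D_def case_prod_unfold
      using alg galQ_diff[OF \<sigma>(1)] by (intro prod.cong) auto
    finally have "\<sigma> D = D" .
    moreover have Dy: "D = y * of_nat q ^ r" using q0 by (simp add: y_def)
    moreover have "\<sigma> (y * of_nat q ^ r) = \<sigma> y * of_nat q ^ r"
      using \<open>algebraic_int y\<close> \<sigma>(1) galQ_mult[OF \<sigma>(1), of y "of_nat q ^ r"]
      by (simp add: galQ_power galQ_of_nat algebraic_power algebraic_int_imp_algebraic)
    ultimately show ?thesis using q0 by simp
  qed
  ultimately show ?thesis using that y2 by blast
qed

text \<open>A moved root and its image are congruent to each other and to \<open>crit\<close>. A
  further moved root would also be congruent to \<open>crit\<close>, and an image of
  \<open>w\<close> other than \<open>v0\<close> would again yield three congruent roots. So exactly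
  two roots move, and they are exchanged.\<close>

lemma inertia_transposition:
  "\<exists>\<sigma>\<in>galQ. \<exists>\<beta>\<in>V (Suc n). \<exists>\<gamma>\<in>V (Suc n). \<beta> \<noteq> \<gamma> \<and> poly f \<beta> = poly f \<gamma> \<and>
     (\<forall>v\<in>V (Suc n). \<sigma> v = Transposition.transpose \<beta> \<gamma> v)"
proof -
  obtain y e' where y: "algebraic_int y" "y\<^sup>2 = of_int (int q * e')" "\<not> int q dvd e'"
    "\<And>\<sigma>. \<sigma> \<in> galQ \<Longrightarrow> (\<And>v. v \<in> V (Suc n) \<Longrightarrow> \<sigma> v = v) \<Longrightarrow> \<sigma> y = y"
    using ramified_square_root by blast
  have "\<sigma> y = y \<or> \<sigma> y = - y" if \<sigma>: "\<sigma> \<in> galQ" for \<sigma>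
  proof -
    have "\<sigma> (y\<^sup>2) = (\<sigma> y)\<^sup>2" using galQ_power[OF \<sigma>] y(1) by blast
    then have "(\<sigma> y)\<^sup>2 = y\<^sup>2" using y(2) galQ_of_int[OF \<sigma>] by metis
    then show ?thesis by (simp add: power2_eq_iff)
  qed
  then have "\<exists>\<sigma>\<in>galQ. (\<exists>v\<in>V (Suc n). \<sigma> v \<noteq> v) \<and> (\<forall>v\<in>V (Suc n). \<sigma> v - v \<in> I)"
    by (intro inertia_nontrivial[OF finite_V _ _ y(1-3)]) (auto intro: V_algebraic_int galQ_V y(4))
  then obtain \<sigma> v0 where \<sigma>: "\<sigma> \<in> galQ" and v0: "v0 \<in> V (Suc n)" "\<sigma> v0 \<noteq> v0"
      and cong: "\<And>v. v \<in> V (Suc n) \<Longrightarrow> \<sigma> v - v \<in> I"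
    by blast
  define w where "w = \<sigma> v0"
  have st: "\<sigma> v \<in> V (Suc n)" if "v \<in> V (Suc n)" for v using galQ_V \<sigma> that by blast
  have w: "w \<in> V (Suc n)" using st v0 by (simp add: w_def)
  have ne: "w \<noteq> v0" using v0 by (simp add: w_def)
  have wv: "w - v0 \<in> I" using cong v0 by (simp add: w_def)
  have inj: "\<sigma> u = \<sigma> v \<longleftrightarrow> u = v" if "u \<in> V (Suc n)" "v \<in> V (Suc n)" for u v
    using galQ_inj[OF \<sigma>] V_algebraic that by blast
  have "\<sigma> v = v" if v: "v \<in> V (Suc n)" "v \<noteq> v0" "v \<noteq> w" for v
  proof (rule ccontr)
    assume "\<sigma> v \<noteq> v"
    then have "v - crit \<in> I"
      using congruent_imp(2)[of v "\<sigma> v"] v(1) st cong[OF v(1)] minus_iff[of "\<sigma> v - v"] by simp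
    moreover have "w - crit \<in> I" using congruent_imp(2)[OF w v0(1) ne wv] .
    ultimately have "w - v \<in> I" using diff[of "w - crit" "v - crit"] by simp
    then show False using no_three_congruent[OF w v0(1) v(1)] ne v wv by auto
  qed
  moreover have "\<sigma> w = v0"
  proof (rule ccontr)
    assume c: "\<sigma> w \<noteq> v0"
    have c2: "\<sigma> w \<noteq> w" using inj[OF w v0(1)] ne by (auto simp: w_def)
    have "w - \<sigma> w \<in> I" using cong[OF w] minus_iff[of "\<sigma> w - w"] by simp
    then show False using no_three_congruent[OF w v0(1) st[OF w]] ne c c2 wv by auto
  qed
  ultimately have "\<forall>v\<in>V (Suc n). \<sigma> v = Transposition.transpose v0 w v"
    by (auto simp: Transposition.transpose_def w_def)
  moreover have "poly f v0 = poly f w" using congruent_imp(1)[OF w v0(1) ne wv] by simp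
  ultimately show ?thesis using \<sigma> v0 w ne by metis
qed

end

lemma (in phi_tree) exists_transposition:
  "\<exists>\<sigma>\<in>galQ. \<exists>\<beta>\<in>V (Suc n). \<exists>\<gamma>\<in>V (Suc n). \<beta> \<noteq> \<gamma> \<and> poly f \<beta> = poly f \<gamma> \<and>
     (\<forall>v\<in>V (Suc n). \<sigma> v = Transposition.transpose \<beta> \<gamma> v)"
proof -
  obtain q r e where q: "prime q" "crit_orbit p k (Suc n) = int q ^ (2 * r + 1) * e" "\<not> int q dvd e"
    using crit_orbit_odd_prime[OF p k not_3_1] .
  obtain I where "prime_over q I" using prime_over_exists[OF q(1)] .
  then interpret phi_ramified p k q I n r e
    using q by (intro phi_ramified.intro phi_ramified_axioms.intro phi_tree_axioms)
  show ?thesis by (rule inertia_transposition)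
qed

subsection \<open>Automorphisms of the finite levels\<close>

context phi_tree
begin

text \<open>The Eisenstein property at \<open>p\<close>: inductively
  \<open>\<beta> ^ (p - 1) * (\<beta> + kp)\<close> lies in a prime above \<open>p\<close>, hence so
  does \<beta>; and the product of the roots is \<open>kp\<close> up to sign, which \<open>p\<close>
  divides only once.\<close>

lemma V_transitive:
  assumes "u \<in> V (Suc n)" "v \<in> V (Suc n)"
  shows "\<exists>\<sigma>\<in>galQ. \<sigma> u = v"
proof -
  obtain I where "prime_over p I" using prime_over_exists[OF p(1)] .
  then interpret prime_over p I .
  have kp: "of_nat (k * p) \<in> I" by (simp only: of_nat_iff) simp
  have VI: "V m \<subseteq> I" for m
  proof (induction m)
    case 0
    then show ?case by (simp add: V_0 zero)
  next
    case (Suc m)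
    show ?case
    proof
      fix \<beta> assume \<beta>: "\<beta> \<in> V (Suc m)"
      have int: "algebraic_int \<beta>" using V_algebraic_int \<beta> by blast
      have "poly f \<beta> \<in> I" using Suc \<beta> by (auto simp: V_Suc_iff)
      then have "poly f \<beta> + of_nat (k * p) \<in> I" using kp by (rule add)
      then have "\<beta> ^ (p - 1) * (\<beta> + of_nat (k * p)) \<in> I" by (simp only: poly_f diff_add_cancel)
      moreover have "algebraic_int (\<beta> ^ (p - 1))" "algebraic_int (\<beta> + of_nat (k * p))"
        using int by (auto simp del: of_nat_mult)
      ultimately have "\<beta> ^ (p - 1) \<in> I \<or> \<beta> + of_nat (k * p) \<in> I" using primeD by blast
      then show "\<beta> \<in> I"
        using power_iff[OF int] add_cancel[OF kp, of \<beta>] by (auto simp: add.commute simp del: of_nat_mult)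
    qed
  qed
  define m where "m = (- 1) ^ card (V (Suc n)) * - int (k * p)"
  have prod_m: "(\<Prod>v\<in>V (Suc n). v) = of_int m"
    using prod_V[of 0 "Suc n"] iter_0[of n] by (simp add: m_def del: funpow.simps)
  have m: "\<not> (int p)\<^sup>2 dvd m"
  proof
    assume "(int p)\<^sup>2 dvd m"
    then have "(int p)\<^sup>2 dvd int (k * p)"
      by (cases "even (card (V (Suc n)))") (simp_all add: m_def)
    then have "int p dvd int k" using p by (simp add: power2_eq_square)
    then show False using k by (simp add: int_dvd_int_iff)
  qed
  show ?thesis
    by (rule galQ_transitive[OF finite_V VI _ prod_m m assms]) (rule galQ_V)
qed

text \<open>Turns out to be an equivalence relation invariant under \<open>galQ\<close>; on each
  class the Galois group realises all transpositions, with the rest of the level fixed.\<close>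

definition swappable :: "nat \<Rightarrow> complex \<Rightarrow> complex \<Rightarrow> bool" where
  "swappable n \<beta> \<gamma> \<longleftrightarrow> \<beta> \<in> V n \<and> \<gamma> \<in> V n \<and>
     (\<exists>\<sigma>\<in>galQ. \<forall>v\<in>V n. \<sigma> v = Transposition.transpose \<beta> \<gamma> v)"

lemma swappable_refl: "\<beta> \<in> V n \<Longrightarrow> swappable n \<beta> \<beta>"
  unfolding swappable_def using galQ_id by (auto intro: bexI[of _ id])

lemma swappable_sym: "swappable n \<beta> \<gamma> \<Longrightarrow> swappable n \<gamma> \<beta>"
  unfolding swappable_def by (auto simp: transpose_commute)

lemma swappable_galQ:
  assumes "swappable n \<beta> \<gamma>" "\<rho> \<in> galQ"
  shows "swappable n (\<rho> \<beta>) (\<rho> \<gamma>)"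
proof -
  obtain \<sigma> where \<sigma>: "\<sigma> \<in> galQ" "\<forall>v\<in>V n. \<sigma> v = Transposition.transpose \<beta> \<gamma> v"
    and V: "\<beta> \<in> V n" "\<gamma> \<in> V n"
    using assms(1) by (auto simp: swappable_def)
  obtain \<rho>' where \<rho>': "\<rho>' \<in> galQ" "\<And>x. algebraic x \<Longrightarrow> \<rho>' (\<rho> x) = x" "\<And>x. algebraic x \<Longrightarrow> \<rho> (\<rho>' x) = x"
    using galQ_inv[OF assms(2)] by blast
  have "(\<rho> \<circ> (\<sigma> \<circ> \<rho>')) v = Transposition.transpose (\<rho> \<beta>) (\<rho> \<gamma>) v" if v: "v \<in> V n" for v
  proof -
    have "\<rho>' v \<in> V n" using galQ_V \<rho>'(1) v by blast
    then have "(\<rho> \<circ> (\<sigma> \<circ> \<rho>')) v = \<rho> (Transposition.transpose \<beta> \<gamma> (\<rho>' v))" using \<sigma> by simp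
    moreover have "\<rho>' v = \<beta> \<longleftrightarrow> v = \<rho> \<beta>" "\<rho>' v = \<gamma> \<longleftrightarrow> v = \<rho> \<gamma>"
      using \<rho>' V v V_algebraic by metis+
    ultimately show ?thesis using \<rho>'(3)[OF V_algebraic[OF v]] by (auto simp: Transposition.transpose_def)
  qed
  moreover have "\<rho> \<circ> (\<sigma> \<circ> \<rho>') \<in> galQ"
    using galQ_comp assms(2) \<sigma>(1) \<rho>'(1) by blast
  moreover have "\<rho> \<beta> \<in> V n" "\<rho> \<gamma> \<in> V n" using galQ_V[OF assms(2)] V by auto
  ultimately show ?thesis unfolding swappable_def by blast
qed

text \<open>Conjugating the transposition of \<open>a\<close> and \<open>b\<close> by that of
  \<open>b\<close> and \<open>c\<close> gives the one of \<open>a\<close> and \<open>c\<close>,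
  provided the three are distinct.\<close>

lemma swappable_trans:
  assumes "swappable n a b" "swappable n b c"
  shows "swappable n a c"
proof (cases "a = c \<or> a = b \<or> b = c")
  case True
  then show ?thesis using assms swappable_refl swappable_def by metis
next
  case False
  obtain \<sigma> where \<sigma>: "\<sigma> \<in> galQ" "\<forall>v\<in>V n. \<sigma> v = Transposition.transpose b c v"
    and V: "a \<in> V n" "b \<in> V n" "c \<in> V n"
    using assms by (auto simp: swappable_def)
  have "\<sigma> a = a" "\<sigma> b = c" using \<sigma> V False by (auto simp: Transposition.transpose_def)
  then show ?thesis using swappable_galQ[OF assms(1) \<sigma>(1)] by simp
qed

text \<open>The fibre of \<beta> has a second point \<delta>. If \<gamma> lay in another fibre, the
  transposition would fix \<delta> and hence the common parent of \<beta> and \<delta>, yet carry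
  that parent to the parent of \<gamma>.\<close>

lemma swappable_same_fibre:
  assumes "swappable (Suc n) \<beta> \<gamma>"
  shows "poly f \<beta> = poly f \<gamma>"
proof (rule ccontr)
  assume ne: "poly f \<beta> \<noteq> poly f \<gamma>"
  obtain \<sigma> where \<sigma>: "\<sigma> \<in> galQ" "\<forall>v\<in>V (Suc n). \<sigma> v = Transposition.transpose \<beta> \<gamma> v"
    and V: "\<beta> \<in> V (Suc n)" "\<gamma> \<in> V (Suc n)"
    using assms by (auto simp: swappable_def)
  have \<alpha>: "poly f \<beta> \<in> V n" using V by (simp add: V_Suc_iff)
  have "\<not> fib (poly f \<beta>) \<subseteq> {\<beta>}"
  proof
    assume "fib (poly f \<beta>) \<subseteq> {\<beta>}"
    then have "card (fib (poly f \<beta>)) \<le> 1" using card_mono[of "{\<beta>}"] by simp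
    then show False using f_minus_const(2)[OF \<alpha>] p by simp
  qed
  then obtain \<delta> where \<delta>: "poly f \<delta> = poly f \<beta>" "\<delta> \<noteq> \<beta>" by (auto simp: fib_def)
  then have \<delta>V: "\<delta> \<in> V (Suc n)" "\<delta> \<noteq> \<gamma>" using \<alpha> ne by (auto simp: V_Suc_iff)
  have "\<sigma> (poly f \<beta>) = poly f \<gamma>"
    using galQ_f[OF \<sigma>(1) V_algebraic[OF V(1)]] \<sigma>(2) V by simp
  moreover have "\<sigma> (poly f \<beta>) = poly f \<beta>"
    using galQ_f[OF \<sigma>(1) V_algebraic[OF \<delta>V(1)]] \<sigma>(2) \<delta> \<delta>V by (simp add: Transposition.transpose_def)
  ultimately show False using ne by simp
qed

text \<open>The swappability classes are permuted transitively, hence have equal size. They partition a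
  fibre of prime size \<open>p\<close> and are not singletons.\<close>

lemma fibre_swappable:
  assumes "\<beta> \<in> V (Suc n)" "poly f \<gamma> = poly f \<beta>"
  shows "swappable (Suc n) \<beta> \<gamma>"
proof -
  define C where "C x = {y. swappable (Suc n) x y}" for x
  have CV: "C x \<subseteq> V (Suc n)" for x by (auto simp: C_def swappable_def)
  have finC: "finite (C x)" for x using finite_subset[OF CV finite_V] .
  have card_le: "card (C x) \<le> card (C y)" if xy: "x \<in> V (Suc n)" "y \<in> V (Suc n)" for x y
  proof -
    obtain \<rho> where \<rho>: "\<rho> \<in> galQ" "\<rho> x = y" using V_transitive[OF xy] by blast
    have "inj_on \<rho> (C x)"
      using galQ_inj[OF \<rho>(1)] CV V_algebraic by (meson inj_onI subsetD)
    moreover have "\<rho> ` C x \<subseteq> C y"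
      using swappable_galQ[OF _ \<rho>(1)] \<rho>(2) by (auto simp: C_def)
    ultimately show ?thesis using finC card_inj_on_le by blast
  qed
  define s where "s = card (C \<beta>)"
  have card_C: "card (C x) = s" if "x \<in> V (Suc n)" for x
    unfolding s_def using card_le that assms(1) by (simp add: order_antisym)
  define F where "F = fib (poly f \<beta>)"
  have \<alpha>: "poly f \<beta> \<in> V n" using assms(1) by (simp add: V_Suc_iff)
  have FV: "F \<subseteq> V (Suc n)" unfolding F_def using \<alpha> by (rule fib_subset)
  then have finF: "finite F" using finite_V finite_subset by blast
  have CF: "C x \<subseteq> F" if "x \<in> F" for x
    using that swappable_same_fibre by (auto simp: C_def F_def fib_def)
  have xC: "x \<in> C x" if "x \<in> F" for x
    using that FV swappable_refl by (auto simp: C_def)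
  have un: "\<Union> (C ` F) = F" using CF xC by blast
  have "s * card (C ` F) = card (\<Union> (C ` F))"
  proof (rule card_partition)
    show "finite (C ` F)" using finF by simp
    show "finite (\<Union> (C ` F))" using finF un by simp
    show "card c = s" if "c \<in> C ` F" for c using that card_C FV by blast
    show "c1 \<inter> c2 = {}" if c: "c1 \<in> C ` F" "c2 \<in> C ` F" "c1 \<noteq> c2" for c1 c2
    proof (rule ccontr)
      obtain x y where xy: "c1 = C x" "c2 = C y" using c by blast
      assume "c1 \<inter> c2 \<noteq> {}"
      then obtain z where "swappable (Suc n) x z" "swappable (Suc n) y z"
        using xy by (auto simp: C_def)
      then have "swappable (Suc n) x y" using swappable_trans swappable_sym by blast
      then have "C x = C y" using swappable_trans swappable_sym unfolding C_def by blast
      then show False using c xy by simp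
    qed
  qed
  then have "s dvd p" using f_minus_const(2)[OF \<alpha>] un by (metis F_def dvd_triv_left)
  moreover have "s \<noteq> 1"
  proof
    assume s: "s = 1"
    obtain \<sigma> b c where *: "\<sigma> \<in> galQ" "b \<in> V (Suc n)" "c \<in> V (Suc n)" "b \<noteq> c"
        "\<forall>v\<in>V (Suc n). \<sigma> v = Transposition.transpose b c v"
      using exists_transposition by blast
    then have "{b, c} \<subseteq> C b" using swappable_refl by (auto simp: C_def swappable_def)
    then have "card {b, c} \<le> card (C b)" using finC by (intro card_mono)
    then show False using card_C[OF *(2)] s *(4) by simp
  qed
  ultimately have "s = p" using p(1) prime_nat_iff by blast
  moreover have "\<beta> \<in> F" by (simp add: F_def fib_def)
  ultimately have "C \<beta> = F"
    using CF finF f_minus_const(2)[OF \<alpha>] by (intro card_subset_eq) (auto simp: F_def s_def)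
  then show ?thesis using assms(2) by (auto simp: C_def F_def fib_def)
qed

text \<open>Following \<pi> by the transposition of \<beta> and \<open>\<pi> \<beta>\<close> makes
  \<beta> a fixed point and moves no new one, so the number of moved points drops.\<close>

lemma fibre_permutation_realised:
  assumes "bij_betw \<pi> (V (Suc n)) (V (Suc n))" "\<And>v. v \<in> V (Suc n) \<Longrightarrow> poly f (\<pi> v) = poly f v"
  shows "\<exists>\<sigma>\<in>galQ. \<forall>v\<in>V (Suc n). \<sigma> v = \<pi> v"
  using assms
proof (induction "card {v \<in> V (Suc n). \<pi> v \<noteq> v}" arbitrary: \<pi> rule: less_induct)
  case (less \<pi>)
  show ?case
  proof (cases "\<forall>v\<in>V (Suc n). \<pi> v = v")
    case True
    then show ?thesis using galQ_id by (intro bexI[of _ id]) auto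
  next
    case False
    then obtain \<beta> where \<beta>: "\<beta> \<in> V (Suc n)" "\<pi> \<beta> \<noteq> \<beta>" by blast
    define \<gamma> where "\<gamma> = \<pi> \<beta>"
    have \<gamma>: "\<gamma> \<in> V (Suc n)" using less.prems(1) \<beta> by (auto simp: \<gamma>_def bij_betw_def)
    have eq: "poly f \<gamma> = poly f \<beta>" using less.prems(2) \<beta> by (simp add: \<gamma>_def)
    define \<pi>' where "\<pi>' = Transposition.transpose \<beta> \<gamma> \<circ> \<pi>"
    have "\<pi>' \<beta> = \<beta>" by (simp add: \<pi>'_def \<gamma>_def)
    have inj: "\<pi> v \<noteq> \<gamma>" if "v \<in> V (Suc n)" "v \<noteq> \<beta>" for v
      using less.prems(1) \<beta> that by (auto simp: \<gamma>_def bij_betw_def inj_on_def)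
    have bij_t: "bij_betw (Transposition.transpose \<beta> \<gamma>) (V (Suc n)) (V (Suc n))"
      by (rule bij_betw_byWitness[where f' = "Transposition.transpose \<beta> \<gamma>"])
         (use \<beta> \<gamma> in \<open>auto simp: Transposition.transpose_def\<close>)
    have "{v \<in> V (Suc n). \<pi>' v \<noteq> v} \<subset> {v \<in> V (Suc n). \<pi> v \<noteq> v}"
    proof
      show "{v \<in> V (Suc n). \<pi>' v \<noteq> v} \<subseteq> {v \<in> V (Suc n). \<pi> v \<noteq> v}"
        using inj \<open>\<pi>' \<beta> = \<beta>\<close> by (auto simp: \<pi>'_def Transposition.transpose_def split: if_splits)
      show "{v \<in> V (Suc n). \<pi>' v \<noteq> v} \<noteq> {v \<in> V (Suc n). \<pi> v \<noteq> v}"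
        using \<beta> \<open>\<pi>' \<beta> = \<beta>\<close> by blast
    qed
    then have "card {v \<in> V (Suc n). \<pi>' v \<noteq> v} < card {v \<in> V (Suc n). \<pi> v \<noteq> v}"
      using finite_V by (intro psubset_card_mono) auto
    moreover have "bij_betw \<pi>' (V (Suc n)) (V (Suc n))"
      unfolding \<pi>'_def by (rule bij_betw_trans[OF less.prems(1) bij_t])
    moreover have "poly f (\<pi>' v) = poly f v" if "v \<in> V (Suc n)" for v
      using less.prems(2)[OF that] eq by (auto simp: \<pi>'_def Transposition.transpose_def)
    ultimately obtain \<sigma> where \<sigma>: "\<sigma> \<in> galQ" "\<forall>v\<in>V (Suc n). \<sigma> v = \<pi>' v"
      using less.hyps by blast
    obtain \<tau> where \<tau>: "\<tau> \<in> galQ" "\<forall>v\<in>V (Suc n). \<tau> v = Transposition.transpose \<beta> \<gamma> v"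
      using fibre_swappable[OF \<beta>(1) eq] by (auto simp: swappable_def)
    have "(\<tau> \<circ> \<sigma>) v = \<pi> v" if v: "v \<in> V (Suc n)" for v
    proof -
      have "\<pi>' v \<in> V (Suc n)" using \<sigma> galQ_V v by metis
      then show ?thesis using \<sigma> \<tau> v by (simp add: \<pi>'_def)
    qed
    then show ?thesis using galQ_comp[OF \<tau>(1) \<sigma>(1)] by blast
  qed
qed

text \<open>If \<sigma> realises \<open>h\<close> on one level, its inverse composed with
  \<open>h\<close> preserves every fibre of the next level and so is realised there; composing with
  \<sigma> recovers \<open>h\<close>.\<close>

lemma level_automorphism_realised:
  assumes bij: "\<And>m. bij_betw h (V m) (V m)"
    and hf: "\<And>m z. z \<in> V (Suc m) \<Longrightarrow> poly f (h z) = h (poly f z)"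
  shows "\<exists>\<sigma>\<in>galQ. \<forall>z\<in>V n. \<sigma> z = h z"
proof (induction n)
  case 0
  have "h 0 = 0" using bij[of 0] by (simp add: V_0 bij_betw_def)
  then show ?case using galQ_id by (intro bexI[of _ id]) (auto simp: V_0)
next
  case (Suc n)
  then obtain \<sigma> where \<sigma>: "\<sigma> \<in> galQ" "\<forall>z\<in>V n. \<sigma> z = h z" by blast
  obtain \<tau> where \<tau>: "\<tau> \<in> galQ" "\<And>x. algebraic x \<Longrightarrow> \<tau> (\<sigma> x) = x" "\<And>x. algebraic x \<Longrightarrow> \<sigma> (\<tau> x) = x"
    using galQ_inv[OF \<sigma>(1)] by blast
  have hV: "h v \<in> V (Suc n)" if "v \<in> V (Suc n)" for v
    using bij[of "Suc n"] that by (auto simp: bij_betw_def)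
  have "bij_betw (\<tau> \<circ> h) (V (Suc n)) (V (Suc n))"
    using bij galQ_V_surj[OF \<tau>(1)] by (rule bij_betw_trans)
  moreover have "poly f ((\<tau> \<circ> h) v) = poly f v" if v: "v \<in> V (Suc n)" for v
  proof -
    have fv: "poly f v \<in> V n" using v by (simp add: V_Suc_iff)
    have "poly f ((\<tau> \<circ> h) v) = \<tau> (poly f (h v))"
      using galQ_f[OF \<tau>(1) V_algebraic[OF hV[OF v]]] by simp
    also have "\<dots> = \<tau> (\<sigma> (poly f v))" using hf[OF v] \<sigma>(2) fv by simp
    also have "\<dots> = poly f v" using \<tau>(2) V_algebraic[OF fv] by blast
    finally show ?thesis .
  qed
  ultimately obtain \<rho> where \<rho>: "\<rho> \<in> galQ" "\<forall>v\<in>V (Suc n). \<rho> v = (\<tau> \<circ> h) v"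
    using fibre_permutation_realised by blast
  have "(\<sigma> \<circ> \<rho>) v = h v" if "v \<in> V (Suc n)" for v
    using \<rho>(2) \<tau>(3) V_algebraic[OF hV[OF that]] that by simp
  then show ?case using galQ_comp[OF \<sigma>(1) \<rho>(1)] by blast
qed

lemma automorphism_realised:
  assumes bij: "\<And>m. bij_betw h (V m) (V m)"
    and hf: "\<And>m z. z \<in> V (Suc m) \<Longrightarrow> poly f (h z) = h (poly f z)"
  shows "\<exists>\<sigma>\<in>galQ. \<forall>n. \<forall>z\<in>V n. \<sigma> z = h z"
proof -
  have "\<exists>\<sigma>\<in>galQ. \<forall>z\<in>V n. \<sigma> z = h z" for n
    by (rule level_automorphism_realised[OF bij]) (erule hf)
  then have "\<forall>n. \<exists>\<sigma>. \<sigma> \<in> galQ \<and> (\<forall>z\<in>V n. \<sigma> z = h z)"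
    by blast
  from choice[OF this] obtain s where s: "\<forall>n. s n \<in> galQ \<and> (\<forall>z\<in>V n. s n z = h z)" ..
  then have sG: "s n \<in> galQ" for n by blast
  \<comment> \<open>Agreement with \<open>h\<close> descends from a level to those below it, since
    every vertex has a child and both maps commute with \<open>f\<close>. Thus the values of
    \<open>s\<close> at each vertex are eventually constant.\<close>
  have down: "s (m + j) z = h z" if "z \<in> V m" for m j z
    using that
  proof (induction j arbitrary: m z)
    case 0
    then show ?case using s by simp
  next
    case (Suc j)
    have "fib z \<noteq> {}" using f_minus_const(2)[OF Suc.prems] p by auto
    then obtain \<beta> where \<beta>: "poly f \<beta> = z" by (auto simp: fib_def)
    then have \<beta>V: "\<beta> \<in> V (Suc m)" using Suc.prems by (simp add: V_Suc_iff)
    have "s (m + Suc j) z = poly f (s (Suc m + j) \<beta>)"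
      using galQ_f[OF sG V_algebraic[OF \<beta>V]] \<beta> by simp
    also have "\<dots> = h z" using Suc.IH[OF \<beta>V] hf[OF \<beta>V] \<beta> by simp
    finally show ?case .
  qed
  obtain \<sigma> where \<sigma>: "\<sigma> \<in> galQ"
    "\<And>x y N. algebraic x \<Longrightarrow> (\<And>n. n \<ge> N \<Longrightarrow> s n x = y) \<Longrightarrow> \<sigma> x = y"
    using galQ_limit[of s] sG by blast
  have "\<sigma> z = h z" if "z \<in> V n" for n z
    using \<sigma>(2)[of z n "h z"] V_algebraic[OF that] down[OF that] by (metis le_Suc_ex)
  then show ?thesis using \<sigma>(1) by blast
qed

subsection \<open>Automorphisms of the tree\<close>

text \<open>A point on two levels would make some positive iterate of 0 vanish, but these all equal
  \<open>-kp\<close>. Disjointness lets a tree automorphism be read as one function on complex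
  numbers.\<close>

lemma V_disjoint: "z \<in> V m \<Longrightarrow> z \<in> V n \<Longrightarrow> m = n"
proof (induction m n rule: linorder_wlog)
  case (le m n)
  show ?case
  proof (rule ccontr)
    assume "m \<noteq> n"
    then obtain j where "n = Suc j + m" using le(1) by (metis add.commute le_Suc_ex less_imp_Suc_add nat_less_le add_Suc_right add_Suc)
    then have "(poly f ^^ n) z = (poly f ^^ Suc j) 0"
      using le(2) by (simp only: funpow_add o_apply V_iff)
    then show False using le(3) iter_0[of j] k p by (simp add: V_iff del: funpow.simps)
  qed
qed simp

lemma tree_vertices_iff: "u \<in> tree_vertices f \<longleftrightarrow> snd u \<in> V (fst u)"
  by (cases u) (simp add: tree_vertices_def V_def)

definition nbrs :: "nat \<times> complex \<Rightarrow> (nat \<times> complex) set" where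
  "nbrs u = {v. tree_edge f u v}"

lemma tree_edge_iff:
  assumes "snd u \<in> V (fst u)"
  shows "tree_edge f u v \<longleftrightarrow> (fst v = Suc (fst u) \<and> snd v \<in> fib (snd u)) \<or>
     (fst u = Suc (fst v) \<and> snd v = poly f (snd u))"
  using assms by (auto simp: tree_edge_def tree_vertices_iff fib_def V_Suc_iff)

lemma card_nbrs_root: "card (nbrs (0, 0)) = p"
proof -
  have "nbrs (0, 0) = Pair 1 ` fib 0"
    using tree_edge_iff[of "(0, 0)"] by (auto simp: nbrs_def V_0)
  then show ?thesis using f_minus_const(2)[of 0 0] by (simp add: card_image inj_on_def V_0)
qed

lemma card_nbrs_Suc:
  assumes "z \<in> V (Suc n)"
  shows "card (nbrs (Suc n, z)) = Suc p"
proof -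
  have "nbrs (Suc n, z) = insert (n, poly f z) (Pair (Suc (Suc n)) ` fib z)"
    using tree_edge_iff[of "(Suc n, z)"] assms by (auto simp: nbrs_def)
  moreover have "finite (fib z)" using f_minus_const(2)[OF assms] p by (intro card_ge_0_finite) simp
  moreover have "(n, poly f z) \<notin> Pair (Suc (Suc n)) ` fib z" by auto
  ultimately show ?thesis using f_minus_const(2)[OF assms] by (simp add: card_image inj_on_def)
qed

section \<open>Automorphisms respect the root, the levels and parents\<close>

context
  fixes g assumes g: "g \<in> tree_aut f"
begin

lemma aut_vertex: "snd u \<in> V (fst u) \<Longrightarrow> snd (g u) \<in> V (fst (g u))"
  using g by (auto simp: tree_aut_def bij_betw_def tree_vertices_iff[symmetric])

lemma aut_inj: "snd u \<in> V (fst u) \<Longrightarrow> snd v \<in> V (fst v) \<Longrightarrow> g u = g v \<longleftrightarrow> u = v"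
  using g by (auto simp: tree_aut_def bij_betw_def tree_vertices_iff[symmetric] inj_on_def)

lemma aut_edge: "tree_edge f u v \<Longrightarrow> tree_edge f (g u) (g v)"
  using g by (auto simp: tree_aut_def tree_edge_def)

lemma card_nbrs_aut:
  assumes u: "snd u \<in> V (fst u)"
  shows "card (nbrs (g u)) = card (nbrs u)"
proof -
  have verts: "v \<in> tree_vertices f" if "v \<in> nbrs w" for v w
    using that by (auto simp: nbrs_def tree_edge_def)
  have bij: "bij_betw g (tree_vertices f) (tree_vertices f)" using g by (simp add: tree_aut_def)
  have iff: "tree_edge f (g u) (g v) \<longleftrightarrow> tree_edge f u v" if "v \<in> tree_vertices f" for v
    using g u that by (simp add: tree_aut_def tree_vertices_iff)
  have "g ` nbrs u = nbrs (g u)"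
  proof (intro equalityI subsetI)
    fix w assume w: "w \<in> nbrs (g u)"
    then obtain v where "v \<in> tree_vertices f" "w = g v"
      using verts bij by (metis bij_betw_imp_surj_on imageE)
    then show "w \<in> g ` nbrs u" using iff w by (auto simp: nbrs_def)
  qed (auto simp: nbrs_def intro: aut_edge)
  moreover have "inj_on g (nbrs u)"
    using bij verts by (meson bij_betw_imp_inj_on inj_on_subset subsetI)
  ultimately show ?thesis by (metis card_image)
qed

text \<open>The root alone has \<open>p\<close> neighbours; every other vertex has
  \<open>p + 1\<close>.\<close>

lemma aut_root: "g (0, 0) = (0, 0)"
proof -
  have "snd (g (0, 0)) \<in> V (fst (g (0, 0)))" using aut_vertex[of "(0, 0)"] by (simp add: V_0)
  moreover have "card (nbrs (g (0, 0))) = p"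
    using card_nbrs_aut[of "(0, 0)"] card_nbrs_root by (simp add: V_0)
  ultimately show ?thesis
    using card_nbrs_Suc by (cases "g (0, 0)"; cases "fst (g (0, 0))") (auto simp: V_0)
qed

text \<open>The image of a child is adjacent to the image of its parent. If it lay one level lower,
  it would be the parent of that vertex, which is already the image of the grandparent, against
  injectivity.\<close>

lemma aut_level:
  assumes "z \<in> V n"
  shows "fst (g (n, z)) = n"
  using assms
proof (induction n arbitrary: z rule: less_induct)
  case (less n)
  show ?case
  proof (cases n)
    case 0
    then show ?thesis using less.prems aut_root by (simp add: V_0)
  next
    case (Suc m)
    have fz: "poly f z \<in> V m" using less.prems Suc by (simp add: V_Suc_iff)
    have lev: "fst (g (m, poly f z)) = m" using less.IH fz Suc by simp
    have gV: "snd (g (m, poly f z)) \<in> V (fst (g (m, poly f z)))" using aut_vertex fz by simp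
    have "tree_edge f (m, poly f z) (n, z)"
      using tree_edge_iff fz Suc by (simp add: fib_def)
    then have "tree_edge f (g (m, poly f z)) (g (n, z))" by (rule aut_edge)
    then consider "fst (g (n, z)) = Suc m"
      | "m = Suc (fst (g (n, z)))" "snd (g (n, z)) = poly f (snd (g (m, poly f z)))"
      using tree_edge_iff[OF gV] lev by auto
    then show ?thesis
    proof cases
      case 1
      then show ?thesis using Suc by simp
    next
      case 2
      define l where "l = fst (g (n, z))"
      have l: "m = Suc l" using 2 by (simp add: l_def)
      have ffz: "poly f (poly f z) \<in> V l" using fz l by (simp add: V_Suc_iff)
      have lev2: "fst (g (l, poly f (poly f z))) = l" using less.IH ffz Suc l by simp
      have "tree_edge f (m, poly f z) (l, poly f (poly f z))"
        using tree_edge_iff fz l by simp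
      then have "tree_edge f (g (m, poly f z)) (g (l, poly f (poly f z)))" by (rule aut_edge)
      then have "snd (g (l, poly f (poly f z))) = poly f (snd (g (m, poly f z)))"
        using tree_edge_iff[OF gV] lev lev2 l by auto
      then have "g (l, poly f (poly f z)) = g (n, z)"
        using lev2 2 by (simp add: prod_eq_iff l_def)
      then have "(l, poly f (poly f z)) = (n, z)"
        using aut_inj ffz less.prems by simp
      then show ?thesis using l Suc by simp
    qed
  qed
qed

lemma aut_parent:
  assumes "z \<in> V (Suc n)"
  shows "poly f (snd (g (Suc n, z))) = snd (g (n, poly f z))"
proof -
  have fz: "poly f z \<in> V n" using assms by (simp add: V_Suc_iff)
  have gV: "snd (g (n, poly f z)) \<in> V (fst (g (n, poly f z)))" using aut_vertex fz by simp
  have "tree_edge f (n, poly f z) (Suc n, z)"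
    using tree_edge_iff fz by (simp add: fib_def)
  then have "tree_edge f (g (n, poly f z)) (g (Suc n, z))" by (rule aut_edge)
  then show ?thesis
    using tree_edge_iff[OF gV] aut_level[OF fz] aut_level[OF assms] by (auto simp: fib_def)
qed

lemma aut_in_galois_image: "g \<in> arb_galois_group f"
proof -
  \<comment> \<open>The level of \<open>z\<close> is recovered by \<open>THE\<close>, which is
    legitimate because the levels are disjoint.\<close>
  define h where "h z = snd (g (THE m. z \<in> V m, z))" for z
  have h: "h z = snd (g (m, z))" if "z \<in> V m" for m z
  proof -
    have "(THE m. z \<in> V m) = m" using that V_disjoint by blast
    then show ?thesis by (simp add: h_def)
  qed
  have g_eq: "g (m, z) = (m, h z)" if "z \<in> V m" for m z
    using aut_level[OF that] h[OF that] by (simp add: prod_eq_iff)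
  have "bij_betw h (V m) (V m)" for m
  proof -
    have inj: "inj_on h (V m)"
    proof (rule inj_onI)
      fix x y assume xy: "x \<in> V m" "y \<in> V m" "h x = h y"
      then have "g (m, x) = g (m, y)" using g_eq by simp
      then show "x = y" using aut_inj xy by simp
    qed
    have "h ` V m \<subseteq> V m" using aut_vertex g_eq by fastforce
    then have "h ` V m = V m" using finite_V inj by (intro endo_inj_surj)
    then show ?thesis using inj by (simp add: bij_betw_def)
  qed
  moreover have "poly f (h z) = h (poly f z)" if "z \<in> V (Suc m)" for m z
    using aut_parent[OF that] h[OF that] h[of "poly f z" m] that by (simp add: V_Suc_iff)
  ultimately obtain \<sigma> where \<sigma>: "\<sigma> \<in> galQ" "\<forall>n. \<forall>z\<in>V n. \<sigma> z = h z"
    using automorphism_realised[of h] by blast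
  have "g = galois_action f \<sigma>"
  proof
    fix u
    show "g u = galois_action f \<sigma> u"
    proof (cases "u \<in> tree_vertices f")
      case True
      then show ?thesis
        using g_eq[of "snd u" "fst u"] \<sigma>(2) by (simp add: galois_action_def tree_vertices_iff)
    next
      case False
      then show ?thesis using g by (cases u) (simp add: galois_action_def tree_aut_def)
    qed
  qed
  then show ?thesis using \<sigma>(1) by (auto simp: arb_galois_group_def)
qed

end

lemma galois_action_comp:
  assumes "\<tau> \<in> galQ"
  shows "galois_action f \<sigma> \<circ> galois_action f \<tau> = galois_action f (\<sigma> \<circ> \<tau>)"
  using galQ_V[OF assms] by (auto simp: galois_action_def tree_vertices_iff)

lemma arb_galois_group_translate:
  assumes "g \<in> arb_galois_group f"
  shows "(\<lambda>h. g \<circ> h) ` arb_galois_group f = arb_galois_group f"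
proof -
  obtain \<sigma> where \<sigma>: "\<sigma> \<in> galQ" "g = galois_action f \<sigma>"
    using assms by (auto simp: arb_galois_group_def)
  obtain \<sigma>' where \<sigma>': "\<sigma>' \<in> galQ" "\<And>x. algebraic x \<Longrightarrow> \<sigma> (\<sigma>' x) = x"
    using galQ_inv[OF \<sigma>(1)] by blast
  show ?thesis
  proof (intro equalityI subsetI)
    fix h assume "h \<in> (\<lambda>h. g \<circ> h) ` arb_galois_group f"
    then obtain \<tau> where "\<tau> \<in> galQ" "h = g \<circ> galois_action f \<tau>"
      by (auto simp: arb_galois_group_def)
    then show "h \<in> arb_galois_group f"
      using galois_action_comp galQ_comp \<sigma> by (auto simp: arb_galois_group_def)
  next
    fix h assume "h \<in> arb_galois_group f"
    then obtain \<tau> where \<tau>: "\<tau> \<in> galQ" "h = galois_action f \<tau>"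
      by (auto simp: arb_galois_group_def)
    have "g \<circ> galois_action f (\<sigma>' \<circ> \<tau>) = galois_action f (\<sigma> \<circ> (\<sigma>' \<circ> \<tau>))"
      using galois_action_comp galQ_comp \<sigma>' \<tau> \<sigma>(2) by blast
    also have "\<dots> = h"
      using \<sigma>'(2) galQ_algebraic[OF \<tau>(1)] V_algebraic \<tau>(2)
      by (auto simp: galois_action_def tree_vertices_iff)
    finally have "h = g \<circ> galois_action f (\<sigma>' \<circ> \<tau>)" ..
    moreover have "galois_action f (\<sigma>' \<circ> \<tau>) \<in> arb_galois_group f"
      using galQ_comp \<sigma>'(1) \<tau>(1) by (auto simp: arb_galois_group_def)
    ultimately show "h \<in> (\<lambda>h. g \<circ> h) ` arb_galois_group f" by blast
  qed
qed

text \<open>Every automorphism lies in the Galois image, so each coset is the image itself and the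
  index is 1.\<close>

lemma finite_index_arb_galois_group: "finite_index (arb_galois_group f) (tree_aut f)"
proof -
  have "(\<lambda>g. (\<lambda>h. g \<circ> h) ` arb_galois_group f) ` tree_aut f \<subseteq> {arb_galois_group f}"
    using aut_in_galois_image arb_galois_group_translate by blast
  then show ?thesis unfolding finite_index_def by (rule finite_subset) simp
qed

end

theorem theorem1p3:
  fixes p k :: nat
  assumes "prime p" and "p \<ge> 3" and "k > 0" and "\<not> p dvd k"
    and "\<forall>n\<ge>1. rsquarefree (poly_iter (phi_pk p k) n)"
    and "infinite (range (\<lambda>n. (poly (phi_pk p k) ^^ n) (- of_nat (k * (p - 1)))))"
  shows "finite_index (arb_galois_group (phi_pk p k)) (tree_aut (phi_pk p k))"
proof -
  interpret phi_tree p k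
    using assms infinite_orbit_imp_not_3_1[of p k] by unfold_locales auto
  show ?thesis using finite_index_arb_galois_group by (simp only: f_def)
qed

end
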